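(* Assume (A1)–(A4) and run Algorithm SC with event-triggered coefficients $\nu_{ij}=\nu_{ji}\in[0,1/2)$ for all $(i,j)\in\mathcal{E}$ (and arbitrary $b_{ij}=b_{ji}>0$). Then there exist step-size sequences $\{\alpha_{ij,k}\}$ (with $\alpha_{ij,k}=\alpha_{ji,k}>0$) and $\{\beta_{i,k}\}$ (positive) satisfying (i) $\sum_k\alpha_{ij,k}^2<\infty$ and $\sup_k\alpha_{ij,k+1}/\alpha_{ij,k}<\infty$ for all $(i,j)\in\mathcal{E}$; (ii) $\sum_k\beta_{i,k}^2<\infty$ and $\sup_k\beta_{i,k+1}/\beta_{i,k}<\infty$ for all $i$; (iii) $\sum_k\min\{\alpha_{ij,k}/k^{\nu_{ij}},(i,j)\in\mathcal{E};\beta_{i,k},i\in\mathcal{V}\}=\infty$, such that for every $i\in\mathcal{V}$, $\tilde\theta_{i,k}=O\!\left(\sqrt{\ln k}/k^{1/2-\bar\nu/2}\right)$ almost surely, where $\bar\nu=\max_{(i,j)\in\mathcal{E}}\nu_{ij}$.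
   Context: Network: undirected weighted graph with sensor set $\mathcal{V}=\{1,\dots,N\}$, symmetric nonnegative weights $a_{ij}=a_{ji}$, with $a_{ij}>0$ iff $(i,j)\in\mathcal{E}$; the edge set $\mathcal{E}$ is regarded as a set of ordered pairs that is symmetric ($(i,j)\in\mathcal{E}\iff(j,i)\in\mathcal{E}$), $M=|\mathcal{E}|/2$ is the number of undirected edges, and $\mathcal{N}_i=\{j:(i,j)\in\mathcal{E}\}$. The Laplacian is $\mathcal{L}=\mathcal{D}-\mathcal{A}$ with $\mathcal{A}=(a_{ij})$, $\mathcal{D}=\mathrm{diag}(\sum_{j\in\mathcal{N}_i}a_{ij})$; $\lambda_2(\mathcal{L})$ is its second smallest eigenvalue. Observations: unknown $\theta\in\mathbb{R}^n$; sensor $i$ observes $y_{i,k}=H_{i,k}\theta+w_{i,k}$, $k\ge1$, with deterministic $H_{i,k}\in\mathbb{R}^{m_i\times n}$ and noise $w_{i,k}\in\mathbb{R}^{m_i}$. Let $d_{i,k}$ ($i\in\mathcal{V},k\ge1$) be the dithering noises used below, $\mathcal{F}_k=\sigma(w_{i,t},d_{i,t}: i\in\mathcal{V},1\le t\le k)$ and $\mathcal{F}^w_k=\sigma(w_{i,t}: i\in\mathcal{V},1\le t\le k)$. Assumptions. (A1) There is $\bar H>0$ with $\|H_{i,k}\|\le\bar H$ for all $i,k$, and there are a positive integer $p$ and $\delta>0$ with $\frac1p\sum_{t=k}^{k+p-1}\sum_{i=1}^N H_{i,t}^\top H_{i,t}\ge\delta I_n$ for all $k\ge1$. (A2) $\{w_{i,k},\mathcal{F}_k\}$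 is a martingale difference sequence and $\sup_{i,k}\mathbb{E}[\|w_{i,k}\|^\rho\mid\mathcal{F}^w_{k-1}]<\infty$ a.s. for some $\rho>2$. (A3) The graph is connected, i.e. $\mathrm{rank}(\mathcal{L})=N-1$. (A4) The $d_{i,k}$ are i.i.d. with the Laplace distribution $\mathrm{Lap}(0,1)$ (density $f(x)=\frac12e^{-|x|}$, distribution function $F$), mutually independent over all $(i,k)$, and independent of all $w_{j,t}$. Algorithm SC. Inputs: deterministic initial estimates $\hat\theta_{i,0}\in\mathbb{R}^n$; event-triggered coefficients $\nu_{ij}=\nu_{ji}\ge0$; noise coefficients $b_{ij}=b_{ji}>0$; step sizes $\alpha_{ij,k}=\alpha_{ji,k}>0$ ($(i,j)\in\mathcal{E}$) and $\beta_{i,k}>0$. For $k=1,2,\dots$: let $\varphi_k\in\mathbb{R}^n$ be the $l$-th standard basis vector, where $k=nq+l$ with $q\in\mathbb{N}\cup\{0\}$, $l\in\{1,\dots,n\}$; set $x_{i,k}=\varphi_k^\top\hat\theta_{i,k-1}$; set $C_{ij,k}=\nu_{ij}b_{ij}\ln k$; set $s_{ij,k}=1$ if $x_{i,k}+b_{ij}d_{i,k}>0$ and $s_{ij,k}=-1$ otherwise. Sensor $i$ sends the one-bit message $s_{ij,k}$ to neighbor $j$ iff $|x_{i,k}+b_{ij}d_{i,k}|>C_{ij,k}$; sensor $i$ sets $\hat s_{ji,k}=s_{ji,k}$ if it received $s_{ji,k}$ from $j$, and $\hat s_{ji,k}=0$ otherwise. With $G_{ij,k}(x)=F((x-C_{ij,k})/b_{ij})-F((-x-C_{ij,k})/b_{ij})$,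 update $\check\theta_{i,k}=\hat\theta_{i,k-1}+\varphi_k\sum_{j\in\mathcal{N}_i}\alpha_{ij,k}a_{ij}(\hat s_{ji,k}-G_{ij,k}(x_{i,k}))$, $\hat\theta_{i,k}=\check\theta_{i,k}+\beta_{i,k}H_{i,k}^\top(y_{i,k}-H_{i,k}\hat\theta_{i,k-1})$. Write $\tilde\theta_{i,k}=\hat\theta_{i,k}-\theta$. "$X_k=O(r_k)$ a.s." means $\sup_k\|X_k\|/r_k<\infty$ almost surely. *)

theory Defs
  imports "HOL-Probability.Probability"
begin

text \<open>Vectors of R^n and R^m are represented as functions nat => real, only the
components with index below the dimension being relevant; matrices in R^(m x n)
as functions nat => nat => real (row, column).\<close>

definition vnorm :: "nat \<Rightarrow> (nat \<Rightarrow> real) \<Rightarrow> real" where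
  "vnorm n x = sqrt (\<Sum>c<n. (x c)\<^sup>2)"

definition mnorm :: "nat \<Rightarrow> nat \<Rightarrow> (nat \<Rightarrow> nat \<Rightarrow> real) \<Rightarrow> real" where
  "mnorm m n A = sqrt (\<Sum>r<m. \<Sum>c<n. (A r c)\<^sup>2)"

definition mat_vec :: "nat \<Rightarrow> (nat \<Rightarrow> nat \<Rightarrow> real) \<Rightarrow> (nat \<Rightarrow> real) \<Rightarrow> (nat \<Rightarrow> real)" where
  "mat_vec n A x = (\<lambda>r. \<Sum>c<n. A r c * x c)"

definition matT_vec :: "nat \<Rightarrow> (nat \<Rightarrow> nat \<Rightarrow> real) \<Rightarrow> (nat \<Rightarrow> real) \<Rightarrow> (nat \<Rightarrow> real)" where
  "matT_vec m A v = (\<lambda>c. \<Sum>r<m. A r c * v r)"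

definition lap_cdf :: "real \<Rightarrow> real" where
  "lap_cdf x = (if x < 0 then exp x / 2 else 1 - exp (- x) / 2)"

definition laplacian :: "('v::finite \<Rightarrow> 'v \<Rightarrow> real) \<Rightarrow> real^'v^'v" where
  "laplacian a = (\<chi> i j. (if i = j then (\<Sum>l\<in>{l. a i l > 0}. a i l) else 0) - a i j)"

definition gen_sigma :: "'a measure \<Rightarrow> ('a \<Rightarrow> real) set \<Rightarrow> 'a measure" where
  "gen_sigma M fs = sigma (space M) {f -` A \<inter> space M | f A. f \<in> fs \<and> A \<in> sets borel}"

text \<open>Algorithm SC.  Index of the coordinate selected by phi_k (0-based):
  k = n q + l with l in {1..n} gives coordinate l - 1 = (k - 1) mod n.\<close>
definition sc_coord :: "nat \<Rightarrow> nat \<Rightarrow> nat" where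
  "sc_coord n k = (k - 1) mod n"

definition sc_thr :: "('v \<Rightarrow> 'v \<Rightarrow> real) \<Rightarrow> ('v \<Rightarrow> 'v \<Rightarrow> real) \<Rightarrow> 'v \<Rightarrow> 'v \<Rightarrow> nat \<Rightarrow> real" where
  "sc_thr \<nu> b i j k = \<nu> i j * b i j * ln (real k)"

definition sc_msg :: "('v \<Rightarrow> 'v \<Rightarrow> real) \<Rightarrow> ('v \<Rightarrow> 'v \<Rightarrow> real) \<Rightarrow> real \<Rightarrow> real \<Rightarrow> 'v \<Rightarrow> 'v \<Rightarrow> nat \<Rightarrow> real" where
  "sc_msg \<nu> b xj dj j i k =
     (let z = xj + b j i * dj in
      if \<bar>z\<bar> > sc_thr \<nu> b j i k then (if z > 0 then 1 else -1) else 0)"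

definition sc_G :: "('v \<Rightarrow> 'v \<Rightarrow> real) \<Rightarrow> ('v \<Rightarrow> 'v \<Rightarrow> real) \<Rightarrow> 'v \<Rightarrow> 'v \<Rightarrow> nat \<Rightarrow> real \<Rightarrow> real" where
  "sc_G \<nu> b i j k x =
     lap_cdf ((x - sc_thr \<nu> b i j k) / b i j) - lap_cdf ((- x - sc_thr \<nu> b i j k) / b i j)"

text \<open>sc_est n m a nu b alpha beta H theta0 y d k i = hat theta_{i,k}, for the
  observation sequence y (y i k : R^(m i)) and dithering sequence d.\<close>
primrec sc_est ::
  "nat \<Rightarrow> ('v::finite \<Rightarrow> nat) \<Rightarrow> ('v \<Rightarrow> 'v \<Rightarrow> real) \<Rightarrow> ('v \<Rightarrow> 'v \<Rightarrow> real) \<Rightarrow> ('v \<Rightarrow> 'v \<Rightarrow> real)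
   \<Rightarrow> ('v \<Rightarrow> 'v \<Rightarrow> nat \<Rightarrow> real) \<Rightarrow> ('v \<Rightarrow> nat \<Rightarrow> real) \<Rightarrow> ('v \<Rightarrow> nat \<Rightarrow> nat \<Rightarrow> nat \<Rightarrow> real)
   \<Rightarrow> ('v \<Rightarrow> nat \<Rightarrow> real) \<Rightarrow> ('v \<Rightarrow> nat \<Rightarrow> nat \<Rightarrow> real) \<Rightarrow> ('v \<Rightarrow> nat \<Rightarrow> real)
   \<Rightarrow> nat \<Rightarrow> 'v \<Rightarrow> (nat \<Rightarrow> real)" where
  "sc_est n m a \<nu> b \<alpha> \<beta> H \<theta>0 y d 0 = \<theta>0"
| "sc_est n m a \<nu> b \<alpha> \<beta> H \<theta>0 y d (Suc k') =
     (let k = Suc k';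
          prev = sc_est n m a \<nu> b \<alpha> \<beta> H \<theta>0 y d k';
          l = sc_coord n k;
          x = (\<lambda>i. prev i l)
      in (\<lambda>i c.
            prev i c
            + (if c = l then
                 (\<Sum>j\<in>{j. a i j > 0}. \<alpha> i j k * a i j *
                    (sc_msg \<nu> b (x j) (d j k) j i k - sc_G \<nu> b i j k (x i)))
               else 0)
            + \<beta> i k * matT_vec (m i) (H i k)
                 (\<lambda>r. y i k r - mat_vec n (H i k) (prev i) r) c))"

end

theory Submission
  imports Defs "HOL-Real_Asymp.Real_Asymp"
begin

text \<open>
  The step sizes are \<open>A k\<^bsup>\<nu> - 1\<^esup>\<close> and \<open>B / k\<close> with large constants. On bounded arguments the slope of \<open>G\<close> is of
  order \<open>k\<^bsup>-\<nu>\<^esup>\<close>, so the error obeys \<open>x\<^sub>k = x\<^bsub>k-1\<^esub> - Q\<^sub>k x\<^bsub>k-1\<^esub> / k + noise\<close> with \<open>Q\<^sub>k\<close> positive semidefinite,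
  bounded, and coercive over windows by connectedness and persistent excitation.

  All probability enters through exponential supermartingales. The observation noise is truncated at \<open>t\<^sup>q\<close> with
  \<open>1/\<rho> < q < 1/2\<close>, and its sums are \<open>O(\<surd>(k ln k))\<close>. The dither sums are controlled by their predictable
  variance, the probability of sending, which is \<open>O(k\<^bsup>-\<nu>\<^esup>)\<close> only along bounded paths. Boundedness is therefore
  shown first, by applying Ville's inequality to the martingale part of the logarithm of the squared error.

  Averaged noise of order \<open>r\<^sub>k = \<surd>(ln k) / k\<^bsup>(1 - \<nu>)/2\<^esup>\<close> can then be subtracted, which leaves a deterministic
  perturbed linear recursion. A first pass with a path dependent contraction constant gives consistency; the
  slope of \<open>G\<close> near \<open>\<theta>\<close> is then bounded below by a known constant and the second pass gives the rate \<open>r\<^sub>k\<close>.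
\<close>

section \<open>Connected graphs and the Laplace distribution\<close>

text \<open>The edge step size times the slope of \<open>G\<close> is of order 1/k, the same as the
  innovation step, so consensus and learning act on one time scale. A contraction c/k per step gives
  decay \<open>k powr (- c)\<close>, hence the constants must be large enough to beat the target
  exponent. The obstacle is circular: the guaranteed slope decays exponentially in the size of the
  estimates, and this size is random, so no constants fixed in advance ensure a given contraction on
  every path. They are therefore calibrated for estimates within distance 1 of \<theta> only, and
  everything before that point has to work with an arbitrarily small contraction. The exponent of
  the rate is a variance computation: the dither summed with weights \<open>t powr \<nu>\<close> has
  variance of order \<open>k powr (1 + \<nu>)\<close> when messages are sent with probability
  \<open>t powr (- \<nu>)\<close>. With the trivial bound on that probability the exponent would
  only be 1/2 - \<nu>. The condition \<nu> < 1/2 makes the squared dither increments, of order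
  \<open>t powr (2 * \<nu> - 2)\<close>, summable, which is what boundedness rests on.\<close>

lemma laplacian_mult_vec_eq_0:
  fixes a :: "'v::finite \<Rightarrow> 'v \<Rightarrow> real"
  assumes a_nonneg: "\<And>i j. a i j \<ge> 0"
    and eq: "\<And>i j. a i j > 0 \<Longrightarrow> v $ i = v $ j"
  shows "laplacian a *v v = 0"
proof -
  have "(laplacian a *v v) $ i = 0" for i
  proof -
    have "(laplacian a *v v) $ i
        = (\<Sum>j\<in>UNIV. (if i = j then (\<Sum>l\<in>{l. a i l > 0}. a i l) * v $ j else 0) - a i j * v $ j)"
      unfolding laplacian_def matrix_vector_mult_def by (auto simp: algebra_simps intro!: sum.cong)
    also have "\<dots> = (\<Sum>l\<in>{l. a i l > 0}. a i l) * v $ i - (\<Sum>j\<in>UNIV. a i j * v $ j)"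
      by (simp add: sum_subtractf)
    also have "(\<Sum>j\<in>UNIV. a i j * v $ j) = (\<Sum>j\<in>{l. a i l > 0}. a i j * v $ j)"
      by (rule sum.mono_neutral_right) (use a_nonneg in \<open>auto simp: less_le\<close>)
    also have "\<dots> = (\<Sum>j\<in>{l. a i l > 0}. a i j * v $ i)"
      using eq by (auto intro!: sum.cong)
    finally show ?thesis by (simp add: sum_distrib_right)
  qed
  then show ?thesis by (simp add: vec_eq_iff)
qed

text \<open>The row space has dimension N - 1, so its orthogonal complement \<open>K\<close> is a
  line. Every vector constant along edges lies in \<open>K\<close>; a proper nonempty closed set
  would put both the all-ones vector and its own indicator there, and these are independent.\<close>

lemma laplacian_rank_connected:
  fixes a :: "'v::finite \<Rightarrow> 'v \<Rightarrow> real"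
  assumes a_sym: "\<And>i j. a i j = a j i"
    and a_nonneg: "\<And>i j. a i j \<ge> 0"
    and rank: "rank (laplacian a) = CARD('v) - 1"
    and ne: "S \<noteq> {}"
    and closed: "\<And>i j. i \<in> S \<Longrightarrow> a i j > 0 \<Longrightarrow> j \<in> S"
  shows "S = UNIV"
proof (rule ccontr)
  assume not: "S \<noteq> UNIV"
  define K where "K = {y \<in> (UNIV::(real^'v) set). \<forall>x\<in>span (rows (laplacian a)). orthogonal x y}"
  have "dim K + dim (span (rows (laplacian a))) = dim (UNIV :: (real^'v) set)"
    unfolding K_def by (rule dim_subspace_orthogonal_to_vectors) auto
  moreover have "dim (span (rows (laplacian a))) = CARD('v) - 1"
    using rank by (simp add: row_rank_def)
  moreover have "CARD('v) > 0" by simp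
  ultimately have dimK: "dim K = 1" unfolding dim_UNIV DIM_cart by (metis add_diff_cancel_right' diff_diff_cancel less_one linorder_not_le DIM_real mult.right_neutral Suc_leI One_nat_def)
  have inK: "v \<in> K" if "\<And>i j. a i j > 0 \<Longrightarrow> v $ i = v $ j" for v
  proof -
    have 0: "laplacian a *v v = 0" using laplacian_mult_vec_eq_0[OF a_nonneg that] .
    have "orthogonal v x" if "x \<in> rows (laplacian a)" for x
    proof -
      obtain i where "x = row i (laplacian a)" using \<open>x \<in> rows (laplacian a)\<close> by (auto simp: rows_def)
      then have "x \<bullet> v = (laplacian a *v v) $ i"
        by (simp add: matrix_vector_mul_component row_def inner_vec_def matrix_vector_mult_def)
      then show ?thesis using 0 by (simp add: orthogonal_def inner_commute)
    qed
    then have "\<forall>x\<in>span (rows (laplacian a)). orthogonal x v"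
      using orthogonal_to_span orthogonal_commute by blast
    then show ?thesis by (simp add: K_def)
  qed
  define one :: "real^'v" where "one = (\<chi> i. 1)"
  define c :: "real^'v" where "c = (\<chi> i. if i \<in> S then 1 else 0)"
  have "one \<in> K" by (rule inK) (simp add: one_def)
  moreover have "c \<in> K"
  proof (rule inK)
    fix i j assume "a i j > 0"
    then have "i \<in> S \<longleftrightarrow> j \<in> S" using closed a_sym by metis
    then show "c $ i = c $ j" by (simp add: c_def)
  qed
  moreover obtain s where s: "s \<in> S" using ne by blast
  moreover obtain t where t: "t \<notin> S" using not by blast
  have "one \<noteq> c"
  proof
    assume "one = c"
    then have "one $ t = c $ t" by simp
    then show False using t by (simp add: one_def c_def)
  qed
  moreover have "independent {one, c}"
  proof -
    have "c \<noteq> 0"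
    proof
      assume "c = 0"
      then have "c $ s = 0" by simp
      then show False using s by (simp add: c_def)
    qed
    moreover have "one \<notin> span {c}"
    proof
      assume "one \<in> span {c}"
      then obtain r where "one = r *\<^sub>R c" by (auto simp: span_singleton)
      then have "one $ t = r * c $ t" by simp
      then show False using t by (simp add: one_def c_def)
    qed
    ultimately show ?thesis using \<open>one \<noteq> c\<close> by (simp add: independent_insert)
  qed
  ultimately have "card {one, c} \<le> dim K"
    by (intro independent_card_le_dim) auto
  then show False using dimK \<open>one \<noteq> c\<close> by simp
qed

text \<open>The constant plays the role of an inverse spectral gap but is produced by connectedness
  alone: the nodes whose squared deviation from \<open>o'\<close> is bounded by a multiple of the
  energy form a nonempty set closed under edges. Crossing an edge replaces the multiple K by
  \<open>2 / a i j + 2 * K\<close>.\<close>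

lemma connected_poincare:
  fixes a :: "'v::finite \<Rightarrow> 'v \<Rightarrow> real" and o' :: 'v
  assumes a_sym: "\<And>i j. a i j = a j i"
    and a_nonneg: "\<And>i j. a i j \<ge> 0"
    and rank: "rank (laplacian a) = CARD('v) - 1"
  obtains K where "K > 0" "\<And>u::'v \<Rightarrow> real. (\<Sum>i\<in>UNIV. (u i - u o')\<^sup>2) \<le> K * (\<Sum>i\<in>UNIV. \<Sum>j\<in>UNIV. a i j * (u i - u j)\<^sup>2)"
proof -
  define En where "En u = (\<Sum>i\<in>UNIV. \<Sum>j\<in>UNIV. a i j * (u i - u j)\<^sup>2)" for u :: "'v \<Rightarrow> real"
  have En_nonneg: "En u \<ge> 0" for u unfolding En_def using a_nonneg by (intro sum_nonneg mult_nonneg_nonneg) auto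
  have edge: "a i j * (u i - u j)\<^sup>2 \<le> En u" for i j u
  proof -
    have "a i j * (u i - u j)\<^sup>2 \<le> (\<Sum>j\<in>UNIV. a i j * (u i - u j)\<^sup>2)"
      by (rule member_le_sum) (use a_nonneg in auto)
    also have "\<dots> \<le> En u" unfolding En_def
      by (rule member_le_sum[where f = "\<lambda>i. (\<Sum>j\<in>UNIV. a i j * (u i - u j)\<^sup>2)"])
         (use a_nonneg in \<open>auto intro!: sum_nonneg\<close>)
    finally show ?thesis .
  qed
  define S where "S = {i. \<exists>K\<ge>0. \<forall>u. (u i - u o')\<^sup>2 \<le> K * En u}"
  have "S = UNIV"
  proof (rule laplacian_rank_connected[OF a_sym a_nonneg rank])
    have "o' \<in> S" unfolding S_def by (auto intro!: exI[of _ 0])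
    then show "S \<noteq> {}" by blast
  next
    fix i j assume i: "i \<in> S" and aij: "a i j > 0"
    obtain K where K: "K \<ge> 0" "\<And>u. (u i - u o')\<^sup>2 \<le> K * En u" using i unfolding S_def by auto
    have "(u j - u o')\<^sup>2 \<le> (2 / a i j + 2 * K) * En u" for u
    proof -
      have "(u j - u o')\<^sup>2 \<le> 2 * (u i - u j)\<^sup>2 + 2 * (u i - u o')\<^sup>2"
        using sum_squares_ge_zero[of "(u i - u j) + (u i - u o')" 0] by (simp add: power2_eq_square algebra_simps)
      also have "(u i - u j)\<^sup>2 \<le> En u / a i j"
        using edge[of i j u] aij by (simp add: field_simps)
      also have "(u i - u o')\<^sup>2 \<le> K * En u" by (rule K)
      finally show ?thesis by (simp add: algebra_simps)
    qed
    then show "j \<in> S" unfolding S_def using aij K by (auto intro!: exI[of _ "2 / a i j + 2 * K"])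
  qed
  then have "\<forall>i. \<exists>K\<ge>0. \<forall>u. (u i - u o')\<^sup>2 \<le> K * En u" unfolding S_def by auto
  then obtain K where K: "\<And>i. K i \<ge> 0" "\<And>i u. (u i - u o')\<^sup>2 \<le> K i * En u" by metis
  show ?thesis
  proof (rule that[of "1 + (\<Sum>i\<in>UNIV. K i)"])
    show "1 + (\<Sum>i\<in>UNIV. K i) > 0" using sum_nonneg[of UNIV K] K by (simp add: add_pos_nonneg)
    fix u
    have "(\<Sum>i\<in>UNIV. (u i - u o')\<^sup>2) \<le> (\<Sum>i\<in>UNIV. K i * En u)" by (intro sum_mono K)
    also have "\<dots> \<le> (1 + (\<Sum>i\<in>UNIV. K i)) * En u" using En_nonneg[of u] by (simp add: sum_distrib_right[symmetric] ring_distribs)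
    finally show "(\<Sum>i\<in>UNIV. (u i - u o')\<^sup>2) \<le> (1 + (\<Sum>i\<in>UNIV. K i)) * (\<Sum>i\<in>UNIV. \<Sum>j\<in>UNIV. a i j * (u i - u j)\<^sup>2)"
      unfolding En_def .
  qed
qed

section \<open>The Laplace distribution function and the smoothed one-bit nonlinearity\<close>

lemma lap_cdf_minus: "lap_cdf (- x) = 1 - lap_cdf x"
  by (auto simp: lap_cdf_def)

text \<open>For nonnegative arguments this is exp x + exp (- x) \<ge> 2. Having the exponential
  bound on the whole line spares \<open>lap_send_le\<close> a case distinction on the
  threshold.\<close>

lemma lap_cdf_le_exp: "lap_cdf x \<le> exp x / 2"
proof (cases "x < 0")
  case False
  have "0 \<le> (exp (x/2) - exp (-x/2))\<^sup>2" by simp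
  also have "\<dots> = exp x + exp (-x) - 2"
    by (simp add: power2_diff exp_double[symmetric] exp_minus_inverse flip: exp_add)
  finally show ?thesis using False by (simp add: lap_cdf_def)
qed (simp add: lap_cdf_def)

lemma lap_cdf_nonneg: "0 \<le> lap_cdf x"
  using exp_le_one_iff[of "-x"] by (auto simp: lap_cdf_def simp del: exp_le_one_iff)

lemma lap_cdf_le_1: "lap_cdf x \<le> 1"
  using lap_cdf_nonneg[of "-x"] by (simp add: lap_cdf_minus)

lemma DERIV_lap_cdf: "DERIV lap_cdf x :> exp (- \<bar>x\<bar>) / 2"
proof -
  have "((\<lambda>x. if x \<in> {..0} then exp x / 2 else 1 - exp (- x) / 2) has_vector_derivative
     (if x \<in> {..0} then exp x / 2 else exp (- x) / 2)) (at x within UNIV)"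
  proof (rule has_vector_derivative_If_within_closures)
    show "UNIV = {..0::real} \<union> {0..}" by auto
    show "((\<lambda>x. exp x / 2) has_vector_derivative exp x / 2)
        (at x within {..0} \<union> closure {..0} \<inter> closure {0..})" for x :: real
      unfolding has_real_derivative_iff_has_vector_derivative[symmetric]
      by (auto intro!: derivative_eq_intros)
    show "((\<lambda>x. 1 - exp (- x) / 2) has_vector_derivative exp (- x) / 2)
        (at x within {0..} \<union> closure {..0} \<inter> closure {0..})" for x :: real
      unfolding has_real_derivative_iff_has_vector_derivative[symmetric]
      by (auto intro!: derivative_eq_intros)
  qed auto
  moreover have "(\<lambda>x. if x \<in> {..0} then exp x / 2 else 1 - exp (- x) / 2) = lap_cdf"
    by (auto simp: lap_cdf_def fun_eq_iff)
  moreover have "(if x \<in> {..0} then exp x / 2 else exp (- x) / 2) = exp (- \<bar>x\<bar>) / 2" by auto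
  ultimately show ?thesis by (simp only: has_real_derivative_iff_has_vector_derivative)
qed

lemma lap_cdf_borel [measurable]: "lap_cdf \<in> borel_measurable borel"
  unfolding lap_cdf_def by measurable

lemma filterlim_lap_cdf_at_top: "(lap_cdf \<longlongrightarrow> 1) at_top"
proof (rule Lim_transform_eventually)
  show "((\<lambda>x::real. 1 - exp (- x) / 2) \<longlongrightarrow> 1) at_top" by real_asymp
  show "\<forall>\<^sub>F x in at_top. 1 - exp (- x) / 2 = lap_cdf x"
    using eventually_ge_at_top[of 0] by eventually_elim (auto simp: lap_cdf_def)
qed

text \<open>\<open>lap_trans C b\<close> is the function \<open>G\<close> of the algorithm for threshold \<open>C\<close>, and
  \<open>lap_send C b x\<close> is the probability that \<open>\<bar>x + b d\<bar> > C\<close> for Laplacian \<open>d\<close>.\<close>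

definition lap_trans :: "real \<Rightarrow> real \<Rightarrow> real \<Rightarrow> real" where
  "lap_trans C b x = lap_cdf ((x - C) / b) - lap_cdf ((- x - C) / b)"

definition lap_send :: "real \<Rightarrow> real \<Rightarrow> real \<Rightarrow> real" where
  "lap_send C b x = lap_cdf ((x - C) / b) + lap_cdf ((- x - C) / b)"

lemma sc_G_eq: "sc_G \<nu> b i j k x = lap_trans (sc_thr \<nu> b i j k) (b i j) x"
  by (simp add: sc_G_def lap_trans_def)

lemma lap_trans_borel [measurable]: "lap_trans C b \<in> borel_measurable borel"
  unfolding lap_trans_def by measurable

lemma lap_send_borel [measurable]: "lap_send C b \<in> borel_measurable borel"
  unfolding lap_send_def by measurable

lemma abs_lap_trans_le_1: "\<bar>lap_trans C b x\<bar> \<le> 1"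
  using lap_cdf_nonneg[of "(x - C) / b"] lap_cdf_nonneg[of "(- x - C) / b"]
    lap_cdf_le_1[of "(x - C) / b"] lap_cdf_le_1[of "(- x - C) / b"]
  by (auto simp: lap_trans_def)

lemma lap_send_nonneg: "0 \<le> lap_send C b x"
  by (simp add: lap_send_def lap_cdf_nonneg)

text \<open>For the threshold \<nu> b ln k the factor \<open>exp (- C / b)\<close> equals
  \<open>k powr (- \<nu>)\<close>: on bounded arguments the sending probability, and with it the
  conditional variance of the dither noise, decays at this rate.\<close>

lemma lap_send_le:
  assumes "b > 0" "\<bar>x\<bar> \<le> R"
  shows "lap_send C b x \<le> exp (R / b) * exp (- C / b)"
proof -
  have "lap_send C b x \<le> exp ((x - C) / b) / 2 + exp ((- x - C) / b) / 2"
    unfolding lap_send_def by (intro add_mono lap_cdf_le_exp)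
  also have "exp ((x - C) / b) \<le> exp ((R - C) / b)" using assms by (auto intro!: divide_right_mono)
  also have "exp ((- x - C) / b) \<le> exp ((R - C) / b)" using assms by (auto intro!: divide_right_mono)
  finally show ?thesis by (simp add: diff_divide_distrib exp_diff exp_minus field_simps)
qed

definition lap_trans_deriv :: "real \<Rightarrow> real \<Rightarrow> real \<Rightarrow> real" where
  "lap_trans_deriv C b x = (exp (- \<bar>(x - C) / b\<bar>) + exp (- \<bar>(- x - C) / b\<bar>)) / (2 * b)"

lemma DERIV_lap_trans:
  "DERIV (lap_trans C b) x :> lap_trans_deriv C b x"
proof (cases "b = 0")
  case False
  have "DERIV (\<lambda>x. lap_cdf ((x - C) / b)) x :> exp (- \<bar>(x - C) / b\<bar>) / 2 * (1 / b)"
    by (rule DERIV_chain2[OF DERIV_lap_cdf]) (use False in \<open>auto intro!: derivative_eq_intros\<close>)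
  moreover have "DERIV (\<lambda>x. lap_cdf ((- x - C) / b)) x :> exp (- \<bar>(- x - C) / b\<bar>) / 2 * (- 1 / b)"
    by (rule DERIV_chain2[OF DERIV_lap_cdf]) (use False in \<open>auto intro!: derivative_eq_intros\<close>)
  ultimately show ?thesis
    unfolding lap_trans_def lap_trans_deriv_def using False
    by (auto intro!: derivative_eq_intros simp: field_simps)
next
  \<comment> \<open>Division by zero makes both arguments of \<open>lap_cdf\<close> equal to 0, so
    the function vanishes identically, and the formula for the derivative gives 0 as well.\<close>
  case True
  have "lap_trans C 0 = (\<lambda>x. 0)" by (auto simp: lap_trans_def)
  then show ?thesis using True by (simp add: lap_trans_deriv_def)
qed

text \<open>The arguments lie at distance between C - R and C + R from the kinks of the two
  distribution functions, so on bounded sets the derivative is of exact order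
  \<open>exp (- C / b)\<close>. The bound 1 / b does not involve R and serves as long as boundedness
  is unknown.\<close>

lemma lap_trans_deriv_bounds:
  assumes "b > 0" "C \<ge> 0" "\<bar>x\<bar> \<le> R"
  shows "exp (- R / b) / b * exp (- C / b) \<le> lap_trans_deriv C b x"
    and "lap_trans_deriv C b x \<le> exp (R / b) / b * exp (- C / b)"
    and "0 \<le> lap_trans_deriv C b x" "lap_trans_deriv C b x \<le> 1 / b"
proof -
  have lo: "exp (- (R + C) / b) \<le> exp (- \<bar>y / b\<bar>)" if "\<bar>y\<bar> \<le> R + C" for y
    using that assms divide_right_mono[of "\<bar>y\<bar>" "R + C" b] by (simp add: abs_divide diff_divide_distrib add_divide_distrib)
  have hi: "exp (- \<bar>y / b\<bar>) \<le> exp ((R - C) / b)" if "\<bar>y\<bar> \<ge> C - R" for y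
    using that assms divide_right_mono[of "C - R" "\<bar>y\<bar>" b] by (simp add: abs_divide diff_divide_distrib)
  have "2 * exp (- (R + C) / b) \<le> exp (- \<bar>(x - C) / b\<bar>) + exp (- \<bar>(- x - C) / b\<bar>)"
    using lo[of "x - C"] lo[of "- x - C"] assms by linarith
  then have "2 * exp (- (R + C) / b) / (2 * b) \<le> lap_trans_deriv C b x"
    unfolding lap_trans_deriv_def using assms by (intro divide_right_mono) auto
  then have "exp (- (R + C) / b) / b \<le> lap_trans_deriv C b x" by simp
  then show "exp (- R / b) / b * exp (- C / b) \<le> lap_trans_deriv C b x"
    by (simp add: diff_divide_distrib add_divide_distrib exp_diff exp_minus exp_add field_simps)
  have "exp (- \<bar>(x - C) / b\<bar>) + exp (- \<bar>(- x - C) / b\<bar>) \<le> 2 * exp ((R - C) / b)"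
    using hi[of "x - C"] hi[of "- x - C"] assms by linarith
  then have "lap_trans_deriv C b x \<le> 2 * exp ((R - C) / b) / (2 * b)"
    unfolding lap_trans_deriv_def using assms by (intro divide_right_mono) auto
  then have "lap_trans_deriv C b x \<le> exp ((R - C) / b) / b" by simp
  then show "lap_trans_deriv C b x \<le> exp (R / b) / b * exp (- C / b)"
    by (simp add: diff_divide_distrib exp_diff exp_minus field_simps)
  show "0 \<le> lap_trans_deriv C b x" unfolding lap_trans_deriv_def using assms by simp
  have "exp (- \<bar>(x - C) / b\<bar>) \<le> 1" "exp (- \<bar>(- x - C) / b\<bar>) \<le> 1" by auto
  then have "exp (- \<bar>(x - C) / b\<bar>) + exp (- \<bar>(- x - C) / b\<bar>) \<le> 2" by linarith
  then have "lap_trans_deriv C b x \<le> 2 / (2 * b)"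
    unfolding lap_trans_deriv_def using assms by (intro divide_right_mono) auto
  then show "lap_trans_deriv C b x \<le> 1 / b" by simp
qed

text \<open>The divided difference turns the nonlinear consensus term into a linear operator with
  path-dependent symmetric weights. The derivative on the diagonal keeps the two-sided bounds valid
  when both arguments coincide.\<close>

definition lap_slope :: "real \<Rightarrow> real \<Rightarrow> real \<Rightarrow> real \<Rightarrow> real" where
  "lap_slope C b x y = (if x = y then lap_trans_deriv C b x
     else (lap_trans C b x - lap_trans C b y) / (x - y))"

lemma lap_slope_sym: "lap_slope C b x y = lap_slope C b y x"
  unfolding lap_slope_def using minus_divide_divide[of "lap_trans C b x - lap_trans C b y" "x - y"] by simp

lemma lap_slope_mult: "lap_slope C b x y * (x - y) = lap_trans C b x - lap_trans C b y"
  by (simp add: lap_slope_def)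

lemma lap_slope_mean:
  obtains z where "lap_slope C b x y = lap_trans_deriv C b z" "\<bar>z\<bar> \<le> max \<bar>x\<bar> \<bar>y\<bar>"
proof -
  have *: "\<exists>z. lap_slope C b x y = lap_trans_deriv C b z \<and> \<bar>z\<bar> \<le> max \<bar>x\<bar> \<bar>y\<bar>" if "x < y" for x y
  proof -
    obtain z where "x < z" "z < y" "lap_trans C b y - lap_trans C b x = (y - x) * lap_trans_deriv C b z"
      using MVT2[of x y "lap_trans C b" "lap_trans_deriv C b"] DERIV_lap_trans \<open>x < y\<close> by blast
    then have "lap_slope C b y x = lap_trans_deriv C b z" "\<bar>z\<bar> \<le> max \<bar>x\<bar> \<bar>y\<bar>"
      using that by (auto simp: lap_slope_def)
    then show ?thesis by (metis lap_slope_sym)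
  qed
  show thesis
  proof (cases x y rule: linorder_cases)
    case equal then show thesis by (intro that[of x]) (auto simp: lap_slope_def)
  next
    case less then show thesis using *[of x y] that by blast
  next
    case greater then show thesis using *[of y x] that by (auto simp: lap_slope_sym max.commute)
  qed
qed

lemma lap_slope_bounds:
  assumes "b > 0" "C \<ge> 0"
  shows "0 \<le> lap_slope C b x y" "lap_slope C b x y \<le> 1 / b"
    and "\<bar>x\<bar> \<le> R \<Longrightarrow> \<bar>y\<bar> \<le> R \<Longrightarrow> exp (- R / b) / b * exp (- C / b) \<le> lap_slope C b x y"
    and "\<bar>x\<bar> \<le> R \<Longrightarrow> \<bar>y\<bar> \<le> R \<Longrightarrow> lap_slope C b x y \<le> exp (R / b) / b * exp (- C / b)"
proof -
  obtain z where z: "lap_slope C b x y = lap_trans_deriv C b z" "\<bar>z\<bar> \<le> max \<bar>x\<bar> \<bar>y\<bar>"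
    by (rule lap_slope_mean)
  show "0 \<le> lap_slope C b x y" "lap_slope C b x y \<le> 1 / b"
    using lap_trans_deriv_bounds(3,4)[OF assms order.refl, of z] z by simp_all
  assume "\<bar>x\<bar> \<le> R" "\<bar>y\<bar> \<le> R"
  then have "\<bar>z\<bar> \<le> R" using z(2) by linarith
  then show "exp (- R / b) / b * exp (- C / b) \<le> lap_slope C b x y"
    and "lap_slope C b x y \<le> exp (R / b) / b * exp (- C / b)"
    using lap_trans_deriv_bounds(1,2)[OF assms] z by simp_all
qed

section \<open>Exponential supermartingales\<close>

context prob_space
begin

text \<open>The conditional bound \<open>E[exp \<xi> | G] \<le> exp u\<close>, tested against bounded weights.\<close>

definition exp_dominated :: "'a measure \<Rightarrow> ('a \<Rightarrow> real) \<Rightarrow> ('a \<Rightarrow> real) \<Rightarrow> bool" where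
  "exp_dominated G \<xi> u \<longleftrightarrow> (\<forall>Y B. Y \<in> borel_measurable G \<longrightarrow> (\<forall>\<omega>\<in>space M. 0 \<le> Y \<omega> \<and> Y \<omega> \<le> B) \<longrightarrow>
     (\<integral>\<^sup>+\<omega>. ennreal (Y \<omega> * exp (\<xi> \<omega>)) \<partial>M) \<le> (\<integral>\<^sup>+\<omega>. ennreal (Y \<omega> * exp (u \<omega>)) \<partial>M))"

lemma exp_dominatedD:
  assumes "exp_dominated G \<xi> u" "Y \<in> borel_measurable G" "\<And>\<omega>. \<omega> \<in> space M \<Longrightarrow> 0 \<le> Y \<omega> \<and> Y \<omega> \<le> B"
  shows "(\<integral>\<^sup>+\<omega>. ennreal (Y \<omega> * exp (\<xi> \<omega>)) \<partial>M) \<le> (\<integral>\<^sup>+\<omega>. ennreal (Y \<omega> * exp (u \<omega>)) \<partial>M)"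
  using assms unfolding exp_dominated_def by blast

lemma filtration_mono:
  assumes "\<And>t. sets (\<G> t) \<subseteq> sets (\<G> (Suc t))" "s \<le> t"
  shows "sets (\<G> s) \<subseteq> sets (\<G> t)"
  using assms(2) by (induction rule: dec_induct) (use assms(1) in auto)

lemma measurable_filtration_mono:
  fixes f :: "'a \<Rightarrow> real"
  assumes sub: "\<And>t. subalgebra M (\<G> t)" and mono: "\<And>t. sets (\<G> t) \<subseteq> sets (\<G> (Suc t))"
    and "s \<le> t" "f \<in> borel_measurable (\<G> s)"
  shows "f \<in> borel_measurable (\<G> t)"
proof -
  have "subalgebra (\<G> t) (\<G> s)"
    using filtration_mono[of \<G>, OF mono \<open>s \<le> t\<close>] sub by (auto simp: subalgebra_def)
  then show ?thesis using assms(4) measurable_from_subalg by blast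
qed

text \<open>Each step tests \<open>exp_dominated\<close> with the exponential of the past sum minus
  the next compensator. This weight is measurable at time t because compensators are predictable,
  and bounded because increments lie below the constants \<open>c\<close> and compensators are
  nonnegative.\<close>

lemma exp_supermartingale:
  fixes \<xi> u :: "nat \<Rightarrow> 'a \<Rightarrow> real"
  assumes sub: "\<And>t. subalgebra M (\<G> t)" and mono: "\<And>t. sets (\<G> t) \<subseteq> sets (\<G> (Suc t))"
    and \<xi>_meas: "\<And>t. \<xi> (Suc t) \<in> borel_measurable (\<G> (Suc t))"
    and u_meas: "\<And>t. u (Suc t) \<in> borel_measurable (\<G> t)"
    and u_nonneg: "\<And>t \<omega>. \<omega> \<in> space M \<Longrightarrow> 0 \<le> u (Suc t) \<omega>"
    and bd: "\<And>t \<omega>. \<omega> \<in> space M \<Longrightarrow> \<xi> (Suc t) \<omega> \<le> c (Suc t)"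
    and dom: "\<And>t. t < k \<Longrightarrow> exp_dominated (\<G> t) (\<xi> (Suc t)) (u (Suc t))"
  shows "(\<integral>\<^sup>+\<omega>. ennreal (exp (\<Sum>t\<in>{1..k}. \<xi> t \<omega> - u t \<omega>)) \<partial>M) \<le> 1"
  using dom
proof (induction k)
  case 0
  show ?case by (simp add: emeasure_space_1)
next
  case (Suc k)
  define Z where "Z = (\<lambda>\<omega>. \<Sum>t\<in>{1..k}. \<xi> t \<omega> - u t \<omega>)"
  define Y where "Y = (\<lambda>\<omega>. exp (Z \<omega> - u (Suc k) \<omega>))"
  have "(\<lambda>\<omega>. \<xi> t \<omega> - u t \<omega>) \<in> borel_measurable (\<G> k)" if "t \<in> {1..k}" for t
  proof -
    obtain s where s: "t = Suc s" using \<open>t \<in> {1..k}\<close> by (cases t) auto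
    have "\<xi> t \<in> borel_measurable (\<G> k)"
      unfolding s by (rule measurable_filtration_mono[where \<G> = \<G>, OF sub mono _ \<xi>_meas]) (use that s in auto)
    moreover have "u t \<in> borel_measurable (\<G> k)"
      unfolding s by (rule measurable_filtration_mono[where \<G> = \<G>, OF sub mono _ u_meas]) (use that s in auto)
    ultimately show ?thesis by simp
  qed
  then have Z: "Z \<in> borel_measurable (\<G> k)" unfolding Z_def by (rule borel_measurable_sum)
  then have Y: "Y \<in> borel_measurable (\<G> k)" unfolding Y_def using u_meas[of k] by measurable
  have Y_bd: "0 \<le> Y \<omega> \<and> Y \<omega> \<le> exp (\<Sum>t\<in>{1..k}. c t)" if "\<omega> \<in> space M" for \<omega>
  proof -
    have "Z \<omega> \<le> (\<Sum>t\<in>{1..k}. c t)" unfolding Z_def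
    proof (rule sum_mono)
      fix t assume "t \<in> {1..k}"
      then obtain s where "t = Suc s" by (cases t) auto
      then show "\<xi> t \<omega> - u t \<omega> \<le> c t" using bd[OF that, of s] u_nonneg[OF that, of s] by simp
    qed
    then show ?thesis using u_nonneg[OF that, of k] by (simp add: Y_def)
  qed
  have "(\<integral>\<^sup>+\<omega>. ennreal (exp (\<Sum>t\<in>{1..Suc k}. \<xi> t \<omega> - u t \<omega>)) \<partial>M)
      = (\<integral>\<^sup>+\<omega>. ennreal (Y \<omega> * exp (\<xi> (Suc k) \<omega>)) \<partial>M)"
    unfolding Y_def Z_def by (simp add: exp_add[symmetric] algebra_simps)
  also have "\<dots> \<le> (\<integral>\<^sup>+\<omega>. ennreal (Y \<omega> * exp (u (Suc k) \<omega>)) \<partial>M)"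
    by (rule exp_dominatedD[OF Suc.prems Y Y_bd]) auto
  also have "\<dots> = (\<integral>\<^sup>+\<omega>. ennreal (exp (Z \<omega>)) \<partial>M)"
    unfolding Y_def by (simp add: exp_add[symmetric])
  also have "\<dots> \<le> 1" using Suc unfolding Z_def by simp
  finally show ?case .
qed

lemma exp_markov:
  fixes D :: "'a \<Rightarrow> real"
  assumes [measurable]: "D \<in> borel_measurable M"
    and D: "(\<integral>\<^sup>+\<omega>. ennreal (exp (D \<omega>)) \<partial>M) \<le> 1"
  shows "emeasure M {\<omega> \<in> space M. x \<le> D \<omega>} \<le> ennreal (exp (- x))"
proof -
  have "emeasure M {\<omega> \<in> space M. x \<le> D \<omega>}
      \<le> emeasure M ({\<omega> \<in> space M. 1 \<le> ennreal (exp (- x)) * ennreal (exp (D \<omega>))} \<inter> space M)"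
    by (rule emeasure_mono) (auto simp: ennreal_mult[symmetric] exp_add[symmetric] ennreal_1[symmetric] simp del: ennreal_1)
  also have "\<dots> \<le> ennreal (exp (- x)) * (\<integral>\<^sup>+\<omega>. ennreal (exp (D \<omega>)) * indicator (space M) \<omega> \<partial>M)"
    using nn_integral_Markov_inequality[of "\<lambda>\<omega>. ennreal (exp (D \<omega>))" "space M" M "ennreal (exp (- x))"]
    by (simp add: Int_def conj_commute)
  also have "(\<integral>\<^sup>+\<omega>. ennreal (exp (D \<omega>)) * indicator (space M) \<omega> \<partial>M) = (\<integral>\<^sup>+\<omega>. ennreal (exp (D \<omega>)) \<partial>M)"
    by (intro nn_integral_cong) (auto simp: indicator_def)
  also have "ennreal (exp (- x)) * \<dots> \<le> ennreal (exp (- x)) * 1" by (intro mult_left_mono D) auto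
  finally show ?thesis by simp
qed

text \<open>Only the exponential moment of each single \<open>D k\<close> enters, so every k may use
  its own supermartingale; this permits a multiplier tuned to the horizon. The level 2 ln k makes
  the exceptional probabilities at most 1 / k^2, and Borel-Cantelli applies.\<close>

lemma AE_eventually_le_ln:
  fixes D :: "nat \<Rightarrow> 'a \<Rightarrow> real"
  assumes [measurable]: "\<And>k. D k \<in> borel_measurable M"
    and D: "\<forall>\<^sub>F k in sequentially. (\<integral>\<^sup>+\<omega>. ennreal (exp (D k \<omega>)) \<partial>M) \<le> 1"
  shows "AE \<omega> in M. \<forall>\<^sub>F k in sequentially. D k \<omega> \<le> 2 * ln (real k)"
proof -
  define A where "A k = {\<omega> \<in> space M. 2 * ln (real k) \<le> D k \<omega>}" for k
  have [measurable]: "A k \<in> sets M" for k unfolding A_def by measurable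
  have "\<forall>\<^sub>F k in sequentially. measure M (A k) \<le> 1 / real k ^ 2"
    using D eventually_gt_at_top[of 0]
  proof eventually_elim
    case (elim k)
    have "ennreal (measure M (A k)) = emeasure M (A k)" by (simp add: emeasure_eq_measure)
    also have "\<dots> \<le> ennreal (exp (- (2 * ln (real k))))"
      unfolding A_def by (rule exp_markov) (use elim in auto)
    also have "exp (- (2 * ln (real k))) = 1 / real k ^ 2"
      using elim(2) by (simp add: exp_minus exp_double power2_eq_square inverse_eq_divide)
    finally show ?case by simp
  qed
  then have "summable (\<lambda>k. measure M (A k))"
    by (intro summable_comparison_test_ev[OF _ inverse_power_summable[of 2, where 'a = real]])
       (auto simp: inverse_eq_divide elim: eventually_mono)
  then have "AE \<omega> in M. \<forall>\<^sub>F k in sequentially. \<omega> \<in> space M - A k"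
    by (intro borel_cantelli_AE1) (auto simp: emeasure_eq_measure)
  then show ?thesis
    by eventually_elim (auto simp: A_def elim!: eventually_mono)
qed

text \<open>Ville's inequality: stopping the supermartingale when it exceeds \<open>exp x\<close> keeps it a supermartingale.\<close>

lemma AE_bounded_above_of_exp_dominated:
  fixes \<xi> u :: "nat \<Rightarrow> 'a \<Rightarrow> real"
  assumes sub: "\<And>t. subalgebra M (\<G> t)" and mono: "\<And>t. sets (\<G> t) \<subseteq> sets (\<G> (Suc t))"
    and \<xi>_meas: "\<And>t. \<xi> (Suc t) \<in> borel_measurable (\<G> (Suc t))"
    and u_meas: "\<And>t. u (Suc t) \<in> borel_measurable (\<G> t)"
    and u_nonneg: "\<And>t \<omega>. \<omega> \<in> space M \<Longrightarrow> 0 \<le> u (Suc t) \<omega>"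
    and bd: "\<And>t \<omega>. \<omega> \<in> space M \<Longrightarrow> \<xi> (Suc t) \<omega> \<le> c (Suc t)"
    and c_nonneg: "\<And>t. 0 \<le> c t"
    and dom: "\<And>t. exp_dominated (\<G> t) (\<xi> (Suc t)) (u (Suc t))"
  shows "AE \<omega> in M. \<exists>C. \<forall>k. (\<Sum>t\<in>{1..k}. \<xi> t \<omega> - u t \<omega>) \<le> C"
proof -
  define Z where "Z k \<omega> = (\<Sum>t\<in>{1..k}. \<xi> t \<omega> - u t \<omega>)" for k \<omega>
  have Z_meas: "Z k \<in> borel_measurable (\<G> k)" for k
  proof -
    have "(\<lambda>\<omega>. \<xi> t \<omega> - u t \<omega>) \<in> borel_measurable (\<G> k)" if "t \<in> {1..k}" for t
    proof -
      obtain s where s: "t = Suc s" using \<open>t \<in> {1..k}\<close> by (cases t) auto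
      have "\<xi> t \<in> borel_measurable (\<G> k)"
        unfolding s by (rule measurable_filtration_mono[where \<G> = \<G>, OF sub mono _ \<xi>_meas]) (use that s in auto)
      moreover have "u t \<in> borel_measurable (\<G> k)"
        unfolding s by (rule measurable_filtration_mono[where \<G> = \<G>, OF sub mono _ u_meas]) (use that s in auto)
      ultimately show ?thesis by simp
    qed
    then show ?thesis unfolding Z_def by (rule borel_measurable_sum)
  qed
  have [measurable]: "Z k \<in> borel_measurable M" for k
    using Z_meas sub measurable_from_subalg by blast
  have bound: "emeasure M {\<omega> \<in> space M. \<exists>s\<le>k. x \<le> Z s \<omega>} \<le> ennreal (exp (- x))" for x k
  proof -
    \<comment> \<open>Predictable indicator that level x has not been reached before time t.
      Multiplying the increments by it stops the process at the first passage.\<close>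
    define I where "I t \<omega> = (if \<forall>s<t. Z s \<omega> < x then 1 else 0 :: real)" for t \<omega>
    have I_meas: "I (Suc t) \<in> borel_measurable (\<G> t)" for t
    proof -
      have [measurable]: "Z s \<in> borel_measurable (\<G> t)" if "s \<in> {..t}" for s
        by (rule measurable_filtration_mono[where \<G> = \<G>, OF sub mono _ Z_meas]) (use that in auto)
      have "{\<omega> \<in> space (\<G> t). \<forall>s\<in>{..t}. Z s \<omega> < x} \<in> sets (\<G> t)"
        by (rule sets.sets_Collect_finite_All') (auto intro: borel_measurable_less)
      moreover have "I (Suc t) = (\<lambda>\<omega>. if \<forall>s\<in>{..t}. Z s \<omega> < x then 1 else 0)"
        unfolding I_def by (auto simp: less_Suc_eq_le)
      ultimately show ?thesis by (simp add: measurable_If)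
    qed
    define \<xi>' where "\<xi>' t \<omega> = I t \<omega> * \<xi> t \<omega>" for t \<omega>
    define u' where "u' t \<omega> = I t \<omega> * u t \<omega>" for t \<omega>
    define Z' where "Z' \<omega> = (\<Sum>t\<in>{1..k}. \<xi>' t \<omega> - u' t \<omega>)" for \<omega>
    have Z'_ge: "x \<le> Z' \<omega>" if "\<exists>s\<le>k. x \<le> Z s \<omega>" for \<omega>
    proof -
      \<comment> \<open>First passage time: the increments up to \<open>s\<close> are kept and all
        later ones vanish, so the stopped value is \<open>Z s \<omega>\<close>.\<close>
      define s where "s = (LEAST s. x \<le> Z s \<omega>)"
      have s: "x \<le> Z s \<omega>" "s \<le> k" unfolding s_def using that by (auto intro: LeastI Least_le order.trans)
      have lt: "Z r \<omega> < x" if "r < s" for r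
        using not_less_Least[of r "\<lambda>s. x \<le> Z s \<omega>"] that by (simp add: s_def)
      have "Z' \<omega> = (\<Sum>t\<in>{1..k}. if t \<in> {1..s} then \<xi> t \<omega> - u t \<omega> else 0)"
        unfolding Z'_def
      proof (rule sum.cong)
        fix t assume t: "t \<in> {1..k}"
        show "\<xi>' t \<omega> - u' t \<omega> = (if t \<in> {1..s} then \<xi> t \<omega> - u t \<omega> else 0)"
        proof (cases "t \<le> s")
          case True
          then have "I t \<omega> = 1" unfolding I_def using lt by auto
          then show ?thesis using True t by (simp add: \<xi>'_def u'_def)
        next
          case False
          then have "s < t" by simp
          then have "I t \<omega> = 0" unfolding I_def using s(1) by (auto simp: not_less)
          then show ?thesis using False t by (simp add: \<xi>'_def u'_def)
        qed
      qed simp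
      also have "\<dots> = (\<Sum>t\<in>{1..s}. \<xi> t \<omega> - u t \<omega>)"
        by (rule sum.mono_neutral_cong_right) (use s(2) in auto)
      finally show ?thesis using s(1) by (simp add: Z_def)
    qed
    have "(\<integral>\<^sup>+\<omega>. ennreal (exp (\<Sum>t\<in>{1..k}. \<xi>' t \<omega> - u' t \<omega>)) \<partial>M) \<le> 1"
    proof (rule exp_supermartingale[where \<G> = \<G>, OF sub mono, where c = c])
      show "\<xi>' (Suc t) \<in> borel_measurable (\<G> (Suc t))" for t
      proof -
        have [measurable]: "I (Suc t) \<in> borel_measurable (\<G> (Suc t))"
          by (rule measurable_filtration_mono[where \<G> = \<G>, OF sub mono _ I_meas]) simp
        note [measurable] = \<xi>_meas[of t]
        show ?thesis unfolding \<xi>'_def by measurable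
      qed
      show "u' (Suc t) \<in> borel_measurable (\<G> t)" for t
        unfolding u'_def using I_meas[of t] u_meas[of t] by measurable
      show "0 \<le> u' (Suc t) \<omega>" if "\<omega> \<in> space M" for t \<omega>
        using u_nonneg[OF that] by (simp add: u'_def I_def)
      show "\<xi>' (Suc t) \<omega> \<le> c (Suc t)" if "\<omega> \<in> space M" for t \<omega>
        using bd[OF that, of t] c_nonneg[of "Suc t"] by (simp add: \<xi>'_def I_def)
      show "exp_dominated (\<G> t) (\<xi>' (Suc t)) (u' (Suc t))" for t
        unfolding exp_dominated_def
      proof (intro allI impI)
        fix Y :: "'a \<Rightarrow> real" and B assume Y [measurable]: "Y \<in> borel_measurable (\<G> t)" and B: "\<forall>\<omega>\<in>space M. 0 \<le> Y \<omega> \<and> Y \<omega> \<le> B"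
        note [measurable] = I_meas[of t] 
        have mM: "f \<in> borel_measurable M" if "f \<in> borel_measurable (\<G> s)" for s and f :: "'a \<Rightarrow> real"
          using that sub measurable_from_subalg by blast
        note [measurable] = mM[OF I_meas[of t]] mM[OF Y] mM[OF \<xi>_meas[of t]] mM[OF u_meas[of t]]
        \<comment> \<open>Where the process has stopped the integrand is just Y for either choice of
          f, so domination is invoked only with the weight Y times the indicator.\<close>
        have split: "(\<integral>\<^sup>+\<omega>. ennreal (Y \<omega> * exp (I (Suc t) \<omega> * f \<omega>)) \<partial>M)
          = (\<integral>\<^sup>+\<omega>. ennreal (Y \<omega> * (1 - I (Suc t) \<omega>)) \<partial>M) + (\<integral>\<^sup>+\<omega>. ennreal ((Y \<omega> * I (Suc t) \<omega>) * exp (f \<omega>)) \<partial>M)"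
          if [measurable]: "f \<in> borel_measurable M" for f
        proof (subst nn_integral_add[symmetric])
          show "(\<integral>\<^sup>+\<omega>. ennreal (Y \<omega> * exp (I (Suc t) \<omega> * f \<omega>)) \<partial>M)
            = (\<integral>\<^sup>+\<omega>. ennreal (Y \<omega> * (1 - I (Suc t) \<omega>)) + ennreal ((Y \<omega> * I (Suc t) \<omega>) * exp (f \<omega>)) \<partial>M)"
            by (intro nn_integral_cong) (auto simp: I_def)
        qed measurable
        have "(\<integral>\<^sup>+\<omega>. ennreal ((Y \<omega> * I (Suc t) \<omega>) * exp (\<xi> (Suc t) \<omega>)) \<partial>M)
            \<le> (\<integral>\<^sup>+\<omega>. ennreal ((Y \<omega> * I (Suc t) \<omega>) * exp (u (Suc t) \<omega>)) \<partial>M)"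
        proof (rule exp_dominatedD[OF dom])
          show "(\<lambda>\<omega>. Y \<omega> * I (Suc t) \<omega>) \<in> borel_measurable (\<G> t)" by measurable
          show "0 \<le> Y \<omega> * I (Suc t) \<omega> \<and> Y \<omega> * I (Suc t) \<omega> \<le> \<bar>B\<bar>" if "\<omega> \<in> space M" for \<omega>
            using B[rule_format, OF that] by (auto simp: I_def)
        qed
        then show "(\<integral>\<^sup>+\<omega>. ennreal (Y \<omega> * exp (\<xi>' (Suc t) \<omega>)) \<partial>M) \<le> (\<integral>\<^sup>+\<omega>. ennreal (Y \<omega> * exp (u' (Suc t) \<omega>)) \<partial>M)"
          unfolding \<xi>'_def u'_def split[OF mM[OF \<xi>_meas[of t]]] split[OF mM[OF u_meas[of t]]]
          by (rule add_left_mono)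
      qed
    qed
    then have 1: "(\<integral>\<^sup>+\<omega>. ennreal (exp (Z' \<omega>)) \<partial>M) \<le> 1" by (simp add: Z'_def)
    have "Z' \<in> borel_measurable M"
    proof -
      have "(\<lambda>\<omega>. \<xi>' t \<omega> - u' t \<omega>) \<in> borel_measurable M" if "t \<in> {1..k}" for t
      proof -
        obtain s where s: "t = Suc s" using \<open>t \<in> {1..k}\<close> by (cases t) auto
        have mM: "f \<in> borel_measurable M" if "f \<in> borel_measurable (\<G> s)" for s and f :: "'a \<Rightarrow> real"
          using that sub measurable_from_subalg by blast
        note [measurable] = mM[OF I_meas[of s]] mM[OF \<xi>_meas[of s]] mM[OF u_meas[of s]]
        show ?thesis unfolding s \<xi>'_def u'_def by measurable
      qed
      then show ?thesis unfolding Z'_def by (rule borel_measurable_sum)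
    qed
    note 2 = this and exp_markov[OF this 1, of x]
    have "emeasure M {\<omega> \<in> space M. \<exists>s\<le>k. x \<le> Z s \<omega>} \<le> emeasure M {\<omega> \<in> space M. x \<le> Z' \<omega>}"
      using 2 Z'_ge by (intro emeasure_mono) auto
    also have "\<dots> \<le> ennreal (exp (- x))" by fact
    finally show ?thesis .
  qed
  \<comment> \<open>Paths unbounded above pass every level x, so their probability is at most exp (-
    x) for all x.\<close>
  define N where "N = {\<omega> \<in> space M. \<forall>x::nat. \<exists>s. real x \<le> Z s \<omega>}"
  have [measurable]: "N \<in> sets M" unfolding N_def by measurable
  have "emeasure M N \<le> ennreal (exp (- real x))" for x :: nat
  proof -
    have inc: "incseq (\<lambda>k. {\<omega> \<in> space M. \<exists>s\<le>k. real x \<le> Z s \<omega>})"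
      by (auto simp: incseq_def) (meson order.trans)
    have "emeasure M N \<le> emeasure M (\<Union>k. {\<omega> \<in> space M. \<exists>s\<le>k. real x \<le> Z s \<omega>})"
      by (intro emeasure_mono) (auto simp: N_def, blast)
    also have "\<dots> = (SUP k. emeasure M {\<omega> \<in> space M. \<exists>s\<le>k. real x \<le> Z s \<omega>})"
      by (rule SUP_emeasure_incseq[symmetric, OF _ inc]) (auto simp: image_subset_iff)
    also have "\<dots> \<le> ennreal (exp (- real x))" by (intro SUP_least bound)
    finally show ?thesis .
  qed
  then have "measure M N \<le> exp (- real x)" for x :: nat
    by (simp add: emeasure_eq_measure)
  moreover have "(\<lambda>x::nat. exp (- real x)) \<longlonglongrightarrow> 0" by real_asymp
  ultimately have "measure M N \<le> 0" by (intro LIMSEQ_le_const) auto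
  then have "emeasure M N = 0" by (simp add: emeasure_eq_measure measure_le_0_iff)
  then have "AE \<omega> in M. \<omega> \<notin> N" by (intro AE_not_in) (auto simp: null_sets_def)
  then show ?thesis
  proof (rule AE_mp[OF _ AE_I2], intro impI)
    fix \<omega> assume "\<omega> \<in> space M" "\<omega> \<notin> N"
    then obtain x :: nat where "\<forall>s. Z s \<omega> < real x" by (auto simp: N_def not_le)
    then show "\<exists>C. \<forall>k. (\<Sum>t\<in>{1..k}. \<xi> t \<omega> - u t \<omega>) \<le> C"
      unfolding Z_def by (auto intro!: exI[of _ "real x"] less_imp_le)
  qed
qed

end

section \<open>Exponential moments of the centred one-bit message\<close>

lemma exp_le_quadratic:
  fixes x :: real
  assumes "\<bar>x\<bar> \<le> 1"
  shows "exp x \<le> 1 + x + x\<^sup>2"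
proof (cases "x \<ge> 0")
  case True
  then show ?thesis using exp_bound[of x] assms by simp
next
  case False
  then have "1 - x + (- x)^2 / 2 \<le> exp (- x)"
    using exp_lower_Taylor_quadratic[of "- x"] by simp
  then have *: "1 - x + x\<^sup>2 / 2 \<le> exp (- x)" by simp
  have pos: "0 < 1 - x + x\<^sup>2 / 2" using False by (smt (verit) zero_le_power2 divide_nonneg_pos)
  have "exp x = 1 / exp (- x)" by (simp add: exp_minus inverse_eq_divide)
  also have "\<dots> \<le> 1 / (1 - x + x\<^sup>2 / 2)" using * pos by (intro divide_left_mono) auto
  also have "\<dots> \<le> 1 + x + x\<^sup>2"
  proof -
    have "(1 + x + x\<^sup>2) * (1 - x + x\<^sup>2 / 2) = 1 + x\<^sup>2 / 2 - x^3 / 2 + x^4 / 2"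
      by (simp add: field_simps power2_eq_square power3_eq_cube power4_eq_xxxx)
    moreover have "x^3 \<le> 0" using False by (simp add: power3_eq_cube mult_nonneg_nonpos2 mult_nonpos_nonpos mult_nonneg_nonpos)
    moreover have "0 \<le> x\<^sup>2" "0 \<le> x^4" by auto
    ultimately have "1 \<le> (1 + x + x\<^sup>2) * (1 - x + x\<^sup>2 / 2)" by linarith
    then show ?thesis using pos by (simp add: field_simps)
  qed
  finally show ?thesis .
qed

text \<open>The received symbol as a function of the sender's value and dither, with silence encoded
  as 0. Freed from network indices and time, it lets the probabilistic estimates be stated for a
  single transmission.\<close>

definition one_bit :: "real \<Rightarrow> real \<Rightarrow> real \<Rightarrow> real \<Rightarrow> real" where
  "one_bit C b x y = (let z = x + b * y in if \<bar>z\<bar> > C then (if z > 0 then 1 else -1) else 0)"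

lemma sc_msg_eq: "sc_msg \<nu> b xj dj j i k = one_bit (sc_thr \<nu> b j i k) (b j i) xj dj"
  by (simp add: sc_msg_def one_bit_def)

lemma abs_one_bit_le_1: "\<bar>one_bit C b x y\<bar> \<le> 1"
  by (simp add: one_bit_def Let_def)

lemma one_bit_borel [measurable (raw)]:
  assumes [measurable]: "f \<in> borel_measurable N" "g \<in> borel_measurable N"
  shows "(\<lambda>x. one_bit C b (f x) (g x)) \<in> borel_measurable N"
  unfolding one_bit_def Let_def by measurable

lemma one_bit_eq_indicator:
  assumes "b > 0" "C \<ge> 0"
  shows "one_bit C b x y = indicator {(C - x) / b<..} y - indicator {..<(- x - C) / b} y"
proof -
  have 1: "y > (C - x) / b \<longleftrightarrow> x + b * y > C" using assms by (simp add: field_simps)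
  have 2: "y < (- x - C) / b \<longleftrightarrow> x + b * y < - C" using assms by (simp add: pos_less_divide_eq algebra_simps) linarith
  show ?thesis unfolding one_bit_def Let_def indicator_def
    using assms by (auto simp: 1 2)
qed

context prob_space
begin

lemma laplace_tails:
  assumes D: "distributed M lborel D (\<lambda>x. ennreal (exp (- \<bar>x\<bar>) / 2))"
  shows "measure (distr M borel D) {u<..} = lap_cdf (- u)"
    and "measure (distr M borel D) {..<u} = lap_cdf u"
proof -
  have [measurable]: "D \<in> borel_measurable M" using D by (simp add: distributed_def)
  interpret L: prob_space "distr M borel D" by (rule prob_space_distr) simp
  have em: "emeasure (distr M borel D) A = (\<integral>\<^sup>+x. ennreal (exp (- \<bar>x\<bar>) / 2) * indicator A x \<partial>lborel)"
    if "A \<in> sets borel" for A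
    using distributed_emeasure[OF D, of A] that by (simp add: emeasure_distr)
  have ge: "(\<integral>\<^sup>+x. ennreal (exp (- \<bar>x\<bar>) / 2) * indicator {u..} x \<partial>lborel) = ennreal (1 - lap_cdf u)"
    by (rule nn_integral_FTC_atLeast[OF _ DERIV_lap_cdf]) (auto intro: filterlim_lap_cdf_at_top)
  have "emeasure (distr M borel D) {u<..} = (\<integral>\<^sup>+x. ennreal (exp (- \<bar>x\<bar>) / 2) * indicator {u..} x \<partial>lborel)"
    unfolding em[of "{u<..}", simplified]
    by (rule nn_integral_cong_AE, rule AE_mp[OF AE_lborel_singleton[of u]]) (auto simp: indicator_def)
  then show "measure (distr M borel D) {u<..} = lap_cdf (- u)"
    unfolding ge using lap_cdf_le_1[of u] by (simp add: measure_def lap_cdf_minus)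
  have "measure (distr M borel D) {u..} = 1 - lap_cdf u"
    using em[of "{u..}"] ge lap_cdf_le_1[of u] by (simp add: measure_def)
  moreover have "space (distr M borel D) - {u..} = {..<u}" by auto
  ultimately show "measure (distr M borel D) {..<u} = lap_cdf u"
    using L.prob_compl[of "{u..}"] by simp
qed

text \<open>\<open>lap_trans\<close> is the mean of \<open>one_bit\<close>, and
  \<open>lap_send\<close> is the probability that it is nonzero, hence its second moment. The
  quadratic bound of exp therefore leaves a compensator of Bernstein type, proportional to the
  sending probability instead of a constant; this is how rare transmissions become cheap in
  variance. The restriction on h keeps the exponent within [-1, 1].\<close>

lemma one_bit_mgf:
  assumes D: "distributed M lborel D (\<lambda>x. ennreal (exp (- \<bar>x\<bar>) / 2))"
    and b: "b > 0" "C \<ge> 0" and h: "\<bar>h\<bar> \<le> 1 / 2"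
  shows "(\<integral>\<^sup>+y. ennreal (exp (h * (one_bit C b x y - lap_trans C b x))) \<partial>distr M borel D)
    \<le> ennreal (exp (h\<^sup>2 * lap_send C b x))"
proof -
  have [measurable]: "D \<in> borel_measurable M" using D by (simp add: distributed_def)
  define L where "L = distr M borel D"
  interpret L: prob_space L unfolding L_def by (rule prob_space_distr) simp
  have setsL [measurable_cong]: "sets L = sets borel" by (simp add: L_def)
  have spaceL: "space L = UNIV" by (simp add: L_def)
  define A where "A = {(C - x) / b<..}"
  define A' where "A' = {..<(- x - C) / b}"
  define p where "p = lap_cdf ((x - C) / b)"
  define p' where "p' = lap_cdf ((- x - C) / b)"
  define g where "g = p - p'"
  have [measurable]: "A \<in> sets L" "A' \<in> sets L" by (simp_all add: A_def A'_def L_def)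
  have "- ((C - x) / b) = (x - C) / b" by (metis minus_diff_eq minus_divide_left)
  then have mA: "measure L A = p" "measure L A' = p'"
    unfolding L_def A_def A'_def p_def p'_def by (simp_all only: laplace_tails[OF D])
  have g: "lap_trans C b x = g" by (simp add: lap_trans_def g_def p_def p'_def)
  have disj: "indicator A y * indicator A' y = (0::real)" for y
  proof -
    have "(- x - C) / b \<le> (C - x) / b" using b by (intro divide_right_mono) auto
    then show ?thesis by (auto simp: indicator_def A_def A'_def)
  qed
  \<comment> \<open>Coefficients of the two tail indicators after expanding the square, whose cross
    term vanishes because the tails are disjoint.\<close>
  define K1 where "K1 = h + h\<^sup>2 * (1 - 2 * g)"
  define K2 where "K2 = - h + h\<^sup>2 * (1 + 2 * g)"
  define q where "q y = 1 - h * g + h\<^sup>2 * g\<^sup>2 + K1 * indicator A y + K2 * indicator A' y" for y :: real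
  have le: "exp (h * (one_bit C b x y - g)) \<le> q y" for y
  proof -
    have "\<bar>g\<bar> \<le> 1" using abs_lap_trans_le_1[of C b x] g by simp
    then have "\<bar>one_bit C b x y - g\<bar> \<le> 2" using abs_one_bit_le_1[of C b x y] by linarith
    then have "\<bar>h\<bar> * \<bar>one_bit C b x y - g\<bar> \<le> (1/2) * 2" using h by (intro mult_mono) auto
    then have "\<bar>h * (one_bit C b x y - g)\<bar> \<le> 1" by (simp add: abs_mult)
    then have "exp (h * (one_bit C b x y - g)) \<le> 1 + h * (one_bit C b x y - g) + (h * (one_bit C b x y - g))\<^sup>2"
      by (rule exp_le_quadratic)
    also have "\<dots> = 1 + h * (indicator A y - indicator A' y - g) + (h * (indicator A y - indicator A' y - g))\<^sup>2"
      unfolding A_def A'_def one_bit_eq_indicator[OF b] ..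
    also have "\<dots> = q y"
      unfolding q_def K1_def K2_def using disj[of y]
      by (auto simp: indicator_def power2_eq_square algebra_simps split: if_splits)
    finally show ?thesis .
  qed
  have ind: "integrable L (\<lambda>y. K1 * indicator A y)" "integrable L (\<lambda>y. K2 * indicator A' y)"
    by (intro integrable_mult_right integrable_real_indicator; simp add: L.emeasure_eq_measure)+
  then have int: "integrable L q"
    unfolding q_def by (intro Bochner_Integration.integrable_add L.integrable_const)
  have q_nonneg: "0 \<le> q y" for y by (rule order.trans[OF exp_ge_zero le])
  have "(\<integral>\<^sup>+y. ennreal (exp (h * (one_bit C b x y - lap_trans C b x))) \<partial>L) \<le> (\<integral>\<^sup>+y. ennreal (q y) \<partial>L)"
    unfolding g by (intro nn_integral_mono ennreal_leI le)
  also have "\<dots> = ennreal (integral\<^sup>L L q)"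
    by (rule nn_integral_eq_integral[OF int]) (simp add: q_nonneg)
  also have "integral\<^sup>L L q = 1 - h * g + h\<^sup>2 * g\<^sup>2 + K1 * p + K2 * p'"
    unfolding q_def using ind spaceL L.prob_space by (simp add: mA)
  also have "\<dots> = 1 + h\<^sup>2 * (p + p') - h\<^sup>2 * g\<^sup>2"
    by (simp add: K1_def K2_def g_def power2_eq_square algebra_simps)
  also have "\<dots> \<le> 1 + h\<^sup>2 * (p + p')" by simp
  also have "\<dots> \<le> exp (h\<^sup>2 * (p + p'))" by (rule exp_ge_add_one_self)
  also have "p + p' = lap_send C b x" by (simp add: lap_send_def p_def p'_def)
  finally show ?thesis unfolding L_def by (simp add: ennreal_leI)
qed

text \<open>Independence makes the joint law of past and dither a product. By Fubini the
  past-measurable \<open>X\<close>, \<open>h\<close> and \<open>Y\<close> are frozen while the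
  dither is integrated by \<open>one_bit_mgf\<close>.\<close>

lemma exp_dominated_one_bit:
  assumes sub: "subalgebra M G" and indep: "\<And>A B. A \<in> sets G \<Longrightarrow> B \<in> sets borel \<Longrightarrow>
      prob (A \<inter> (D -` B \<inter> space M)) = prob A * prob (D -` B \<inter> space M)"
    and D: "distributed M lborel D (\<lambda>x. ennreal (exp (- \<bar>x\<bar>) / 2))"
    and b: "b > 0" "C \<ge> 0"
    and X [measurable]: "X \<in> borel_measurable G" and h [measurable]: "h \<in> borel_measurable G"
    and h_le: "\<And>\<omega>. \<omega> \<in> space M \<Longrightarrow> \<bar>h \<omega>\<bar> \<le> 1 / 2"
  shows "exp_dominated G (\<lambda>\<omega>. h \<omega> * (one_bit C b (X \<omega>) (D \<omega>) - lap_trans C b (X \<omega>)))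
    (\<lambda>\<omega>. (h \<omega>)\<^sup>2 * lap_send C b (X \<omega>))"
  unfolding exp_dominated_def
proof (intro allI impI)
  fix Y :: "'a \<Rightarrow> real" and B assume Y [measurable]: "Y \<in> borel_measurable G" and B: "\<forall>\<omega>\<in>space M. 0 \<le> Y \<omega> \<and> Y \<omega> \<le> B"
  have spG: "space G = space M" using sub by (simp add: subalgebra_def)
  have [measurable]: "D \<in> borel_measurable M" using D by (simp add: distributed_def)
  have [measurable]: "(\<lambda>\<omega>. \<omega>) \<in> measurable M G"
    using sub by (auto simp: subalgebra_def measurable_def dest: sets.sets_into_space)
  interpret L: prob_space "distr M borel D" by (rule prob_space_distr) simp
  \<comment> \<open>The identity map into \<open>G\<close> carries the whole past at once, so a
    single product measure handles \<open>X\<close>, \<open>h\<close> and \<open>Y\<close> together;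
    it is identified on rectangles.\<close>
  have eq: "distr M G (\<lambda>\<omega>. \<omega>) \<Otimes>\<^sub>M distr M borel D = distr M (G \<Otimes>\<^sub>M borel) (\<lambda>x. (x, D x))"
  proof (rule pair_measure_eqI)
    show "sigma_finite_measure (distr M G (\<lambda>\<omega>. \<omega>))"
      by (intro finite_measure.sigma_finite_measure prob_space.finite_measure prob_space_distr) simp
    show "sigma_finite_measure (distr M borel D)"
      by (intro finite_measure.sigma_finite_measure prob_space.finite_measure prob_space_distr) simp
    show "sets (distr M G (\<lambda>\<omega>. \<omega>) \<Otimes>\<^sub>M distr M borel D) = sets (distr M (G \<Otimes>\<^sub>M borel) (\<lambda>x. (x, D x)))"
      by (simp cong: sets_pair_measure_cong)
    fix A B assume "A \<in> sets (distr M G (\<lambda>\<omega>. \<omega>))" "B \<in> sets (distr M borel D)"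
    then have [measurable]: "A \<in> sets G" "B \<in> sets borel" by auto
    have A: "A \<subseteq> space M" using sets.sets_into_space[of A G] spG by auto
    have "emeasure (distr M (G \<Otimes>\<^sub>M borel) (\<lambda>x. (x, D x))) (A \<times> B) = emeasure M ((\<lambda>x. (x, D x)) -` (A \<times> B) \<inter> space M)"
      by (rule emeasure_distr) measurable
    also have "(\<lambda>x. (x, D x)) -` (A \<times> B) \<inter> space M = A \<inter> (D -` B \<inter> space M)" by auto
    finally show "emeasure (distr M G (\<lambda>\<omega>. \<omega>)) A * emeasure (distr M borel D) B
        = emeasure (distr M (G \<Otimes>\<^sub>M borel) (\<lambda>x. (x, D x))) (A \<times> B)"
      using indep[of A B] A by (simp add: emeasure_distr emeasure_eq_measure ennreal_mult Int_absorb2)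
  qed
  define f where "f = (\<lambda>(\<omega>, y). ennreal (Y \<omega> * exp (h \<omega> * (one_bit C b (X \<omega>) y - lap_trans C b (X \<omega>)))))"
  have f [measurable]: "f \<in> borel_measurable (G \<Otimes>\<^sub>M borel)" unfolding f_def by measurable
  have "(\<integral>\<^sup>+\<omega>. ennreal (Y \<omega> * exp (h \<omega> * (one_bit C b (X \<omega>) (D \<omega>) - lap_trans C b (X \<omega>)))) \<partial>M)
    = (\<integral>\<^sup>+\<omega>. f (\<omega>, D \<omega>) \<partial>M)" by (simp add: f_def)
  also have "\<dots> = (\<integral>\<^sup>+z. f z \<partial>distr M (G \<Otimes>\<^sub>M borel) (\<lambda>x. (x, D x)))"
    by (rule nn_integral_distr[symmetric]) measurable
  also have "\<dots> = (\<integral>\<^sup>+z. f z \<partial>(distr M G (\<lambda>\<omega>. \<omega>) \<Otimes>\<^sub>M distr M borel D))" by (simp add: eq)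
  also have "\<dots> = (\<integral>\<^sup>+\<omega>. \<integral>\<^sup>+y. f (\<omega>, y) \<partial>distr M borel D \<partial>distr M G (\<lambda>\<omega>. \<omega>))"
    by (rule L.nn_integral_fst[symmetric]) (use f in \<open>simp cong: measurable_cong_sets sets_pair_measure_cong\<close>)
  also have "\<dots> = (\<integral>\<^sup>+\<omega>. \<integral>\<^sup>+y. f (\<omega>, y) \<partial>distr M borel D \<partial>M)"
  proof -
    have "f \<in> borel_measurable (G \<Otimes>\<^sub>M distr M borel D)" using f by (simp cong: measurable_cong_sets sets_pair_measure_cong)
    then have "(\<lambda>\<omega>. \<integral>\<^sup>+y. f (\<omega>, y) \<partial>distr M borel D) \<in> borel_measurable G"
      by (rule L.borel_measurable_nn_integral_fst)
    then show ?thesis by (intro nn_integral_distr) simp_all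
  qed
  also have "\<dots> \<le> (\<integral>\<^sup>+\<omega>. ennreal (Y \<omega> * exp ((h \<omega>)\<^sup>2 * lap_send C b (X \<omega>))) \<partial>M)"
  proof (rule nn_integral_mono)
    fix \<omega> assume \<omega>: "\<omega> \<in> space M"
    have "(\<integral>\<^sup>+y. f (\<omega>, y) \<partial>distr M borel D)
        = ennreal (Y \<omega>) * (\<integral>\<^sup>+y. ennreal (exp (h \<omega> * (one_bit C b (X \<omega>) y - lap_trans C b (X \<omega>)))) \<partial>distr M borel D)"
      using B \<omega> by (simp add: f_def ennreal_mult nn_integral_cmult)
    also have "\<dots> \<le> ennreal (Y \<omega>) * ennreal (exp ((h \<omega>)\<^sup>2 * lap_send C b (X \<omega>)))"
      by (intro mult_left_mono one_bit_mgf D b h_le \<omega>) auto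
    also have "\<dots> = ennreal (Y \<omega> * exp ((h \<omega>)\<^sup>2 * lap_send C b (X \<omega>)))"
      using B \<omega> by (simp add: ennreal_mult)
    finally show "(\<integral>\<^sup>+y. f (\<omega>, y) \<partial>distr M borel D) \<le> ennreal (Y \<omega> * exp ((h \<omega>)\<^sup>2 * lap_send C b (X \<omega>)))" .
  qed
  finally show "(\<integral>\<^sup>+\<omega>. ennreal (Y \<omega> * exp (h \<omega> * (one_bit C b (X \<omega>) (D \<omega>) - lap_trans C b (X \<omega>)))) \<partial>M)
    \<le> (\<integral>\<^sup>+\<omega>. ennreal (Y \<omega> * exp ((h \<omega>)\<^sup>2 * lap_send C b (X \<omega>))) \<partial>M)" .
qed

end

section \<open>Martingale differences with random conditional moments\<close>

lemma sum_inverse_sqrt_le: "(\<Sum>t\<in>{1..k}. 1 / sqrt (real t)) \<le> 2 * sqrt (real k)"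
proof (induction k)
  case (Suc k)
  have "1 / sqrt (real (Suc k)) \<le> 2 * (sqrt (real (Suc k)) - sqrt (real k))"
  proof -
    have "(sqrt (real (Suc k)) - sqrt (real k)) * (sqrt (real (Suc k)) + sqrt (real k)) = 1"
      by (simp add: algebra_simps)
    then have "sqrt (real (Suc k)) - sqrt (real k) = 1 / (sqrt (real (Suc k)) + sqrt (real k))"
      by (simp add: eq_divide_eq add_nonneg_eq_0_iff)
    also have "\<dots> \<ge> 1 / (2 * sqrt (real (Suc k)))" by (intro divide_left_mono) (auto intro!: add_pos_nonneg mult_pos_pos)
    finally show ?thesis by simp
  qed
  then show ?case using Suc by simp
qed simp

context prob_space
begin

text \<open>Truncation costs a bias: the part of \<xi> with \<eta> > T has mean at most
  \<open>T powr (1 - \<rho>)\<close> times the moment of order \<rho>, which is the first part of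
  the compensator. The second part is the variance, bounded through
  \<open>\<eta>\<^sup>2 \<le> 1 + \<eta> powr \<rho>\<close>. The conditional moment is finite but
  not uniformly bounded, so it stays inside the compensator as a random variable.\<close>

lemma truncated_exp_dominated:
  fixes \<xi> \<eta> :: "'a \<Rightarrow> real"
  assumes sub: "subalgebra M G"
    and \<xi> [measurable]: "\<xi> \<in> borel_measurable M" and \<eta> [measurable]: "\<eta> \<in> borel_measurable M"
    and \<xi>_le: "\<And>\<omega>. \<omega> \<in> space M \<Longrightarrow> \<bar>\<xi> \<omega>\<bar> \<le> \<eta> \<omega>"
    and int: "integrable M \<xi>"
    and mean: "\<And>Y B. Y \<in> borel_measurable G \<Longrightarrow> (\<And>\<omega>. \<omega> \<in> space M \<Longrightarrow> 0 \<le> Y \<omega> \<and> Y \<omega> \<le> B)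
      \<Longrightarrow> (\<integral>\<omega>. Y \<omega> * \<xi> \<omega> \<partial>M) = 0"
    and \<rho>: "\<rho> > 2"
    and fin: "AE \<omega> in M. nn_cond_exp M G (\<lambda>\<omega>. ennreal (\<eta> \<omega> powr \<rho>)) \<omega> < \<infinity>"
    and T: "T > 0" and lam: "lam > 0" "lam * T \<le> 1"
  defines "\<kappa> \<equiv> \<lambda>\<omega>. enn2real (nn_cond_exp M G (\<lambda>\<omega>. ennreal (\<eta> \<omega> powr \<rho>)) \<omega>)"
  shows "exp_dominated G (\<lambda>\<omega>. lam * (if \<eta> \<omega> \<le> T then \<xi> \<omega> else 0))
    (\<lambda>\<omega>. lam * (T powr (1 - \<rho>) * \<kappa> \<omega>) + lam\<^sup>2 * (1 + \<kappa> \<omega>))"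
  unfolding exp_dominated_def
proof (intro allI impI)
  fix Y :: "'a \<Rightarrow> real" and B assume Y: "Y \<in> borel_measurable G" and B: "\<forall>\<omega>\<in>space M. 0 \<le> Y \<omega> \<and> Y \<omega> \<le> B"
  interpret finite_measure_subalgebra M G by standard (rule sub)
  define K where "K = nn_cond_exp M G (\<lambda>\<omega>. ennreal (\<eta> \<omega> powr \<rho>))"
  define \<psi> where "\<psi> = lam * T powr (1 - \<rho>) + lam\<^sup>2"
  have \<psi>: "\<psi> > 0" unfolding \<psi>_def using lam T by (simp add: add_pos_pos)
  have YM [measurable]: "Y \<in> borel_measurable M" using Y sub measurable_from_subalg by blast
  have [measurable]: "K \<in> borel_measurable M" unfolding K_def using borel_measurable_nn_cond_exp2 by simp
  have [measurable]: "\<kappa> \<in> borel_measurable M" unfolding \<kappa>_def K_def[symmetric] by measurable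
  have \<kappa>_nonneg: "\<kappa> \<omega> \<ge> 0" for \<omega> by (simp add: \<kappa>_def)
  have \<kappa>_int: "(\<integral>\<^sup>+\<omega>. ennreal (Y \<omega>) * ennreal (\<kappa> \<omega>) \<partial>M) = (\<integral>\<^sup>+\<omega>. ennreal (Y \<omega>) * ennreal (\<eta> \<omega> powr \<rho>) \<partial>M)"
  proof -
    have "AE \<omega> in M. ennreal (\<kappa> \<omega>) = K \<omega>"
      using fin unfolding \<kappa>_def K_def by eventually_elim (simp add: ennreal_enn2real_if less_top)
    then have "(\<integral>\<^sup>+\<omega>. ennreal (Y \<omega>) * ennreal (\<kappa> \<omega>) \<partial>M) = (\<integral>\<^sup>+\<omega>. ennreal (Y \<omega>) * K \<omega> \<partial>M)"
      by (intro nn_integral_cong_AE) (auto elim: eventually_mono)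
    also have "\<dots> = (\<integral>\<^sup>+\<omega>. ennreal (Y \<omega>) * ennreal (\<eta> \<omega> powr \<rho>) \<partial>M)"
      unfolding K_def by (rule nn_cond_exp_intg) (use Y in measurable)
    finally show ?thesis .
  qed
  have u_ge: "1 + lam\<^sup>2 + \<psi> * \<kappa> \<omega> \<le> exp (lam * (T powr (1 - \<rho>) * \<kappa> \<omega>) + lam\<^sup>2 * (1 + \<kappa> \<omega>))" for \<omega>
    using exp_ge_add_one_self[of "lam\<^sup>2 + \<psi> * \<kappa> \<omega>"] by (simp add: \<psi>_def algebra_simps)
  have "(\<integral>\<^sup>+\<omega>. ennreal (Y \<omega> * exp (lam * (if \<eta> \<omega> \<le> T then \<xi> \<omega> else 0))) \<partial>M)
      \<le> (\<integral>\<^sup>+\<omega>. ennreal (Y \<omega> * (1 + lam\<^sup>2 + \<psi> * \<kappa> \<omega>)) \<partial>M)"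
  proof (cases "(\<integral>\<^sup>+\<omega>. ennreal (Y \<omega>) * ennreal (\<eta> \<omega> powr \<rho>) \<partial>M) = \<infinity>")
    \<comment> \<open>An infinite weighted moment makes the right-hand side infinite, since \<psi> >
      0.\<close>
    case True
    have "\<infinity> = ennreal \<psi> * (\<integral>\<^sup>+\<omega>. ennreal (Y \<omega>) * ennreal (\<kappa> \<omega>) \<partial>M)"
      using \<psi> by (simp add: \<kappa>_int True ennreal_mult_top)
    also have "\<dots> = (\<integral>\<^sup>+\<omega>. ennreal \<psi> * (ennreal (Y \<omega>) * ennreal (\<kappa> \<omega>)) \<partial>M)"
      by (rule nn_integral_cmult[symmetric]) measurable
    also have "\<dots> \<le> (\<integral>\<^sup>+\<omega>. ennreal (Y \<omega> * (1 + lam\<^sup>2 + \<psi> * \<kappa> \<omega>)) \<partial>M)"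
    proof (rule nn_integral_mono)
      fix \<omega> assume "\<omega> \<in> space M"
      then have y: "0 \<le> Y \<omega>" using B by auto
      have "\<psi> * (Y \<omega> * \<kappa> \<omega>) \<le> Y \<omega> * (1 + lam\<^sup>2 + \<psi> * \<kappa> \<omega>)"
        using y by (simp add: algebra_simps)
      then show "ennreal \<psi> * (ennreal (Y \<omega>) * ennreal (\<kappa> \<omega>)) \<le> ennreal (Y \<omega> * (1 + lam\<^sup>2 + \<psi> * \<kappa> \<omega>))"
        using y \<psi> \<kappa>_nonneg[of \<omega>] by (simp add: ennreal_mult[symmetric] ennreal_leI)
    qed
    finally show ?thesis by (simp add: top_unique)
  next
    case False
    \<comment> \<open>The bound is linear in \<xi>, whose integral against Y then drops out. Beyond
      T the left side is 1, and a negative \<xi> is compensated by the moment term.\<close>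
    have pw: "exp (lam * (if \<eta> \<omega> \<le> T then \<xi> \<omega> else 0)) \<le> 1 + lam\<^sup>2 + lam * \<xi> \<omega> + \<psi> * \<eta> \<omega> powr \<rho>"
      if \<omega>: "\<omega> \<in> space M" for \<omega>
    proof -
      have \<eta>0: "0 \<le> \<eta> \<omega>" using \<xi>_le[OF \<omega>] by linarith
      have sq: "(\<eta> \<omega>)\<^sup>2 \<le> 1 + \<eta> \<omega> powr \<rho>"
      proof (cases "\<eta> \<omega> \<le> 1")
        case True
        then have "(\<eta> \<omega>)\<^sup>2 \<le> 1" using \<eta>0 by (simp add: power_le_one)
        then show ?thesis by (smt (verit) powr_ge_zero)
      next
        case False
        then have "(\<eta> \<omega>) powr 2 \<le> \<eta> \<omega> powr \<rho>" using \<rho> by (intro powr_mono) auto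
        then show ?thesis using False by simp
      qed
      show ?thesis
      proof (cases "\<eta> \<omega> \<le> T")
        case True
        have "\<bar>lam * \<xi> \<omega>\<bar> \<le> lam * T"
          using True \<xi>_le[OF \<omega>] lam by (simp add: abs_mult)
        then have "\<bar>lam * \<xi> \<omega>\<bar> \<le> 1" using lam by linarith
        then have "exp (lam * \<xi> \<omega>) \<le> 1 + lam * \<xi> \<omega> + lam\<^sup>2 * (\<xi> \<omega>)\<^sup>2"
          using exp_le_quadratic[of "lam * \<xi> \<omega>"] by (simp add: power_mult_distrib)
        also have "(\<xi> \<omega>)\<^sup>2 \<le> 1 + \<eta> \<omega> powr \<rho>"
          using sq power_mono[OF \<xi>_le[OF \<omega>], of 2] by simp
        finally have "exp (lam * \<xi> \<omega>) \<le> 1 + lam * \<xi> \<omega> + lam\<^sup>2 * (1 + \<eta> \<omega> powr \<rho>)"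
          using lam by (simp add: mult_left_mono)
        moreover have "0 \<le> lam * (T powr (1 - \<rho>) * \<eta> \<omega> powr \<rho>)" using lam by simp
        ultimately show ?thesis using True unfolding \<psi>_def
          by (simp add: algebra_simps)
      next
        case False
        have "\<eta> \<omega> = \<eta> \<omega> powr (1 - \<rho>) * \<eta> \<omega> powr \<rho>" using False T by (simp add: powr_add[symmetric])
        also have "\<dots> \<le> T powr (1 - \<rho>) * \<eta> \<omega> powr \<rho>"
          using False T \<rho> by (intro mult_right_mono powr_mono2') auto
        finally have "- \<xi> \<omega> \<le> T powr (1 - \<rho>) * \<eta> \<omega> powr \<rho>" using \<xi>_le[OF \<omega>] by linarith
        then have "lam * (- \<xi> \<omega>) \<le> lam * (T powr (1 - \<rho>) * \<eta> \<omega> powr \<rho>)" using lam by (intro mult_left_mono) auto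
        moreover have "0 \<le> lam\<^sup>2" "0 \<le> lam\<^sup>2 * \<eta> \<omega> powr \<rho>" by simp_all
        moreover have "\<psi> * \<eta> \<omega> powr \<rho> = lam * (T powr (1 - \<rho>) * \<eta> \<omega> powr \<rho>) + lam\<^sup>2 * \<eta> \<omega> powr \<rho>"
          by (simp add: \<psi>_def algebra_simps)
        moreover have "lam * (- \<xi> \<omega>) = - (lam * \<xi> \<omega>)" by simp
        moreover have "exp (lam * (if \<eta> \<omega> \<le> T then \<xi> \<omega> else 0)) = 1" using False by simp
        ultimately show ?thesis by linarith
      qed
    qed
    have bnd: "integrable M (\<lambda>\<omega>. Y \<omega> * \<xi> \<omega>)"
    proof (rule Bochner_Integration.integrable_bound)
      show "integrable M (\<lambda>\<omega>. B * \<xi> \<omega>)" using int by simp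
      show "AE \<omega> in M. norm (Y \<omega> * \<xi> \<omega>) \<le> norm (B * \<xi> \<omega>)"
        by (rule AE_I2) (use B in \<open>auto simp: abs_mult intro!: mult_right_mono\<close>)
    qed measurable
    have i1: "integrable M (\<lambda>\<omega>. Y \<omega> * \<eta> \<omega> powr \<rho>)"
    proof (rule integrableI_nonneg)
      show "AE \<omega> in M. 0 \<le> Y \<omega> * \<eta> \<omega> powr \<rho>" by (rule AE_I2) (use B in auto)
      have "(\<integral>\<^sup>+\<omega>. ennreal (Y \<omega> * \<eta> \<omega> powr \<rho>) \<partial>M) = (\<integral>\<^sup>+\<omega>. ennreal (Y \<omega>) * ennreal (\<eta> \<omega> powr \<rho>) \<partial>M)"
        by (intro nn_integral_cong) (use B in \<open>simp add: ennreal_mult\<close>)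
      then show "(\<integral>\<^sup>+\<omega>. ennreal (Y \<omega> * \<eta> \<omega> powr \<rho>) \<partial>M) < \<infinity>" using False by (simp add: less_top)
    qed measurable
    have iY: "integrable M Y"
      by (rule integrable_const_bound[of _ "B"]) (use B in \<open>auto intro!: AE_I2\<close>)
    define V where "V \<omega> = (1 + lam\<^sup>2) * Y \<omega> + lam * (Y \<omega> * \<xi> \<omega>) + \<psi> * (Y \<omega> * \<eta> \<omega> powr \<rho>)" for \<omega>
    have iV: "integrable M V" unfolding V_def using bnd i1 iY by (intro Bochner_Integration.integrable_add integrable_mult_right)
    have leV: "Y \<omega> * exp (lam * (if \<eta> \<omega> \<le> T then \<xi> \<omega> else 0)) \<le> V \<omega>" if "\<omega> \<in> space M" for \<omega>
    proof -
      have "Y \<omega> * exp (lam * (if \<eta> \<omega> \<le> T then \<xi> \<omega> else 0)) \<le> Y \<omega> * (1 + lam\<^sup>2 + lam * \<xi> \<omega> + \<psi> * \<eta> \<omega> powr \<rho>)"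
        using pw[OF that] B that by (intro mult_left_mono) auto
      then show ?thesis by (simp add: V_def algebra_simps)
    qed
    have V_nonneg: "0 \<le> V \<omega>" if "\<omega> \<in> space M" for \<omega>
      using leV[OF that] B that by (meson exp_ge_zero mult_nonneg_nonneg order.trans)
    have "(\<integral>\<^sup>+\<omega>. ennreal (Y \<omega> * exp (lam * (if \<eta> \<omega> \<le> T then \<xi> \<omega> else 0))) \<partial>M) \<le> (\<integral>\<^sup>+\<omega>. ennreal (V \<omega>) \<partial>M)"
      by (intro nn_integral_mono ennreal_leI leV)
    also have "\<dots> = ennreal (\<integral>\<omega>. V \<omega> \<partial>M)"
      by (rule nn_integral_eq_integral[OF iV]) (use V_nonneg in \<open>auto intro!: AE_I2\<close>)
    also have "(\<integral>\<omega>. V \<omega> \<partial>M) = (1 + lam\<^sup>2) * (\<integral>\<omega>. Y \<omega> \<partial>M) + lam * (\<integral>\<omega>. Y \<omega> * \<xi> \<omega> \<partial>M) + \<psi> * (\<integral>\<omega>. Y \<omega> * \<eta> \<omega> powr \<rho> \<partial>M)"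
      unfolding V_def using bnd i1 iY by simp
    also have "(\<integral>\<omega>. Y \<omega> * \<xi> \<omega> \<partial>M) = 0" using B by (intro mean[OF Y]) blast
    also have "ennreal ((1 + lam\<^sup>2) * (\<integral>\<omega>. Y \<omega> \<partial>M) + lam * 0 + \<psi> * (\<integral>\<omega>. Y \<omega> * \<eta> \<omega> powr \<rho> \<partial>M))
       = ennreal (1 + lam\<^sup>2) * ennreal (\<integral>\<omega>. Y \<omega> \<partial>M) + ennreal \<psi> * ennreal (\<integral>\<omega>. Y \<omega> * \<eta> \<omega> powr \<rho> \<partial>M)"
    proof -
      have "0 \<le> (\<integral>\<omega>. Y \<omega> \<partial>M)" using B by (intro integral_nonneg_AE AE_I2) auto
      moreover have "0 \<le> (\<integral>\<omega>. Y \<omega> * \<eta> \<omega> powr \<rho> \<partial>M)" using B by (intro integral_nonneg_AE AE_I2) auto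
      ultimately show ?thesis using \<psi> by (simp add: ennreal_plus[symmetric] ennreal_mult[symmetric] del: ennreal_plus)
    qed
    also have "ennreal (\<integral>\<omega>. Y \<omega> \<partial>M) = (\<integral>\<^sup>+\<omega>. ennreal (Y \<omega>) \<partial>M)"
      by (rule nn_integral_eq_integral[symmetric, OF iY]) (use B in \<open>auto intro!: AE_I2\<close>)
    also have "ennreal (\<integral>\<omega>. Y \<omega> * \<eta> \<omega> powr \<rho> \<partial>M) = (\<integral>\<^sup>+\<omega>. ennreal (Y \<omega> * \<eta> \<omega> powr \<rho>) \<partial>M)"
      by (rule nn_integral_eq_integral[symmetric, OF i1]) (use B in \<open>auto intro!: AE_I2\<close>)
    also have "\<dots> = (\<integral>\<^sup>+\<omega>. ennreal (Y \<omega>) * ennreal (\<kappa> \<omega>) \<partial>M)"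
      unfolding \<kappa>_int by (intro nn_integral_cong) (use B in \<open>simp add: ennreal_mult\<close>)
    also have "ennreal (1 + lam\<^sup>2) * (\<integral>\<^sup>+\<omega>. ennreal (Y \<omega>) \<partial>M) + ennreal \<psi> * (\<integral>\<^sup>+\<omega>. ennreal (Y \<omega>) * ennreal (\<kappa> \<omega>) \<partial>M)
      = (\<integral>\<^sup>+\<omega>. ennreal (1 + lam\<^sup>2) * ennreal (Y \<omega>) + ennreal \<psi> * (ennreal (Y \<omega>) * ennreal (\<kappa> \<omega>)) \<partial>M)"
      by (subst nn_integral_add) (auto simp: nn_integral_cmult)
    also have "\<dots> = (\<integral>\<^sup>+\<omega>. ennreal (Y \<omega> * (1 + lam\<^sup>2 + \<psi> * \<kappa> \<omega>)) \<partial>M)"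
    proof (rule nn_integral_cong)
      fix \<omega> assume "\<omega> \<in> space M"
      then have "0 \<le> Y \<omega>" using B by auto
      then show "ennreal (1 + lam\<^sup>2) * ennreal (Y \<omega>) + ennreal \<psi> * (ennreal (Y \<omega>) * ennreal (\<kappa> \<omega>))
         = ennreal (Y \<omega> * (1 + lam\<^sup>2 + \<psi> * \<kappa> \<omega>))"
        using \<psi> \<kappa>_nonneg[of \<omega>]
        by (simp add: ennreal_plus[symmetric] ennreal_mult[symmetric] algebra_simps del: ennreal_plus)
    qed
    finally show ?thesis .
  qed
  also have "\<dots> \<le> (\<integral>\<^sup>+\<omega>. ennreal (Y \<omega> * exp (lam * (T powr (1 - \<rho>) * \<kappa> \<omega>) + lam\<^sup>2 * (1 + \<kappa> \<omega>))) \<partial>M)"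
    by (intro nn_integral_mono ennreal_leI mult_left_mono u_ge) (use B in auto)
  finally show "(\<integral>\<^sup>+\<omega>. ennreal (Y \<omega> * exp (lam * (if \<eta> \<omega> \<le> T then \<xi> \<omega> else 0))) \<partial>M)
      \<le> (\<integral>\<^sup>+\<omega>. ennreal (Y \<omega> * exp (lam * (T powr (1 - \<rho>) * \<kappa> \<omega>) + lam\<^sup>2 * (1 + \<kappa> \<omega>))) \<partial>M)" .
qed

text \<open>Truncation at \<open>t powr q\<close> makes exponential moments available under a mere
  moment of order \<rho> > 2. Along a path only finitely many terms are affected, by Borel-Cantelli,
  so the truncated and the original sums differ by a bounded amount.\<close>

lemma AE_mds_sum_le:
  fixes \<xi> \<eta> :: "nat \<Rightarrow> 'a \<Rightarrow> real"
  assumes sub: "\<And>t. subalgebra M (\<G> t)" and mono: "\<And>t. sets (\<G> t) \<subseteq> sets (\<G> (Suc t))"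
    and \<xi>_meas: "\<And>t. \<xi> (Suc t) \<in> borel_measurable (\<G> (Suc t))"
    and \<eta>_meas: "\<And>t. \<eta> (Suc t) \<in> borel_measurable (\<G> (Suc t))"
    and \<xi>_le: "\<And>t \<omega>. \<omega> \<in> space M \<Longrightarrow> \<bar>\<xi> (Suc t) \<omega>\<bar> \<le> \<eta> (Suc t) \<omega>"
    and int: "\<And>t. integrable M (\<xi> (Suc t))"
    and mean: "\<And>t Y B. Y \<in> borel_measurable (\<G> t) \<Longrightarrow> (\<And>\<omega>. \<omega> \<in> space M \<Longrightarrow> 0 \<le> Y \<omega> \<and> Y \<omega> \<le> B)
      \<Longrightarrow> (\<integral>\<omega>. Y \<omega> * \<xi> (Suc t) \<omega> \<partial>M) = 0"
    and \<rho>: "\<rho> > 2"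
    and fin: "AE \<omega> in M. \<exists>L::real. \<forall>t. nn_cond_exp M (\<G> t) (\<lambda>\<omega>. ennreal (\<eta> (Suc t) \<omega> powr \<rho>)) \<omega> \<le> ennreal L"
  shows "AE \<omega> in M. \<exists>C. \<forall>\<^sub>F k in sequentially. (\<Sum>t\<in>{1..k}. \<xi> t \<omega>) \<le> C * sqrt (real k * ln (real k))"
proof -
  \<comment> \<open>The midpoint between 1 / \<rho> and 1 / 2. Here \<open>q * \<rho> > 1\<close>
    makes the truncation probabilities summable, q < 1 / 2 keeps \<open>lam k * T k\<close> small,
    and \<open>q * (1 - \<rho>) \<le> - (1 / 2)\<close> makes the accumulated bias of order sqrt
    k.\<close>
  define q where "q = (1 / \<rho> + 1 / 2) / 2"
  have q: "0 < q" "q < 1 / 2" "q * \<rho> > 1" "q * (1 - \<rho>) \<le> - (1 / 2)"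
  proof -
    have "1 / \<rho> < 1 / 2" using \<rho> by (simp add: field_simps)
    then show "q < 1 / 2" "0 < q" using \<rho> by (auto simp: q_def field_simps)
    have "q * \<rho> = 1 / 2 + \<rho> / 4" using \<rho> by (simp add: q_def field_simps)
    then show "q * \<rho> > 1" using \<rho> by simp
    have "q * \<rho> - q \<ge> 1 / 2" using \<open>q < 1 / 2\<close> \<open>q * \<rho> > 1\<close> by linarith
    then show "q * (1 - \<rho>) \<le> - (1 / 2)" by (simp add: algebra_simps)
  qed
  define T where "T t = real t powr q" for t
  have T_pos: "T (Suc t) > 0" for t by (simp add: T_def)
  have toM: "f \<in> borel_measurable M" if "f \<in> borel_measurable (\<G> s)" for s and f :: "'a \<Rightarrow> real"
    using that sub measurable_from_subalg by blast
  note [measurable] = toM[OF \<xi>_meas] toM[OF \<eta>_meas]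
  define K where "K t = nn_cond_exp M (\<G> t) (\<lambda>\<omega>. ennreal (\<eta> (Suc t) \<omega> powr \<rho>))" for t
  define \<kappa> where "\<kappa> t \<omega> = enn2real (K t \<omega>)" for t \<omega>
  have K_meas [measurable]: "K t \<in> borel_measurable (\<G> t)" for t unfolding K_def by simp
  have [measurable]: "K t \<in> borel_measurable M" for t unfolding K_def by (simp add: borel_measurable_nn_cond_exp2)
  have \<kappa>_meas: "\<kappa> t \<in> borel_measurable (\<G> t)" for t unfolding \<kappa>_def by measurable
  have fin': "AE \<omega> in M. nn_cond_exp M (\<G> t) (\<lambda>\<omega>. ennreal (\<eta> (Suc t) \<omega> powr \<rho>)) \<omega> < \<infinity>" for t
    using fin by eventually_elim (auto intro: order.strict_trans1)
  define \<xi>' where "\<xi>' t \<omega> = (if \<eta> t \<omega> \<le> T t then \<xi> t \<omega> else 0)" for t \<omega>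
  \<comment> \<open>Balances the deviation term ln k / lam with the variance term lam k: both become
    sqrt (k ln k).\<close>
  define lam where "lam k = sqrt (ln (real k) / real k)" for k
  define u where "u k t \<omega> = lam k * (T t powr (1 - \<rho>) * \<kappa> (t - 1) \<omega>) + (lam k)\<^sup>2 * (1 + \<kappa> (t - 1) \<omega>)" for k t \<omega>
  define D where "D k \<omega> = (\<Sum>t\<in>{1..k}. lam k * \<xi>' t \<omega> - u k t \<omega>)" for k \<omega>
  have "(\<lambda>k. lam k * T k) \<longlonglongrightarrow> 0" unfolding lam_def T_def using q(1,2) by real_asymp
  then have lam_small: "\<forall>\<^sub>F k in sequentially. lam k * T k < 1" by (rule order_tendstoD) simp
  have ev: "\<forall>\<^sub>F k in sequentially. (\<integral>\<^sup>+\<omega>. ennreal (exp (D k \<omega>)) \<partial>M) \<le> 1"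
    using lam_small eventually_ge_at_top[of 2]
  proof eventually_elim
    case (elim k)
    have lam_pos: "lam k > 0" using elim(2) by (simp add: lam_def)
    show ?case unfolding D_def
    proof (rule exp_supermartingale[where \<G> = \<G> and c = "\<lambda>t. lam k * T t", OF sub mono])
      show "(\<lambda>\<omega>. lam k * \<xi>' (Suc t) \<omega>) \<in> borel_measurable (\<G> (Suc t))" for t
        unfolding \<xi>'_def using \<xi>_meas[of t] \<eta>_meas[of t] by measurable
      show "u k (Suc t) \<in> borel_measurable (\<G> t)" for t
        unfolding u_def using \<kappa>_meas[of t] by simp
      show "0 \<le> u k (Suc t) \<omega>" for t \<omega> using lam_pos by (auto simp: u_def \<kappa>_def intro!: add_nonneg_nonneg mult_nonneg_nonneg)
      show "lam k * \<xi>' (Suc t) \<omega> \<le> lam k * T (Suc t)" if "\<omega> \<in> space M" for t \<omega>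
        using \<xi>_le[OF that, of t] lam_pos T_pos[of t] by (auto simp: \<xi>'_def)
      show "exp_dominated (\<G> t) (\<lambda>\<omega>. lam k * \<xi>' (Suc t) \<omega>) (u k (Suc t))" if "t < k" for t
      proof -
        have "T (Suc t) \<le> T k" unfolding T_def using that q by (intro powr_mono2) auto
        then have "lam k * T (Suc t) \<le> lam k * T k" using lam_pos by (intro mult_left_mono) auto
        then have le1: "lam k * T (Suc t) \<le> 1" using elim(1) by linarith
        show ?thesis
          unfolding \<xi>'_def u_def diff_Suc_1 \<kappa>_def K_def
          by (rule truncated_exp_dominated[OF sub toM[OF \<xi>_meas] toM[OF \<eta>_meas] \<xi>_le int mean \<rho> fin' T_pos lam_pos le1])
      qed
    qed
  qed
  have D_meas: "D k \<in> borel_measurable M" for k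
    unfolding D_def
  proof (rule borel_measurable_sum)
    fix t assume "t \<in> {1..k}"
    then obtain s where s: "t = Suc s" by (cases t) auto
    show "(\<lambda>\<omega>. lam k * \<xi>' t \<omega> - u k t \<omega>) \<in> borel_measurable M"
      unfolding s \<xi>'_def u_def diff_Suc_1 using toM[OF \<xi>_meas[of s]] toM[OF \<eta>_meas[of s]] toM[OF \<kappa>_meas[of s]] by measurable
  qed
  have AE1: "AE \<omega> in M. \<forall>\<^sub>F k in sequentially. D k \<omega> \<le> 2 * ln (real k)"
    by (rule AE_eventually_le_ln[OF D_meas ev])
  \<comment> \<open>The bound on the conditional moments is random. Restricting to moments below an
    integer L gives deterministic probabilities, and L is selected along the path
    afterwards.\<close>
  have AE2: "AE \<omega> in M. \<forall>\<^sub>F t in sequentially. \<not> (\<eta> (Suc t) \<omega> > T (Suc t) \<and> K t \<omega> \<le> ennreal (real L))" for L :: nat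
  proof -
    define A where "A t = {\<omega> \<in> space M. \<eta> (Suc t) \<omega> > T (Suc t) \<and> K t \<omega> \<le> ennreal (real L)}" for t
    have [measurable]: "A t \<in> sets M" for t unfolding A_def by measurable
    have le: "measure M (A t) \<le> real L * real (Suc t) powr (- (q * \<rho>))" for t
    proof -
      interpret S: finite_measure_subalgebra M "\<G> t" by standard (rule sub)
      define J where "J \<omega> = (if K t \<omega> \<le> ennreal (real L) then 1 else 0 :: ennreal)" for \<omega>
      have J: "J \<in> borel_measurable (\<G> t)" unfolding J_def by measurable
      have [measurable]: "J \<in> borel_measurable M" unfolding J_def by measurable
      have "ennreal (measure M (A t)) = (\<integral>\<^sup>+\<omega>. indicator (A t) \<omega> \<partial>M)" by (simp add: emeasure_eq_measure)
      also have "\<dots> \<le> (\<integral>\<^sup>+\<omega>. ennreal (T (Suc t) powr (- \<rho>)) * (J \<omega> * ennreal (\<eta> (Suc t) \<omega> powr \<rho>)) \<partial>M)"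
      proof (rule nn_integral_mono)
        fix \<omega>
        show "indicator (A t) \<omega> \<le> ennreal (T (Suc t) powr (- \<rho>)) * (J \<omega> * ennreal (\<eta> (Suc t) \<omega> powr \<rho>))"
        proof (cases "\<omega> \<in> A t")
          case True
          then have *: "\<eta> (Suc t) \<omega> > T (Suc t)" "J \<omega> = 1" by (auto simp: A_def J_def)
          have "1 = T (Suc t) powr (- \<rho>) * T (Suc t) powr \<rho>" using T_pos[of t] by (simp add: powr_add[symmetric])
          also have "\<dots> \<le> T (Suc t) powr (- \<rho>) * \<eta> (Suc t) \<omega> powr \<rho>"
            using *(1) T_pos[of t] \<rho> by (intro mult_left_mono powr_mono2) auto
          finally show ?thesis using True *(2)
            by (simp add: ennreal_mult[symmetric] ennreal_leI flip: ennreal_1)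
        qed simp
      qed
      also have "\<dots> = ennreal (T (Suc t) powr (- \<rho>)) * (\<integral>\<^sup>+\<omega>. J \<omega> * ennreal (\<eta> (Suc t) \<omega> powr \<rho>) \<partial>M)"
        by (rule nn_integral_cmult) measurable
      also have "(\<integral>\<^sup>+\<omega>. J \<omega> * ennreal (\<eta> (Suc t) \<omega> powr \<rho>) \<partial>M) = (\<integral>\<^sup>+\<omega>. J \<omega> * K t \<omega> \<partial>M)"
        unfolding K_def by (rule S.nn_cond_exp_intg[symmetric, OF J]) measurable
      also have "\<dots> \<le> (\<integral>\<^sup>+\<omega>. ennreal (real L) \<partial>M)"
        by (intro nn_integral_mono) (auto simp: J_def)
      also have "\<dots> = ennreal (real L)" by (simp add: emeasure_space_1)
      finally have "ennreal (measure M (A t)) \<le> ennreal (T (Suc t) powr (- \<rho>)) * ennreal (real L)"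
        by (simp add: mult_left_mono)
      then have "measure M (A t) \<le> T (Suc t) powr (- \<rho>) * real L"
        by (simp add: ennreal_mult[symmetric])
      then show ?thesis by (simp add: T_def powr_powr mult.commute)
    qed
    have "summable (\<lambda>t. real L * real (Suc t) powr (- (q * \<rho>)))"
      using q(3) by (intro summable_mult) (subst summable_Suc_iff, simp add: summable_real_powr_iff)
    then have "summable (\<lambda>t. measure M (A t))"
      by (rule summable_comparison_test'[where N = 0]) (use le in auto)
    then have "AE \<omega> in M. \<forall>\<^sub>F t in sequentially. \<omega> \<in> space M - A t"
      by (intro borel_cantelli_AE1) (auto simp: emeasure_eq_measure)
    then show ?thesis by eventually_elim (auto simp: A_def elim!: eventually_mono)
  qed
  have AE2': "AE \<omega> in M. \<forall>L::nat. \<forall>\<^sub>F t in sequentially. \<not> (\<eta> (Suc t) \<omega> > T (Suc t) \<and> K t \<omega> \<le> ennreal (real L))"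
    using AE2 by (simp add: AE_all_countable)
  show ?thesis
    using fin AE1 AE2' AE_space
  proof eventually_elim
    case (elim \<omega>)
    obtain L0 where "\<forall>t. K t \<omega> \<le> ennreal L0" using elim(1) unfolding K_def by blast
    then obtain L :: nat where L: "K t \<omega> \<le> ennreal (real L)" for t
      by (metis ennreal_leI order.trans real_arch_simple)
    have \<kappa>_le: "\<kappa> t \<omega> \<le> real L" "\<kappa> t \<omega> \<ge> 0" for t
      unfolding \<kappa>_def using enn2real_mono[OF L[of t]] by auto
    from elim(3)[rule_format, of L] obtain t0 where t0: "\<And>t. t \<ge> t0 \<Longrightarrow> \<eta> (Suc t) \<omega> \<le> T (Suc t)"
      using L by (auto simp: eventually_sequentially not_less)
    define C' where "C' = (\<Sum>t\<in>{1..t0}. \<bar>\<xi> t \<omega>\<bar>)"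
    have diff: "(\<Sum>t\<in>{1..k}. \<xi> t \<omega>) \<le> (\<Sum>t\<in>{1..k}. \<xi>' t \<omega>) + C'" for k
    proof -
      have "(\<Sum>t\<in>{1..k}. \<xi> t \<omega> - \<xi>' t \<omega>) \<le> (\<Sum>t\<in>{1..k}. if t \<in> {1..t0} then \<bar>\<xi> t \<omega>\<bar> else 0)"
      proof (rule sum_mono)
        fix t assume t: "t \<in> {1..k}"
        then obtain s where s: "t = Suc s" by (cases t) auto
        show "\<xi> t \<omega> - \<xi>' t \<omega> \<le> (if t \<in> {1..t0} then \<bar>\<xi> t \<omega>\<bar> else 0)"
          using t0[of s] s by (auto simp: \<xi>'_def)
      qed
      also have "\<dots> = (\<Sum>t\<in>{1..k} \<inter> {1..t0}. \<bar>\<xi> t \<omega>\<bar>)" by (subst sum.inter_restrict) simp_all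
      also have "\<dots> \<le> C'" unfolding C'_def by (rule sum_mono2) auto
      finally show ?thesis by (simp add: sum_subtractf)
    qed
    have "\<forall>\<^sub>F k in sequentially. (\<Sum>t\<in>{1..k}. \<xi> t \<omega>) \<le> (2 + 2 * real L + (1 + real L) + C') * sqrt (real k * ln (real k))"
      using elim(2) eventually_ge_at_top[of 3]
    proof eventually_elim
      case (elim k)
      have lnk: "ln (real k) \<ge> 1"
        using elim(2) by (intro order.trans[OF _ ln_mono[of "exp 1" "real k"]]) (use exp_le in auto)
      have lam: "lam k > 0" using elim(2) lnk by (simp add: lam_def)
      have sumu: "(\<Sum>t\<in>{1..k}. u k t \<omega>) \<le> lam k * (2 * real L * sqrt (real k)) + (lam k)\<^sup>2 * ((1 + real L) * real k)"
      proof -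
        have "(\<Sum>t\<in>{1..k}. u k t \<omega>) \<le> (\<Sum>t\<in>{1..k}. lam k * (real L * (1 / sqrt (real t))) + (lam k)\<^sup>2 * (1 + real L))"
        proof (rule sum_mono)
          fix t assume t: "t \<in> {1..k}"
          have "T t powr (1 - \<rho>) = real t powr (q * (1 - \<rho>))" by (simp add: T_def powr_powr)
          also have "\<dots> \<le> real t powr (- (1 / 2))" using t q(4) by (intro powr_mono) auto
          also have "\<dots> = 1 / sqrt (real t)" using t by (simp add: powr_minus powr_half_sqrt inverse_eq_divide)
          finally have "T t powr (1 - \<rho>) * \<kappa> (t - 1) \<omega> \<le> 1 / sqrt (real t) * real L"
            using \<kappa>_le by (intro mult_mono) auto
          then show "u k t \<omega> \<le> lam k * (real L * (1 / sqrt (real t))) + (lam k)\<^sup>2 * (1 + real L)"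
            unfolding u_def using lam \<kappa>_le by (intro add_mono mult_left_mono) (auto simp: mult.commute)
        qed
        also have "\<dots> = lam k * (real L * (\<Sum>t\<in>{1..k}. 1 / sqrt (real t))) + (lam k)\<^sup>2 * ((1 + real L) * real k)"
          by (simp add: sum.distrib sum_distrib_left)
        also have "\<dots> \<le> lam k * (real L * (2 * sqrt (real k))) + (lam k)\<^sup>2 * ((1 + real L) * real k)"
          using lam sum_inverse_sqrt_le[of k] by (intro add_mono mult_left_mono) auto
        finally show ?thesis by (simp add: mult_ac)
      qed
      define S where "S = sqrt (real k * ln (real k))"
      have S1: "S \<ge> 1" "S \<ge> sqrt (real k)"
      proof -
        have "real k * 1 \<le> real k * ln (real k)" using lnk elim(2) by (intro mult_left_mono) auto
        then show "S \<ge> sqrt (real k)" unfolding S_def by simp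
        moreover have "sqrt (real k) \<ge> 1" using elim(2) by simp
        ultimately show "S \<ge> 1" by linarith
      qed
      have lamS: "lam k * S = ln (real k)"
        unfolding lam_def S_def using elim(2) lnk by (simp add: real_sqrt_mult[symmetric])
      have lamk: "lam k * real k = S"
      proof -
        have "lam k * real k = sqrt (ln (real k) / real k) * sqrt ((real k)\<^sup>2)" by (simp add: lam_def)
        also have "\<dots> = S" unfolding S_def real_sqrt_mult[symmetric] using elim(2) by (simp add: power2_eq_square mult.commute)
        finally show ?thesis .
      qed
      have "lam k * (\<Sum>t\<in>{1..k}. \<xi>' t \<omega>) = D k \<omega> + (\<Sum>t\<in>{1..k}. u k t \<omega>)"
        by (simp add: D_def sum_subtractf sum_distrib_left)
      also have "\<dots> \<le> 2 * ln (real k) + (lam k * (2 * real L * sqrt (real k)) + (lam k)\<^sup>2 * ((1 + real L) * real k))"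
        using elim(1) sumu by (rule add_mono)
      also have "\<dots> = lam k * (2 * S + 2 * real L * sqrt (real k) + (1 + real L) * S)"
        unfolding lamS[symmetric] lamk[symmetric] by (simp add: power2_eq_square algebra_simps)
      finally have "(\<Sum>t\<in>{1..k}. \<xi>' t \<omega>) \<le> 2 * S + 2 * real L * sqrt (real k) + (1 + real L) * S"
        using lam by simp
      also have "\<dots> \<le> 2 * S + 2 * real L * S + (1 + real L) * S"
        using S1 by (intro add_mono mult_left_mono) auto
      finally have "(\<Sum>t\<in>{1..k}. \<xi> t \<omega>) \<le> 2 * S + 2 * real L * S + (1 + real L) * S + C'"
        using diff[of k] by linarith
      also have "C' \<le> C' * S" using S1 mult_left_mono[of 1 S C'] by (simp add: C'_def sum_nonneg)
      finally show ?case by (simp add: S_def algebra_simps)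
    qed
    then show ?case by blast
  qed
qed

end

section \<open>Deterministic recursions\<close>

text \<open>Induction in steps of P. A bound \<open>D * s\<close> survives a block as soon as
  \<open>C \<le> D * (\<mu> - \<sigma>)\<close>, because the contraction \<mu> / k exceeds the
  relative decay \<sigma> / k of the reference rate.\<close>

lemma linear_recursion_rate:
  fixes N s :: "nat \<Rightarrow> real"
  assumes P: "P \<ge> 1" and \<sigma>: "\<sigma> < \<mu>" "0 \<le> \<mu>" and s_pos: "\<And>k. k \<ge> k1 \<Longrightarrow> s k > 0"
    and N_rec: "\<And>k. k \<ge> k1 \<Longrightarrow> N (k + P) \<le> (1 - \<mu> / real k) * N k + C * s k / real k"
    and s_rec: "\<And>k. k \<ge> k1 \<Longrightarrow> (1 - \<sigma> / real k) * s k \<le> s (k + P)"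
  shows "\<exists>D k2. 0 \<le> D \<and> (\<forall>k\<ge>k2. N k \<le> D * s k)"
proof -
  \<comment> \<open>Beyond \<mu> the factor 1 - \<mu> / k is nonnegative, so the induction
    hypothesis may be multiplied by it.\<close>
  define k2 where "k2 = Suc (k1 + nat \<lceil>\<mu>\<rceil>)"
  have k2: "k \<ge> k1" "real k \<ge> \<mu>" "k > 0" if "k \<ge> k2" for k
    using that \<sigma> unfolding k2_def by linarith+
  \<comment> \<open>The maximum over a whole window of length P starts the induction in every
    residue class modulo P.\<close>
  define D where "D = Max (insert (max 0 (C / (\<mu> - \<sigma>))) ((\<lambda>k. N k / s k) ` {k2..<k2+P}))"
  have D_ge: "max 0 (C / (\<mu> - \<sigma>)) \<le> D" unfolding D_def by (rule Max_ge) auto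
  then have D: "0 \<le> D" "C \<le> D * (\<mu> - \<sigma>)" using \<sigma> by (auto simp: field_simps)
  have "N k \<le> D * s k" if "k \<ge> k2" for k
    using that
  proof (induction k rule: less_induct)
    case (less k)
    show ?case
    proof (cases "k < k2 + P")
      case True
      then have "N k / s k \<le> D" unfolding D_def using less.prems by (intro Max_ge) auto
      then show ?thesis using s_pos[of k] k2[OF less.prems] by (simp add: field_simps)
    next
      case False
      define j where "j = k - P"
      have j: "k = j + P" "j \<ge> k2" "j < k" using False P by (auto simp: j_def)
      have IH: "N j \<le> D * s j" using less.IH j by auto
      have sj: "s j > 0" using s_pos k2(1)[OF j(2)] by auto
      have "N k \<le> (1 - \<mu> / real j) * N j + C * s j / real j" using N_rec[of j] k2(1)[OF j(2)] j by simp
      also have "\<dots> \<le> (1 - \<mu> / real j) * (D * s j) + (D * (\<mu> - \<sigma>)) * s j / real j"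
        using IH D sj k2[OF j(2)] by (intro add_mono mult_left_mono divide_right_mono mult_right_mono) auto
      also have "\<dots> = D * ((1 - \<sigma> / real j) * s j)"
        using k2(3)[OF j(2)] by (simp add: field_simps)
      also have "\<dots> \<le> D * s k" using s_rec[of j] k2(1)[OF j(2)] j D by (intro mult_left_mono) auto
      finally show ?thesis .
    qed
  qed
  then show ?thesis using D by blast
qed

lemma L2_set_mult_const: "L2_set (\<lambda>i. c * f i) I = \<bar>c\<bar> * L2_set f I"
  using L2_set_right_distrib[of "\<bar>c\<bar>" f I]
  by (simp add: L2_set_def power_mult_distrib abs_mult)

lemma L2_set_power2: "(L2_set f I)\<^sup>2 = (\<Sum>i\<in>I. (f i)\<^sup>2)"
  by (simp add: L2_set_def sum_nonneg)

lemma L2_set_minus_fun: "L2_set (\<lambda>i. - f i) I = L2_set f I"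
  by (simp add: L2_set_def)

lemma block_contraction:
  fixes z e :: "nat \<Rightarrow> 'i \<Rightarrow> real" and Q :: "nat \<Rightarrow> ('i \<Rightarrow> real) \<Rightarrow> 'i \<Rightarrow> real" and s :: "nat \<Rightarrow> real"
  assumes fin: "finite I"
    and rec: "\<And>t i. t \<ge> t0 \<Longrightarrow> i \<in> I \<Longrightarrow>
      z (Suc t) i = z t i - Q (Suc t) (z t) i / real (Suc t) + e (Suc t) i / real (Suc t)"
    and diff: "\<And>t x y i. i \<in> I \<Longrightarrow> Q t (\<lambda>i. x i - y i) i = Q t x i - Q t y i"
    and bound: "\<And>t x. t \<ge> t0 \<Longrightarrow> L2_set (Q t x) I \<le> q * L2_set x I" and q: "q \<ge> 0"
    and psd: "\<And>t x. t \<ge> t0 \<Longrightarrow> 0 \<le> (\<Sum>i\<in>I. x i * Q t x i)"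
    and coer: "\<And>k x. k \<ge> t0 \<Longrightarrow> \<mu> * (L2_set x I)\<^sup>2 \<le> (\<Sum>t\<in>{Suc k..k+P}. \<Sum>i\<in>I. x i * Q t x i)"
    and \<mu>: "\<mu> \<ge> 0" "\<mu>' < \<mu>"
    and e: "\<And>k t. k \<ge> t0 \<Longrightarrow> t \<in> {Suc k..k+P} \<Longrightarrow> L2_set (e t) I \<le> c * s k"
    and c: "c \<ge> 0" and s: "\<And>k. s k \<ge> 0"
  shows "\<exists>C k1. \<forall>k\<ge>k1. L2_set (z (k + P)) I \<le> (1 - \<mu>' / real k) * L2_set (z k) I + C * s k / real k"
proof -
  define nrm where "nrm x = L2_set x I" for x :: "'i \<Rightarrow> real"
  have nrm_cong: "nrm x = nrm y" if "\<And>i. i \<in> I \<Longrightarrow> x i = y i" for x y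
    unfolding nrm_def by (rule L2_set_cong) (use that in auto)
  have tri: "nrm (\<lambda>i. x i + y i) \<le> nrm x + nrm y" for x y unfolding nrm_def by (rule L2_set_triangle_ineq)
  have sc: "nrm (\<lambda>i. x i / r) = nrm x / \<bar>r\<bar>" for x and r :: real
    using L2_set_mult_const[of "1 / r" x I] by (simp add: nrm_def)
  have min: "nrm (\<lambda>i. - x i) = nrm x" for x unfolding nrm_def by (rule L2_set_minus_fun)
  have nn [simp]: "0 \<le> nrm x" for x by (simp add: nrm_def)
  define N where "N k = nrm (z k)" for k
  define k0 where "k0 = max t0 1"
  have step: "nrm (\<lambda>i. x i + (y i + e (Suc (k + j)) i) / real (Suc (k + j))) \<le> nrm x + (nrm y + c * s k) / real k"
    if "k \<ge> k0" "j < P" for x y k j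
  proof -
    have k: "k \<ge> t0" "k \<ge> 1" using that by (auto simp: k0_def)
    have "nrm (\<lambda>i. x i + (y i + e (Suc (k + j)) i) / real (Suc (k + j)))
      \<le> nrm x + nrm (\<lambda>i. (y i + e (Suc (k + j)) i) / real (Suc (k + j)))" by (rule tri)
    also have "nrm (\<lambda>i. (y i + e (Suc (k + j)) i) / real (Suc (k + j))) = nrm (\<lambda>i. y i + e (Suc (k + j)) i) / real (Suc (k + j))"
      by (simp add: sc)
    also have "\<dots> \<le> (nrm y + c * s k) / real k"
    proof (rule frac_le)
      have "nrm (\<lambda>i. y i + e (Suc (k + j)) i) \<le> nrm y + nrm (e (Suc (k + j)))" by (rule tri)
      also have "nrm (e (Suc (k + j))) \<le> c * s k" unfolding nrm_def using that k by (intro e) auto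
      finally show "nrm (\<lambda>i. y i + e (Suc (k + j)) i) \<le> nrm y + c * s k" by simp
    qed (use k c s in auto)
    finally show ?thesis by simp
  qed
  \<comment> \<open>A priori displacement inside a window; multiplied by one more factor 1 / k it
    becomes the second-order error of freezing the state.\<close>
  have dev: "\<exists>C\<ge>0. \<forall>k\<ge>k0. nrm (\<lambda>i. z (k + j) i - z k i) \<le> C / real k * (N k + s k)" if "j \<le> P" for j
    using that
  proof (induction j)
    case 0
    show ?case by (rule exI[of _ 0]) (simp add: nrm_def L2_set_def)
  next
    case (Suc j)
    then obtain C where C: "C \<ge> 0" "\<And>k. k \<ge> k0 \<Longrightarrow> nrm (\<lambda>i. z (k + j) i - z k i) \<le> C / real k * (N k + s k)" by auto
    show ?case
    proof (rule exI[of _ "C + (q * (1 + C) + c)"], intro conjI allI impI)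
      fix k assume k: "k \<ge> k0"
      then have k': "k \<ge> t0" "k \<ge> 1" by (auto simp: k0_def)
      have N0: "N k \<ge> 0" by (simp add: N_def)
      have "nrm (\<lambda>i. z (k + Suc j) i - z k i)
        = nrm (\<lambda>i. (z (k + j) i - z k i) + (- Q (Suc (k + j)) (z (k + j)) i + e (Suc (k + j)) i) / real (Suc (k + j)))"
        by (rule nrm_cong) (use rec[of "k + j"] k' in \<open>auto simp: add_divide_distrib diff_divide_distrib\<close>)
      also have "\<dots> \<le> nrm (\<lambda>i. z (k + j) i - z k i) + (nrm (\<lambda>i. - Q (Suc (k + j)) (z (k + j)) i) + c * s k) / real k"
        by (rule step) (use k Suc in auto)
      also have "\<dots> \<le> C / real k * (N k + s k) + (q * (1 + C) * (N k + s k) + c * (N k + s k)) / real k"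
      proof (intro add_mono divide_right_mono)
        show "nrm (\<lambda>i. z (k + j) i - z k i) \<le> C / real k * (N k + s k)" using C k by auto
        have "nrm (z (k + j)) \<le> nrm (z k) + nrm (\<lambda>i. z (k + j) i - z k i)"
          using tri[of "z k" "\<lambda>i. z (k + j) i - z k i"] by simp
        also have "nrm (\<lambda>i. z (k + j) i - z k i) \<le> C / real k * (N k + s k)" using C k by auto
        also have "C / real k * (N k + s k) \<le> C * (N k + s k)"
          using C(1) k' N0 s[of k] mult_left_mono[of 1 "real k" C]
          by (intro mult_right_mono) (auto simp: divide_le_eq)
        finally have "nrm (z (k + j)) \<le> (1 + C) * (N k + s k)" using s[of k] by (simp add: N_def algebra_simps)
        moreover have "nrm (Q (Suc (k + j)) (z (k + j))) \<le> q * nrm (z (k + j))"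
          unfolding nrm_def using k' by (intro bound) auto
        ultimately show "nrm (\<lambda>i. - Q (Suc (k + j)) (z (k + j)) i) \<le> q * (1 + C) * (N k + s k)"
          unfolding min using q by (smt (verit) mult_left_mono mult.assoc)
        show "c * s k \<le> c * (N k + s k)" using c N0 by (intro mult_left_mono) auto
      qed auto
      also have "\<dots> = (C + (q * (1 + C) + c)) / real k * (N k + s k)" by (simp add: algebra_simps add_divide_distrib)
      finally show "nrm (\<lambda>i. z (k + Suc j) i - z k i) \<le> (C + (q * (1 + C) + c)) / real k * (N k + s k)" .
    qed (use C q c in auto)
  qed
  define R where "R k j i = z (k + j) i - z k i + (\<Sum>t\<in>{Suc k..k+j}. Q t (z k) i / real t)" for k j i
  have rem: "\<exists>E\<ge>0. \<forall>k\<ge>k0. nrm (R k j) \<le> E * (N k / (real k)\<^sup>2 + s k / real k)" if "j \<le> P" for j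
    using that
  proof (induction j)
    case 0
    show ?case by (rule exI[of _ 0]) (simp add: nrm_def L2_set_def R_def)
  next
    case (Suc j)
    then obtain E where E: "E \<ge> 0" "\<And>k. k \<ge> k0 \<Longrightarrow> nrm (R k j) \<le> E * (N k / (real k)\<^sup>2 + s k / real k)" by auto
    obtain C where C: "C \<ge> 0" "\<And>k. k \<ge> k0 \<Longrightarrow> nrm (\<lambda>i. z (k + j) i - z k i) \<le> C / real k * (N k + s k)"
      using dev[of j] Suc by auto
    show ?case
    proof (rule exI[of _ "E + (q * C + c)"], intro conjI allI impI)
      fix k assume k: "k \<ge> k0"
      then have k': "k \<ge> t0" "k \<ge> 1" by (auto simp: k0_def)
      have N0: "N k \<ge> 0" by (simp add: N_def)
      have "nrm (R k (Suc j))
        = nrm (\<lambda>i. R k j i + (- Q (Suc (k + j)) (\<lambda>i. z (k + j) i - z k i) i + e (Suc (k + j)) i) / real (Suc (k + j)))"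
        by (rule nrm_cong)
           (use rec[of "k + j"] k' in \<open>auto simp: R_def diff add_divide_distrib diff_divide_distrib\<close>)
      also have "\<dots> \<le> nrm (R k j) + (nrm (\<lambda>i. - Q (Suc (k + j)) (\<lambda>i. z (k + j) i - z k i) i) + c * s k) / real k"
        by (rule step) (use k Suc in auto)
      also have "\<dots> \<le> E * (N k / (real k)\<^sup>2 + s k / real k) + (q * (C / real k * (N k + s k)) + c * s k) / real k"
      proof (intro add_mono divide_right_mono order.refl)
        show "nrm (R k j) \<le> E * (N k / (real k)\<^sup>2 + s k / real k)" using E k by auto
        have "nrm (Q (Suc (k + j)) (\<lambda>i. z (k + j) i - z k i)) \<le> q * nrm (\<lambda>i. z (k + j) i - z k i)"
          unfolding nrm_def using k' by (intro bound) auto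
        also have "\<dots> \<le> q * (C / real k * (N k + s k))" using C(2)[OF k] q by (intro mult_left_mono)
        finally show "nrm (\<lambda>i. - Q (Suc (k + j)) (\<lambda>i. z (k + j) i - z k i) i) \<le> q * (C / real k * (N k + s k))"
          unfolding min .
      qed auto
      also have "(q * (C / real k * (N k + s k)) + c * s k) / real k
          = q * C * (N k / (real k)\<^sup>2 + (s k / real k) / real k) + c * (s k / real k)"
        by (simp add: power2_eq_square add_divide_distrib algebra_simps)
      also have "\<dots> \<le> q * C * (N k / (real k)\<^sup>2 + s k / real k) + c * (N k / (real k)\<^sup>2 + s k / real k)"
      proof -
        have "(s k / real k) / real k \<le> s k / real k"
          using k' divide_left_mono[of 1 "real k" "s k / real k"] s[of k] by simp
        then show ?thesis using q C c N0 by (intro add_mono mult_left_mono) auto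
      qed
      finally show "nrm (R k (Suc j)) \<le> (E + (q * C + c)) * (N k / (real k)\<^sup>2 + s k / real k)"
        by (simp only: distrib_right add.assoc)
    qed (use E q c C in auto)
  qed
  obtain E where E: "E \<ge> 0" "\<And>k. k \<ge> k0 \<Longrightarrow> nrm (R k P) \<le> E * (N k / (real k)\<^sup>2 + s k / real k)"
    using rem[of P] by auto
  define F where "F = (real P * q)\<^sup>2 / 2 + E"
  have contr: "nrm (\<lambda>i. z k i - (\<Sum>t\<in>{Suc k..k+P}. Q t (z k) i / real t))
      \<le> N k * (1 - \<mu> / (real k + real P) + (real P * q)\<^sup>2 / 2 / (real k)\<^sup>2)" if k: "k \<ge> k0" "real k \<ge> \<mu>" for k
  proof (rule power2_le_imp_le)
    have k': "k \<ge> t0" "k \<ge> 1" using k by (auto simp: k0_def)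
    define L where "L i = (\<Sum>t\<in>{Suc k..k+P}. Q t (z k) i / real t)" for i
    have nL: "nrm L \<le> real P * q * N k / real k"
    proof -
      have "nrm (\<lambda>i. \<Sum>t\<in>A. Q t (z k) i / real t) \<le> real (card A) * (q * N k / real k)"
        if "finite A" "A \<subseteq> {Suc k..k+P}" for A
        using that
      proof (induction A)
        case empty show ?case by (simp add: nrm_def L2_set_def)
      next
        case (insert t A)
        have "nrm (\<lambda>i. \<Sum>t\<in>insert t A. Q t (z k) i / real t) = nrm (\<lambda>i. Q t (z k) i / real t + (\<Sum>t\<in>A. Q t (z k) i / real t))"
          using insert by simp
        also have "\<dots> \<le> nrm (\<lambda>i. Q t (z k) i / real t) + nrm (\<lambda>i. \<Sum>t\<in>A. Q t (z k) i / real t)" by (rule tri)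
        also have "nrm (\<lambda>i. Q t (z k) i / real t) \<le> q * N k / real k"
          unfolding sc N_def nrm_def using insert k' q by (intro frac_le bound) auto
        finally show ?case using insert by (simp add: algebra_simps add_divide_distrib)
      qed
      from this[of "{Suc k..k+P}"] show ?thesis by (simp add: L_def[abs_def])
    qed
    have zL: "(\<Sum>i\<in>I. z k i * L i) \<ge> \<mu> * (N k)\<^sup>2 / (real k + real P)"
    proof -
      have "\<mu> * (N k)\<^sup>2 / (real k + real P) \<le> (\<Sum>t\<in>{Suc k..k+P}. \<Sum>i\<in>I. z k i * Q t (z k) i) / (real k + real P)"
        unfolding N_def nrm_def by (intro divide_right_mono coer k') auto
      also have "\<dots> = (\<Sum>t\<in>{Suc k..k+P}. (\<Sum>i\<in>I. z k i * Q t (z k) i) / (real k + real P))"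
        by (simp add: sum_divide_distrib)
      also have "\<dots> \<le> (\<Sum>t\<in>{Suc k..k+P}. (\<Sum>i\<in>I. z k i * Q t (z k) i) / real t)"
        using k' by (intro sum_mono divide_left_mono psd) (auto intro!: mult_pos_pos add_pos_nonneg)
      also have "\<dots> = (\<Sum>i\<in>I. z k i * L i)"
        unfolding L_def sum_divide_distrib sum_distrib_left by (subst sum.swap) simp
      finally show ?thesis .
    qed
    have "(nrm (\<lambda>i. z k i - L i))\<^sup>2 = (N k)\<^sup>2 - 2 * (\<Sum>i\<in>I. z k i * L i) + (nrm L)\<^sup>2"
      unfolding nrm_def N_def L2_set_power2
      by (simp add: power2_diff sum.distrib sum_subtractf sum_distrib_left algebra_simps)
    also have "\<dots> \<le> (N k)\<^sup>2 - 2 * (\<mu> * (N k)\<^sup>2 / (real k + real P)) + (real P * q * N k / real k)\<^sup>2"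
      using zL power_mono[OF nL nn, of 2] by linarith
    also have "\<dots> = (N k)\<^sup>2 * (1 + 2 * (- \<mu> / (real k + real P) + (real P * q)\<^sup>2 / 2 / (real k)\<^sup>2))"
      by (simp add: power_mult_distrib power_divide algebra_simps)
    also have "\<dots> \<le> (N k)\<^sup>2 * (1 - \<mu> / (real k + real P) + (real P * q)\<^sup>2 / 2 / (real k)\<^sup>2)\<^sup>2"
    proof (rule mult_left_mono)
      \<comment> \<open>Takes the place of a square root: the estimate for the squared norm becomes
        a contraction of the norm itself.\<close>
      have "1 + 2 * x \<le> (1 + x)\<^sup>2" for x :: real by (simp add: power2_eq_square algebra_simps)
      from this[of "- \<mu> / (real k + real P) + (real P * q)\<^sup>2 / 2 / (real k)\<^sup>2"]
      show "1 + 2 * (- \<mu> / (real k + real P) + (real P * q)\<^sup>2 / 2 / (real k)\<^sup>2)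
          \<le> (1 - \<mu> / (real k + real P) + (real P * q)\<^sup>2 / 2 / (real k)\<^sup>2)\<^sup>2" by (simp add: algebra_simps)
    qed simp
    finally show "(nrm (\<lambda>i. z k i - (\<Sum>t\<in>{Suc k..k+P}. Q t (z k) i / real t)))\<^sup>2
      \<le> (N k * (1 - \<mu> / (real k + real P) + (real P * q)\<^sup>2 / 2 / (real k)\<^sup>2))\<^sup>2"
      unfolding L_def by (simp add: power_mult_distrib)
    have "\<mu> / (real k + real P) \<le> 1" using k k' \<mu> by (simp add: divide_le_eq_1)
    then show "0 \<le> N k * (1 - \<mu> / (real k + real P) + (real P * q)\<^sup>2 / 2 / (real k)\<^sup>2)"
      by (intro mult_nonneg_nonneg) (auto simp: N_def add_nonneg_nonneg)
  qed
  \<comment> \<open>The net contraction of a block, multiplied by k, tends to \<mu>; hence it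
    eventually exceeds \<mu>'.\<close>
  have "(\<lambda>k. real k * (\<mu> / (real k + real P) - F / (real k)\<^sup>2)) \<longlonglongrightarrow> \<mu>"
    by real_asymp
  then have "\<forall>\<^sub>F k in sequentially. \<mu>' < real k * (\<mu> / (real k + real P) - F / (real k)\<^sup>2)"
    using \<mu>(2) by (rule order_tendstoD)
  moreover have "\<forall>\<^sub>F k in sequentially. real k \<ge> \<mu>" by real_asymp
  ultimately have "\<forall>\<^sub>F k in sequentially. L2_set (z (k + P)) I \<le> (1 - \<mu>' / real k) * L2_set (z k) I + E * s k / real k"
    using eventually_ge_at_top[of k0]
  proof eventually_elim
    case (elim k)
    have k': "k \<ge> 1" using elim by (auto simp: k0_def)
    have "N (k + P) = nrm (\<lambda>i. (z k i - (\<Sum>t\<in>{Suc k..k+P}. Q t (z k) i / real t)) + R k P i)"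
      unfolding N_def by (rule nrm_cong) (simp add: R_def)
    also have "\<dots> \<le> nrm (\<lambda>i. z k i - (\<Sum>t\<in>{Suc k..k+P}. Q t (z k) i / real t)) + nrm (R k P)" by (rule tri)
    also have "\<dots> \<le> N k * (1 - \<mu> / (real k + real P) + (real P * q)\<^sup>2 / 2 / (real k)\<^sup>2) + E * (N k / (real k)\<^sup>2 + s k / real k)"
      using elim by (intro add_mono contr E) auto
    also have "\<dots> = N k * (1 - (\<mu> / (real k + real P) - F / (real k)\<^sup>2)) + E * s k / real k"
      by (simp add: F_def algebra_simps add_divide_distrib)
    also have "\<dots> \<le> N k * (1 - \<mu>' / real k) + E * s k / real k"
    proof -
      have "\<mu>' / real k \<le> \<mu> / (real k + real P) - F / (real k)\<^sup>2"
        using elim(1) k' by (simp add: field_simps)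
      then show ?thesis by (intro add_mono mult_left_mono) (auto simp: N_def)
    qed
    finally show ?case by (simp add: N_def nrm_def mult.commute)
  qed
  then show ?thesis unfolding eventually_sequentially by blast
qed

section \<open>Energy and coercivity of the network operator\<close>

text \<open>One step of the algorithm, linearised and multiplied by the time index: consensus along the
  transmitted coordinate \<open>l\<close> with weights \<open>\<tau>\<close>, plus the innovation term.\<close>

definition netop :: "nat \<Rightarrow> ('v::finite \<Rightarrow> nat) \<Rightarrow> real \<Rightarrow> ('v \<Rightarrow> nat \<Rightarrow> nat \<Rightarrow> real) \<Rightarrow> nat \<Rightarrow> ('v \<Rightarrow> 'v \<Rightarrow> real)
    \<Rightarrow> ('v \<times> nat \<Rightarrow> real) \<Rightarrow> 'v \<times> nat \<Rightarrow> real" where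
  "netop n m B h l \<tau> y = (\<lambda>(i, c).
     (if c = l then \<Sum>j\<in>UNIV. \<tau> i j * (y (i, l) - y (j, l)) else 0)
     + B * (\<Sum>r<m i. h i r c * (\<Sum>c'<n. h i r c' * y (i, c'))))"

lemma netop_diff: "netop n m B h l \<tau> (\<lambda>i. x i - y i) p = netop n m B h l \<tau> x p - netop n m B h l \<tau> y p"
proof (cases p)
  case (Pair i c)
  have 1: "(\<Sum>j\<in>UNIV. \<tau> i j * ((x (i, l) - y (i, l)) - (x (j, l) - y (j, l))))
     = (\<Sum>j\<in>UNIV. \<tau> i j * (x (i, l) - x (j, l))) - (\<Sum>j\<in>UNIV. \<tau> i j * (y (i, l) - y (j, l)))"
    unfolding sum_subtractf[symmetric] by (rule sum.cong) (auto simp: algebra_simps)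
  have 2: "(\<Sum>r<m i. h i r c * (\<Sum>c'<n. h i r c' * (x (i, c') - y (i, c'))))
     = (\<Sum>r<m i. h i r c * (\<Sum>c'<n. h i r c' * x (i, c'))) - (\<Sum>r<m i. h i r c * (\<Sum>c'<n. h i r c' * y (i, c')))"
    unfolding sum_subtractf[symmetric] by (rule sum.cong) (auto simp: algebra_simps sum_subtractf)
  show ?thesis unfolding netop_def Pair prod.case 1 2 by (simp add: right_diff_distrib)
qed

lemma sum_pairs: "(\<Sum>p\<in>UNIV \<times> {..<n}. f p) = (\<Sum>i\<in>UNIV. \<Sum>c<n. f (i, c))" for f :: "'v::finite \<times> nat \<Rightarrow> real"
  by (simp add: sum.cartesian_product)

lemma symmetric_form:
  fixes \<tau> :: "'v::finite \<Rightarrow> 'v \<Rightarrow> real"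
  assumes "\<And>i j. \<tau> i j = \<tau> j i"
  shows "(\<Sum>i\<in>UNIV. u i * (\<Sum>j\<in>UNIV. \<tau> i j * (u i - u j))) = (\<Sum>i\<in>UNIV. \<Sum>j\<in>UNIV. \<tau> i j * (u i - u j)\<^sup>2) / 2"
proof -
  define S where "S = (\<Sum>i\<in>UNIV. \<Sum>j\<in>UNIV. \<tau> i j * (u i * (u i - u j)))"
  have S1: "(\<Sum>i\<in>UNIV. u i * (\<Sum>j\<in>UNIV. \<tau> i j * (u i - u j))) = S"
    unfolding S_def by (simp add: sum_distrib_left mult_ac)
  have "S = (\<Sum>i\<in>UNIV. \<Sum>j\<in>UNIV. \<tau> j i * (u j * (u j - u i)))"
    unfolding S_def by (subst sum.swap) simp
  also have "\<dots> = (\<Sum>i\<in>UNIV. \<Sum>j\<in>UNIV. \<tau> i j * (u j * (u j - u i)))"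
    by (intro sum.cong refl arg_cong2[where f = "(*)"] assms)
  finally have "S + S = (\<Sum>i\<in>UNIV. \<Sum>j\<in>UNIV. \<tau> i j * (u i * (u i - u j)) + \<tau> i j * (u j * (u j - u i)))"
    by (simp add: S_def sum.distrib)
  also have "\<dots> = (\<Sum>i\<in>UNIV. \<Sum>j\<in>UNIV. \<tau> i j * (u i - u j)\<^sup>2)"
    by (intro sum.cong refl) (simp add: power2_eq_square algebra_simps)
  finally show ?thesis using S1 by simp
qed

text \<open>Both parts are symmetric: the consensus part is a weighted graph Laplacian in one
  coordinate, the innovation part a Gram operator. The norm bound and the coercivity over windows
  both start from this energy identity.\<close>

lemma netop_inner:
  fixes \<tau> :: "'v::finite \<Rightarrow> 'v \<Rightarrow> real"
  assumes l: "l < n" and sym: "\<And>i j. \<tau> i j = \<tau> j i"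
  shows "(\<Sum>p\<in>UNIV \<times> {..<n}. y p * netop n m B h l \<tau> y p)
    = (\<Sum>i\<in>UNIV. \<Sum>j\<in>UNIV. \<tau> i j * (y (i, l) - y (j, l))\<^sup>2) / 2
      + B * (\<Sum>i\<in>UNIV. \<Sum>r<m i. (\<Sum>c<n. h i r c * y (i, c))\<^sup>2)"
proof -
  define T where "T i = (\<Sum>j\<in>UNIV. \<tau> i j * (y (i, l) - y (j, l)))" for i
  define v where "v i r = (\<Sum>c<n. h i r c * y (i, c))" for i r
  have "(\<Sum>p\<in>UNIV \<times> {..<n}. y p * netop n m B h l \<tau> y p)
     = (\<Sum>i\<in>UNIV. \<Sum>c<n. (if c = l then y (i, c) * T i else 0) + B * (\<Sum>r<m i. y (i, c) * h i r c * v i r))"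
    unfolding sum_pairs netop_def T_def v_def
    by (intro sum.cong refl) (auto simp: algebra_simps sum_distrib_left)
  also have "\<dots> = (\<Sum>i\<in>UNIV. y (i, l) * T i) + B * (\<Sum>i\<in>UNIV. \<Sum>c<n. \<Sum>r<m i. y (i, c) * h i r c * v i r)"
    using l by (simp add: sum.distrib sum_distrib_left)
  also have "(\<Sum>i\<in>UNIV. y (i, l) * T i) = (\<Sum>i\<in>UNIV. \<Sum>j\<in>UNIV. \<tau> i j * (y (i, l) - y (j, l))\<^sup>2) / 2"
    unfolding T_def by (rule symmetric_form[OF sym, where u = "\<lambda>i. y (i, l)"])
  also have "(\<Sum>i\<in>UNIV. \<Sum>c<n. \<Sum>r<m i. y (i, c) * h i r c * v i r) = (\<Sum>i\<in>UNIV. \<Sum>r<m i. (v i r)\<^sup>2)"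
  proof (rule sum.cong[OF refl])
    fix i
    have "(\<Sum>c<n. \<Sum>r<m i. y (i, c) * h i r c * v i r) = (\<Sum>r<m i. \<Sum>c<n. y (i, c) * h i r c * v i r)" by (rule sum.swap)
    also have "\<dots> = (\<Sum>r<m i. v i r * v i r)"
      by (intro sum.cong refl) (subst (3) v_def, simp add: sum_distrib_left mult_ac)
    finally show "(\<Sum>c<n. \<Sum>r<m i. y (i, c) * h i r c * v i r) = (\<Sum>r<m i. (v i r)\<^sup>2)" by (simp add: power2_eq_square)
  qed
  finally show ?thesis unfolding v_def .
qed

text \<open>A positive semidefinite operator satisfies |Q y|^2 \<le> |Q| (y, Q y); Cauchy-Schwarz
  bounds the norm by row sums and \<open>Hb\<close>. The single estimate supplies the norm bound,
  positivity, and the descent inequality for small steps.\<close>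

lemma netop_norm_le_inner:
  fixes \<tau> :: "'v::finite \<Rightarrow> 'v \<Rightarrow> real"
  assumes l: "l < n" and sym: "\<And>i j. \<tau> i j = \<tau> j i" and \<tau>0: "\<And>i j. \<tau> i j \<ge> 0" and B: "B \<ge> 0"
    and \<tau>r: "\<And>i. (\<Sum>j\<in>UNIV. \<tau> i j) \<le> \<tau>r" and Hb: "\<And>i. mnorm (m i) n (h i) \<le> Hb"
  shows "(\<Sum>p\<in>UNIV \<times> {..<n}. (netop n m B h l \<tau> y p)\<^sup>2)
    \<le> (4 * \<tau>r + 2 * B * Hb\<^sup>2) * (\<Sum>p\<in>UNIV \<times> {..<n}. y p * netop n m B h l \<tau> y p)"
proof -
  define T where "T i = (\<Sum>j\<in>UNIV. \<tau> i j * (y (i, l) - y (j, l)))" for i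
  define v where "v i r = (\<Sum>c<n. h i r c * y (i, c))" for i r
  define X where "X = (\<Sum>i\<in>UNIV. \<Sum>j\<in>UNIV. \<tau> i j * (y (i, l) - y (j, l))\<^sup>2) / 2"
  define Y where "Y = (\<Sum>i\<in>UNIV. \<Sum>r<m i. (v i r)\<^sup>2)"
  have X0: "X \<ge> 0" unfolding X_def using \<tau>0 by (intro divide_nonneg_nonneg sum_nonneg mult_nonneg_nonneg) auto
  have Y0: "Y \<ge> 0" unfolding Y_def by (intro sum_nonneg) auto
  have \<tau>r0: "\<tau>r \<ge> 0" using \<tau>r sum_nonneg[of UNIV "\<tau> undefined"] \<tau>0 by (meson order.trans)
  have "(\<Sum>p\<in>UNIV \<times> {..<n}. (netop n m B h l \<tau> y p)\<^sup>2)
     \<le> (\<Sum>i\<in>UNIV. \<Sum>c<n. (if c = l then 2 * (T i)\<^sup>2 else 0) + 2 * B\<^sup>2 * (\<Sum>r<m i. h i r c * v i r)\<^sup>2)"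
    unfolding sum_pairs
  proof (intro sum_mono)
    fix i c
    have *: "(x + z)\<^sup>2 \<le> 2 * x\<^sup>2 + 2 * z\<^sup>2" for x z :: real
      using zero_le_power2[of "x - z"] by (simp add: power2_eq_square algebra_simps)
    show "(netop n m B h l \<tau> y (i, c))\<^sup>2 \<le> (if c = l then 2 * (T i)\<^sup>2 else 0) + 2 * B\<^sup>2 * (\<Sum>r<m i. h i r c * v i r)\<^sup>2"
      using *[of "if c = l then T i else 0" "B * (\<Sum>r<m i. h i r c * v i r)"]
      by (auto simp: netop_def T_def v_def power_mult_distrib split: if_splits)
  qed
  also have "\<dots> = 2 * (\<Sum>i\<in>UNIV. (T i)\<^sup>2) + 2 * B\<^sup>2 * (\<Sum>i\<in>UNIV. \<Sum>c<n. (\<Sum>r<m i. h i r c * v i r)\<^sup>2)"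
    using l by (simp add: sum.distrib sum_distrib_left)
  also have "(\<Sum>i\<in>UNIV. (T i)\<^sup>2) \<le> 2 * \<tau>r * X"
  proof -
    have "(T i)\<^sup>2 \<le> \<tau>r * (\<Sum>j\<in>UNIV. \<tau> i j * (y (i, l) - y (j, l))\<^sup>2)" for i
    proof -
      \<comment> \<open>Splitting each weight into two square roots lets one factor of
        Cauchy-Schwarz sum to the row bound and the other to the energy.\<close>
      have "T i = (\<Sum>j\<in>UNIV. sqrt (\<tau> i j) * (sqrt (\<tau> i j) * (y (i, l) - y (j, l))))"
        unfolding T_def using \<tau>0 by (simp add: mult.assoc[symmetric])
      then have "(T i)\<^sup>2 \<le> (\<Sum>j\<in>UNIV. (sqrt (\<tau> i j))\<^sup>2) * (\<Sum>j\<in>UNIV. (sqrt (\<tau> i j) * (y (i, l) - y (j, l)))\<^sup>2)"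
        using Cauchy_Schwarz_ineq_sum by metis
      also have "\<dots> = (\<Sum>j\<in>UNIV. \<tau> i j) * (\<Sum>j\<in>UNIV. \<tau> i j * (y (i, l) - y (j, l))\<^sup>2)"
        using \<tau>0 by (simp add: power_mult_distrib)
      also have "\<dots> \<le> \<tau>r * (\<Sum>j\<in>UNIV. \<tau> i j * (y (i, l) - y (j, l))\<^sup>2)"
        using \<tau>0 by (intro mult_right_mono \<tau>r sum_nonneg mult_nonneg_nonneg) auto
      finally show ?thesis .
    qed
    then have "(\<Sum>i\<in>UNIV. (T i)\<^sup>2) \<le> (\<Sum>i\<in>UNIV. \<tau>r * (\<Sum>j\<in>UNIV. \<tau> i j * (y (i, l) - y (j, l))\<^sup>2))" by (intro sum_mono)
    then show ?thesis by (simp add: X_def sum_distrib_left[symmetric])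
  qed
  also have "(\<Sum>i\<in>UNIV. \<Sum>c<n. (\<Sum>r<m i. h i r c * v i r)\<^sup>2) \<le> Hb\<^sup>2 * Y"
  proof -
    have "(\<Sum>c<n. (\<Sum>r<m i. h i r c * v i r)\<^sup>2) \<le> Hb\<^sup>2 * (\<Sum>r<m i. (v i r)\<^sup>2)" for i
    proof -
      have "(\<Sum>c<n. (\<Sum>r<m i. h i r c * v i r)\<^sup>2) \<le> (\<Sum>c<n. (\<Sum>r<m i. (h i r c)\<^sup>2) * (\<Sum>r<m i. (v i r)\<^sup>2))"
        by (intro sum_mono Cauchy_Schwarz_ineq_sum)
      also have "\<dots> = (mnorm (m i) n (h i))\<^sup>2 * (\<Sum>r<m i. (v i r)\<^sup>2)"
        unfolding mnorm_def by (subst sum.swap) (simp add: sum_nonneg sum_distrib_right)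
      also have "\<dots> \<le> Hb\<^sup>2 * (\<Sum>r<m i. (v i r)\<^sup>2)"
        by (intro mult_right_mono power_mono Hb sum_nonneg) (auto simp: mnorm_def sum_nonneg)
      finally show ?thesis .
    qed
    then show ?thesis unfolding Y_def sum_distrib_left[of _ _ UNIV] by (intro sum_mono)
  qed
  finally have "(\<Sum>p\<in>UNIV \<times> {..<n}. (netop n m B h l \<tau> y p)\<^sup>2) \<le> 2 * (2 * \<tau>r * X) + 2 * B\<^sup>2 * (Hb\<^sup>2 * Y)"
    by (simp add: mult_left_mono)
  also have "\<dots> \<le> (4 * \<tau>r + 2 * B * Hb\<^sup>2) * (X + B * Y)"
  proof -
    have "0 \<le> 4 * \<tau>r * (B * Y)" "0 \<le> 2 * B * Hb\<^sup>2 * X" using X0 Y0 \<tau>r0 B by simp_all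
    then show ?thesis by (simp add: algebra_simps power2_eq_square)
  qed
  also have "X + B * Y = (\<Sum>p\<in>UNIV \<times> {..<n}. y p * netop n m B h l \<tau> y p)"
    unfolding X_def Y_def v_def by (rule netop_inner[symmetric, OF l sym])
  finally show ?thesis .
qed

lemma norm_le_of_sq_le_inner:
  assumes "(\<Sum>p\<in>I. (v p)\<^sup>2) \<le> \<kappa> * (\<Sum>p\<in>I. y p * v p)" "\<kappa> \<ge> 0"
  shows "L2_set v I \<le> \<kappa> * L2_set y I"
proof (cases "L2_set v I = 0")
  case False
  then have pos: "L2_set v I > 0" using L2_set_nonneg[of v I] by linarith
  have "(\<Sum>p\<in>I. y p * v p) \<le> (\<Sum>p\<in>I. \<bar>y p\<bar> * \<bar>v p\<bar>)" by (intro sum_mono) (metis abs_ge_self abs_mult)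
  also have "\<dots> \<le> L2_set y I * L2_set v I" by (rule L2_set_mult_ineq)
  finally have "\<kappa> * (\<Sum>p\<in>I. y p * v p) \<le> \<kappa> * (L2_set y I * L2_set v I)" using assms(2) by (rule mult_left_mono)
  then have "(L2_set v I)\<^sup>2 \<le> \<kappa> * (L2_set y I * L2_set v I)"
    using assms(1) unfolding L2_set_power2 by linarith
  then have "L2_set v I * L2_set v I \<le> (\<kappa> * L2_set y I) * L2_set v I"
    by (simp add: power2_eq_square mult.assoc)
  then show ?thesis using pos by simp
qed (use assms in simp)

text \<open>The step v is computed from \<zeta> + U, but the energy is that of \<zeta>. Young's
  inequality with weight \<kappa> charges the mismatch to \<kappa> |U|^2 and uses up one of the two
  copies of the descent term; the other one pays for |v|^2.\<close>

lemma perturbed_descent: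
  fixes \<zeta> U v :: "'i \<Rightarrow> real"
  assumes "(\<Sum>p\<in>I. (v p)\<^sup>2) \<le> \<kappa> * (\<Sum>p\<in>I. (\<zeta> p + U p) * v p)" "0 < \<kappa>" "\<kappa> \<le> 1"
  shows "(\<Sum>p\<in>I. (\<zeta> p - v p)\<^sup>2) \<le> (\<Sum>p\<in>I. (\<zeta> p)\<^sup>2) + \<kappa> * (\<Sum>p\<in>I. (U p)\<^sup>2)"
proof -
  define D where "D = (\<Sum>p\<in>I. (\<zeta> p + U p) * v p)"
  define V where "V = (\<Sum>p\<in>I. (v p)\<^sup>2)"
  have V: "0 \<le> V" "V \<le> \<kappa> * D" using assms(1) by (auto simp: V_def D_def sum_nonneg)
  then have D0: "D \<ge> 0" using assms(2) by (meson order.trans zero_le_mult_iff not_le)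
  have Vd: "V / \<kappa> \<le> D" using V assms(2) by (simp add: divide_le_eq mult.commute)
  have "(\<Sum>p\<in>I. 2 * (U p * v p)) \<le> (\<Sum>p\<in>I. \<kappa> * (U p)\<^sup>2 + (v p)\<^sup>2 / \<kappa>)"
  proof (rule sum_mono)
    fix p
    have "0 \<le> (\<kappa> * U p - v p)\<^sup>2 / \<kappa>" using assms(2) by simp
    also have "\<dots> = \<kappa> * (U p)\<^sup>2 + (v p)\<^sup>2 / \<kappa> - 2 * (U p * v p)"
      using assms(2) by (simp add: power2_eq_square field_simps)
    finally show "2 * (U p * v p) \<le> \<kappa> * (U p)\<^sup>2 + (v p)\<^sup>2 / \<kappa>" by simp
  qed
  also have "\<dots> = \<kappa> * (\<Sum>p\<in>I. (U p)\<^sup>2) + V / \<kappa>" by (simp add: sum.distrib sum_distrib_left sum_divide_distrib V_def)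
  finally have c: "(\<Sum>p\<in>I. 2 * (U p * v p)) \<le> \<kappa> * (\<Sum>p\<in>I. (U p)\<^sup>2) + D" using Vd by linarith
  have "(\<Sum>p\<in>I. (\<zeta> p - v p)\<^sup>2) = (\<Sum>p\<in>I. (\<zeta> p)\<^sup>2 - 2 * ((\<zeta> p + U p) * v p) + 2 * (U p * v p) + (v p)\<^sup>2)"
    by (intro sum.cong refl) (simp add: power2_eq_square algebra_simps)
  also have "\<dots> = (\<Sum>p\<in>I. (\<zeta> p)\<^sup>2) - 2 * D + (\<Sum>p\<in>I. 2 * (U p * v p)) + V"
    by (simp add: sum.distrib sum_subtractf sum_distrib_left D_def V_def)
  also have "\<dots> \<le> (\<Sum>p\<in>I. (\<zeta> p)\<^sup>2) - 2 * D + (\<kappa> * (\<Sum>p\<in>I. (U p)\<^sup>2) + D) + D"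
    using c V(2) mult_right_mono[OF assms(3) D0] by linarith
  finally show ?thesis by simp
qed

text \<open>Shifting the window drops k + 1 and adds k + n + 1, which select the same coordinate.
  Hence any n consecutive times transmit every coordinate exactly once.\<close>

lemma sum_mod_window: "(\<Sum>t\<in>{Suc k..k+n}. f ((t - 1) mod n)) = (\<Sum>l<n. f l)" for f :: "nat \<Rightarrow> real"
proof (induction k)
  case 0
  have "(\<Sum>t\<in>{Suc 0..0+n}. f ((t - 1) mod n)) = (\<Sum>t\<in>{..<n}. f t)"
    by (rule sum.reindex_bij_witness[of _ Suc "\<lambda>t. t - 1"]) auto
  then show ?case by simp
next
  case (Suc k)
  show ?case
  proof (cases "n = 0")
    case False
    have "(\<Sum>t\<in>{Suc (Suc k)..Suc k + n}. f ((t - 1) mod n)) + f (k mod n)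
        = (\<Sum>t\<in>{Suc k..Suc k + n}. f ((t - 1) mod n))"
      by (subst (2) sum.atLeast_Suc_atMost) auto
    also have "\<dots> = (\<Sum>t\<in>{Suc k..k + n}. f ((t - 1) mod n)) + f (k mod n)" by simp
    finally show ?thesis using Suc by simp
  qed simp
qed

text \<open>The first n steps visit all coordinates, so by the Poincare inequality the consensus
  energy controls every deviation from the reference node \<open>o'\<close>. Excitation over p steps
  controls the value at \<open>o'\<close> up to these deviations, which enter with the factor
  \<open>B'\<close>; by \<open>c3\<close> half of the consensus energy pays for them. Allowing
  \<open>B'\<close> below B makes this possible for every positive \<gamma>, however large B
  is.\<close>

lemma netop_coercive:
  fixes a :: "'v::finite \<Rightarrow> 'v \<Rightarrow> real" and \<tau> :: "nat \<Rightarrow> 'v \<Rightarrow> 'v \<Rightarrow> real"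
    and h :: "nat \<Rightarrow> 'v \<Rightarrow> nat \<Rightarrow> nat \<Rightarrow> real" and o' :: 'v
  assumes n: "n > 0" and a0: "\<And>i j. a i j \<ge> 0" and K: "K > 0"
    and poinc: "\<And>u::'v \<Rightarrow> real. (\<Sum>i\<in>UNIV. (u i - u o')\<^sup>2) \<le> K * (\<Sum>i\<in>UNIV. \<Sum>j\<in>UNIV. a i j * (u i - u j)\<^sup>2)"
    and pe: "\<And>x. real p * \<delta> * (vnorm n x)\<^sup>2 \<le> (\<Sum>t\<in>{Suc k..k+p}. \<Sum>i\<in>UNIV. (vnorm (m i) (mat_vec n (h t i) x))\<^sup>2)"
    and Hb: "\<And>t i. t \<in> {Suc k..k+p} \<Longrightarrow> mnorm (m i) n (h t i) \<le> Hb"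
    and sym: "\<And>t i j. t \<in> {Suc k..k+(n+p)} \<Longrightarrow> \<tau> t i j = \<tau> t j i"
    and \<tau>: "\<And>t i j. t \<in> {Suc k..k+(n+p)} \<Longrightarrow> \<gamma> * a i j \<le> \<tau> t i j"
    and \<gamma>: "\<gamma> \<ge> 0" and B': "0 \<le> B'" "B' \<le> B" and \<mu>: "\<mu> \<ge> 0"
    and c1: "8 * K * \<mu> \<le> \<gamma>" and c2: "4 * real CARD('v) * \<mu> \<le> real p * \<delta> * B'"
    and c3: "4 * K * (real p * Hb\<^sup>2) * B' \<le> \<gamma>"
  shows "\<mu> * (L2_set y (UNIV \<times> {..<n}))\<^sup>2
    \<le> (\<Sum>t\<in>{Suc k..k+(n+p)}. \<Sum>q\<in>UNIV \<times> {..<n}. y q * netop n m B (h t) (sc_coord n t) (\<tau> t) y q)"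
proof -
  define En where "En l = (\<Sum>i\<in>UNIV. \<Sum>j\<in>UNIV. a i j * (y (i, l) - y (j, l))\<^sup>2)" for l
  define W where "W t = (\<Sum>i\<in>UNIV. (vnorm (m i) (mat_vec n (h t i) (\<lambda>c. y (i, c))))\<^sup>2)" for t
  define Dev where "Dev = (\<Sum>i\<in>UNIV. \<Sum>c<n. (y (i, c) - y (o', c))\<^sup>2)"
  define Y0 where "Y0 = (vnorm n (\<lambda>c. y (o', c)))\<^sup>2"
  have En0: "En l \<ge> 0" for l unfolding En_def using a0 by (intro sum_nonneg mult_nonneg_nonneg) auto
  have W0: "W t \<ge> 0" for t unfolding W_def by (intro sum_nonneg) auto
  have Dev0: "Dev \<ge> 0" unfolding Dev_def by (intro sum_nonneg) auto
  have Y00: "Y0 \<ge> 0" by (simp add: Y0_def)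
  have coord: "sc_coord n t < n" for t using n by (simp add: sc_coord_def)
  have vn: "(vnorm N x)\<^sup>2 = (\<Sum>c<N. (x c)\<^sup>2)" for N x by (simp add: vnorm_def sum_nonneg)
  have inner: "\<gamma> / 2 * En (sc_coord n t) + B' * W t
      \<le> (\<Sum>q\<in>UNIV \<times> {..<n}. y q * netop n m B (h t) (sc_coord n t) (\<tau> t) y q)" if t: "t \<in> {Suc k..k+(n+p)}" for t
  proof -
    have "\<gamma> / 2 * En (sc_coord n t) \<le> (\<Sum>i\<in>UNIV. \<Sum>j\<in>UNIV. \<tau> t i j * (y (i, sc_coord n t) - y (j, sc_coord n t))\<^sup>2) / 2"
    proof -
      have "\<gamma> * En (sc_coord n t) = (\<Sum>i\<in>UNIV. \<Sum>j\<in>UNIV. (\<gamma> * a i j) * (y (i, sc_coord n t) - y (j, sc_coord n t))\<^sup>2)"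
        unfolding En_def sum_distrib_left by (simp add: mult_ac)
      also have "\<dots> \<le> (\<Sum>i\<in>UNIV. \<Sum>j\<in>UNIV. \<tau> t i j * (y (i, sc_coord n t) - y (j, sc_coord n t))\<^sup>2)"
        by (intro sum_mono mult_right_mono \<tau>[OF t]) auto
      finally show ?thesis by simp
    qed
    moreover have "B' * W t \<le> B * W t" using B' W0 by (intro mult_right_mono)
    moreover have "W t = (\<Sum>i\<in>UNIV. \<Sum>r<m i. (\<Sum>c<n. h t i r c * y (i, c))\<^sup>2)"
      unfolding W_def by (simp add: vn mat_vec_def)
    ultimately show ?thesis
      using netop_inner[where l = "sc_coord n t" and \<tau> = "\<tau> t" and y = y and m = m and B = B and h = "h t", OF coord sym[OF t]] by simp
  qed
  have "(\<Sum>t\<in>{Suc k..k+(n+p)}. En (sc_coord n t)) \<ge> Dev / K"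
  proof -
    have "Dev = (\<Sum>l<n. \<Sum>i\<in>UNIV. (y (i, l) - y (o', l))\<^sup>2)" unfolding Dev_def by (rule sum.swap)
    also have "\<dots> \<le> (\<Sum>l<n. K * En l)" 
    proof (rule sum_mono)
      show "(\<Sum>i\<in>UNIV. (y (i, l) - y (o', l))\<^sup>2) \<le> K * En l" for l
        unfolding En_def using poinc[of "\<lambda>i. y (i, l)"] .
    qed
    also have "\<dots> = K * (\<Sum>t\<in>{Suc k..k+n}. En (sc_coord n t))"
      unfolding sc_coord_def sum_mod_window sum_distrib_left ..
    also have "\<dots> \<le> K * (\<Sum>t\<in>{Suc k..k+(n+p)}. En (sc_coord n t))"
      using K En0 by (intro mult_left_mono sum_mono2) auto
    finally show ?thesis using K by (simp add: divide_le_eq mult.commute)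
  qed
  then have 1: "\<gamma> / 2 * (Dev / K) \<le> (\<Sum>t\<in>{Suc k..k+(n+p)}. \<gamma> / 2 * En (sc_coord n t))"
    unfolding sum_distrib_left[symmetric] using \<gamma> by (intro mult_left_mono) auto
  have "(\<Sum>t\<in>{Suc k..k+(n+p)}. W t) \<ge> real p * \<delta> * Y0 / 2 - real p * Hb\<^sup>2 * Dev"
  proof -
    have "real p * \<delta> * Y0 / 2 - real p * Hb\<^sup>2 * Dev
       \<le> (\<Sum>t\<in>{Suc k..k+p}. (\<Sum>i\<in>UNIV. (vnorm (m i) (mat_vec n (h t i) (\<lambda>c. y (o', c))))\<^sup>2) / 2 - Hb\<^sup>2 * Dev)"
      using pe[of "\<lambda>c. y (o', c)"] by (simp add: Y0_def sum_subtractf sum_divide_distrib[symmetric])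
    also have "\<dots> \<le> (\<Sum>t\<in>{Suc k..k+p}. W t)"
    proof (rule sum_mono)
      fix t assume t: "t \<in> {Suc k..k+p}"
      \<comment> \<open>Trades the value at the reference node for the value at node i: half of the
        former square is kept, and the difference costs \<open>Hb\<^sup>2\<close> times the
        deviation.\<close>
      have "(vnorm (m i) (mat_vec n (h t i) (\<lambda>c. y (o', c))))\<^sup>2 / 2 - Hb\<^sup>2 * (\<Sum>c<n. (y (i, c) - y (o', c))\<^sup>2)
         \<le> (vnorm (m i) (mat_vec n (h t i) (\<lambda>c. y (i, c))))\<^sup>2" for i
      proof -
        have dv: "mat_vec n (h t i) (\<lambda>c. y (i, c)) r - mat_vec n (h t i) (\<lambda>c. y (o', c)) r = (\<Sum>c<n. h t i r c * (y (i, c) - y (o', c)))" for r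
          by (simp add: mat_vec_def sum_subtractf algebra_simps)
        have "(\<Sum>r<m i. (mat_vec n (h t i) (\<lambda>c. y (i, c)) r - mat_vec n (h t i) (\<lambda>c. y (o', c)) r)\<^sup>2)
          \<le> (\<Sum>r<m i. (\<Sum>c<n. (h t i r c)\<^sup>2) * (\<Sum>c<n. (y (i, c) - y (o', c))\<^sup>2))"
          unfolding dv by (intro sum_mono Cauchy_Schwarz_ineq_sum)
        also have "\<dots> = (mnorm (m i) n (h t i))\<^sup>2 * (\<Sum>c<n. (y (i, c) - y (o', c))\<^sup>2)"
          unfolding mnorm_def by (simp add: sum_nonneg sum_distrib_right)
        also have "\<dots> \<le> Hb\<^sup>2 * (\<Sum>c<n. (y (i, c) - y (o', c))\<^sup>2)"
          by (intro mult_right_mono power_mono Hb t sum_nonneg) (auto simp: mnorm_def sum_nonneg)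
        finally have "(\<Sum>r<m i. (mat_vec n (h t i) (\<lambda>c. y (i, c)) r - mat_vec n (h t i) (\<lambda>c. y (o', c)) r)\<^sup>2) \<le> Hb\<^sup>2 * (\<Sum>c<n. (y (i, c) - y (o', c))\<^sup>2)" .
        moreover have "(\<Sum>r<m i. (mat_vec n (h t i) (\<lambda>c. y (o', c)) r)\<^sup>2 / 2)
          \<le> (\<Sum>r<m i. (mat_vec n (h t i) (\<lambda>c. y (i, c)) r)\<^sup>2 + (mat_vec n (h t i) (\<lambda>c. y (i, c)) r - mat_vec n (h t i) (\<lambda>c. y (o', c)) r)\<^sup>2)"
        proof (rule sum_mono)
          fix r
          have "q\<^sup>2 / 2 \<le> x\<^sup>2 + (x - q)\<^sup>2" for x q :: real
            using zero_le_power2[of "2 * x - q"] by (simp add: power2_eq_square algebra_simps)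
          then show "(mat_vec n (h t i) (\<lambda>c. y (o', c)) r)\<^sup>2 / 2
            \<le> (mat_vec n (h t i) (\<lambda>c. y (i, c)) r)\<^sup>2 + (mat_vec n (h t i) (\<lambda>c. y (i, c)) r - mat_vec n (h t i) (\<lambda>c. y (o', c)) r)\<^sup>2" .
        qed
        ultimately show ?thesis unfolding vn sum.distrib sum_divide_distrib by linarith
      qed
      then have "(\<Sum>i\<in>UNIV. (vnorm (m i) (mat_vec n (h t i) (\<lambda>c. y (o', c))))\<^sup>2 / 2 - Hb\<^sup>2 * (\<Sum>c<n. (y (i, c) - y (o', c))\<^sup>2)) \<le> W t"
        unfolding W_def by (intro sum_mono)
      then show "(\<Sum>i\<in>UNIV. (vnorm (m i) (mat_vec n (h t i) (\<lambda>c. y (o', c))))\<^sup>2) / 2 - Hb\<^sup>2 * Dev \<le> W t"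
        by (simp add: sum_subtractf sum_divide_distrib sum_distrib_left Dev_def)
    qed
    also have "\<dots> \<le> (\<Sum>t\<in>{Suc k..k+(n+p)}. W t)" using W0 by (intro sum_mono2) auto
    finally show ?thesis .
  qed
  then have 2: "B' * (real p * \<delta> * Y0 / 2 - real p * Hb\<^sup>2 * Dev) \<le> (\<Sum>t\<in>{Suc k..k+(n+p)}. B' * W t)"
    unfolding sum_distrib_left[symmetric] using B' by (intro mult_left_mono) auto
  have norm: "(L2_set y (UNIV \<times> {..<n}))\<^sup>2 \<le> 2 * real CARD('v) * Y0 + 2 * Dev"
  proof -
    have "(L2_set y (UNIV \<times> {..<n}))\<^sup>2 = (\<Sum>i\<in>UNIV. \<Sum>c<n. (y (i, c))\<^sup>2)" unfolding L2_set_power2 by (rule sum_pairs)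
    also have "\<dots> \<le> (\<Sum>i\<in>UNIV. \<Sum>c<n. 2 * (y (o', c))\<^sup>2 + 2 * (y (i, c) - y (o', c))\<^sup>2)"
    proof (intro sum_mono)
      fix i c
      have "x\<^sup>2 \<le> 2 * q\<^sup>2 + 2 * (x - q)\<^sup>2" for x q :: real
        using zero_le_power2[of "x - 2 * q"] by (simp add: power2_eq_square algebra_simps)
      then show "(y (i, c))\<^sup>2 \<le> 2 * (y (o', c))\<^sup>2 + 2 * (y (i, c) - y (o', c))\<^sup>2" .
    qed
    also have "\<dots> = 2 * real CARD('v) * Y0 + 2 * Dev"
      by (simp add: sum.distrib sum_distrib_left Y0_def vn Dev_def mult_ac)
    finally show ?thesis .
  qed
  have "\<mu> * (L2_set y (UNIV \<times> {..<n}))\<^sup>2 \<le> \<mu> * (2 * real CARD('v) * Y0 + 2 * Dev)"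
    using norm \<mu> by (rule mult_left_mono)
  also have "\<dots> \<le> \<gamma> / 2 * (Dev / K) + B' * (real p * \<delta> * Y0 / 2 - real p * Hb\<^sup>2 * Dev)"
  proof -
    have "(4 * real CARD('v) * \<mu>) * Y0 \<le> (real p * \<delta> * B') * Y0" using c2 Y00 by (rule mult_right_mono)
    moreover have "(2 * \<mu>) * Dev \<le> (\<gamma> / (4 * K)) * Dev" using c1 K Dev0 by (intro mult_right_mono) (auto simp: field_simps)
    moreover have "(B' * (real p * Hb\<^sup>2)) * Dev \<le> (\<gamma> / (4 * K)) * Dev"
      using c3 K Dev0 by (intro mult_right_mono) (auto simp: field_simps)
    moreover have "\<gamma> / 2 * (Dev / K) = (\<gamma> / (4 * K)) * Dev + (\<gamma> / (4 * K)) * Dev" using K by (simp add: field_simps)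
    ultimately show ?thesis by (simp add: algebra_simps)
  qed
  also have "\<dots> \<le> (\<Sum>t\<in>{Suc k..k+(n+p)}. \<gamma> / 2 * En (sc_coord n t) + B' * W t)"
    using 1 2 by (simp add: sum.distrib)
  also have "\<dots> \<le> (\<Sum>t\<in>{Suc k..k+(n+p)}. \<Sum>q\<in>UNIV \<times> {..<n}. y q * netop n m B (h t) (sc_coord n t) (\<tau> t) y q)"
    by (intro sum_mono inner)
  finally show ?thesis .
qed

section \<open>The algorithm as a perturbed linear recursion\<close>

lemma space_gen_sigma [simp]: "space (gen_sigma M fs) = space M"
  unfolding gen_sigma_def by (rule space_measure_of) auto

lemma sets_gen_sigma:
  "sets (gen_sigma M fs) = sigma_sets (space M) {f -` A \<inter> space M | f A. f \<in> fs \<and> A \<in> sets borel}"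
  unfolding gen_sigma_def by (rule sets_measure_of) auto

lemma gen_sigma_measurable:
  assumes "f \<in> fs"
  shows "f \<in> borel_measurable (gen_sigma M fs)"
proof (rule measurableI)
  fix A :: "real set" assume "A \<in> sets borel"
  then show "f -` A \<inter> space (gen_sigma M fs) \<in> sets (gen_sigma M fs)"
    unfolding sets_gen_sigma space_gen_sigma using assms by (intro sigma_sets.Basic) blast
qed simp

lemma gen_sigma_mono: "fs \<subseteq> gs \<Longrightarrow> sets (gen_sigma M fs) \<subseteq> sets (gen_sigma M gs)"
  unfolding sets_gen_sigma by (rule sigma_sets_mono') blast

lemma subalgebra_gen_sigma:
  assumes "\<And>f. f \<in> fs \<Longrightarrow> f \<in> borel_measurable M"
  shows "subalgebra M (gen_sigma M fs)"
proof -
  have "sets (gen_sigma M fs) \<subseteq> sets M"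
    unfolding sets_gen_sigma by (rule sets.sigma_sets_subset) (use assms in \<open>auto intro: measurable_sets\<close>)
  then show ?thesis by (simp add: subalgebra_def)
qed

definition wfilt :: "'a measure \<Rightarrow> ('v \<Rightarrow> nat) \<Rightarrow> ('v \<Rightarrow> nat \<Rightarrow> 'a \<Rightarrow> nat \<Rightarrow> real) \<Rightarrow> nat \<Rightarrow> 'a measure" where
  "wfilt M m w k = gen_sigma M {(\<lambda>\<omega>. w i t \<omega> r) | i t r. 1 \<le> t \<and> t \<le> k \<and> r < m i}"

definition wdfilt :: "'a measure \<Rightarrow> ('v \<Rightarrow> nat) \<Rightarrow> ('v \<Rightarrow> nat \<Rightarrow> 'a \<Rightarrow> nat \<Rightarrow> real) \<Rightarrow> ('v \<Rightarrow> nat \<Rightarrow> 'a \<Rightarrow> real)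
    \<Rightarrow> nat \<Rightarrow> 'a measure" where
  "wdfilt M m w d k = gen_sigma M ({(\<lambda>\<omega>. w i t \<omega> r) | i t r. 1 \<le> t \<and> t \<le> k \<and> r < m i}
     \<union> {d i t | i t. 1 \<le> t \<and> t \<le> k})"

text \<open>The witnesses of the boundedness and moment assumptions and the step-size constants
  \<open>A\<close>, \<open>B\<close> are parameters; \<open>\<nu>b\<close> is any bound below 1 / 2
  for the event-trigger coefficients on edges. All estimates up to the rate hold for arbitrary
  positive \<open>A\<close> and \<open>B\<close>.\<close>

locale sc_network = prob_space M for M :: "'a measure" +
  fixes n :: nat and m :: "'v::finite \<Rightarrow> nat" and a :: "'v \<Rightarrow> 'v \<Rightarrow> real"
    and H :: "'v \<Rightarrow> nat \<Rightarrow> nat \<Rightarrow> nat \<Rightarrow> real" and \<theta> :: "nat \<Rightarrow> real"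
    and w :: "'v \<Rightarrow> nat \<Rightarrow> 'a \<Rightarrow> nat \<Rightarrow> real" and d :: "'v \<Rightarrow> nat \<Rightarrow> 'a \<Rightarrow> real"
    and \<theta>0 :: "'v \<Rightarrow> nat \<Rightarrow> real" and \<nu> b :: "'v \<Rightarrow> 'v \<Rightarrow> real"
    and A B Hb \<rho> \<nu>b :: real
  assumes n_pos: "0 < n"
    and a_sym: "\<And>i j. a i j = a j i" and a_nonneg: "\<And>i j. a i j \<ge> 0"
    and A_pos: "A > 0" and B_pos: "B > 0" and Hb_pos: "Hb > 0"
    and H_le: "\<And>i k. k \<ge> 1 \<Longrightarrow> mnorm (m i) n (H i k) \<le> Hb"
    and w_meas: "\<And>i k r. (\<lambda>\<omega>. w i k \<omega> r) \<in> borel_measurable M"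
    and w_int: "\<And>i k r. k \<ge> 1 \<Longrightarrow> r < m i \<Longrightarrow> integrable M (\<lambda>\<omega>. w i k \<omega> r)"
    and w_mds: "\<And>i k r. k \<ge> 1 \<Longrightarrow> r < m i \<Longrightarrow>
      AE \<omega> in M. real_cond_exp M (wdfilt M m w d (k - 1)) (\<lambda>\<omega>. w i k \<omega> r) \<omega> = 0"
    and \<rho>: "\<rho> > 2"
    and w_moment: "AE \<omega> in M. (SUP ik \<in> UNIV \<times> {1..}. nn_cond_exp M (wfilt M m w (snd ik - 1))
       (\<lambda>\<omega>. ennreal (vnorm (m (fst ik)) (w (fst ik) (snd ik) \<omega>) powr \<rho>)) \<omega>) < \<infinity>"
    and d_lap: "\<And>i k. k \<ge> 1 \<Longrightarrow> distributed M lborel (d i k) (\<lambda>x. ennreal (exp (- \<bar>x\<bar>) / 2))"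
    and d_indep: "indep_sets
       (\<lambda>j. case j of Inl (i, k) \<Rightarrow> sets (gen_sigma M {d i k})
                   | Inr () \<Rightarrow> sets (gen_sigma M {(\<lambda>\<omega>. w i t \<omega> r) | i t r. 1 \<le> t \<and> r < m i}))
       (Inl ` {(i, k). k \<ge> 1} \<union> {Inr ()})"
    and \<nu>_sym: "\<And>i j. a i j > 0 \<Longrightarrow> \<nu> i j = \<nu> j i"
    and \<nu>_nonneg: "\<And>i j. a i j > 0 \<Longrightarrow> 0 \<le> \<nu> i j" and \<nu>_le: "\<And>i j. a i j > 0 \<Longrightarrow> \<nu> i j \<le> \<nu>b"
    and \<nu>b: "0 \<le> \<nu>b" "\<nu>b < 1 / 2"
    and b_sym: "\<And>i j. a i j > 0 \<Longrightarrow> b i j = b j i" and b_pos: "\<And>i j. a i j > 0 \<Longrightarrow> b i j > 0"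
begin

abbreviation I :: "('v \<times> nat) set" where "I \<equiv> UNIV \<times> {..<n}"

definition est :: "'a \<Rightarrow> nat \<Rightarrow> 'v \<Rightarrow> nat \<Rightarrow> real" where
  "est \<omega> k i c = sc_est n m a \<nu> b (\<lambda>i j k. A * real k powr (\<nu> i j - 1)) (\<lambda>i k. B / real k) H \<theta>0
     (\<lambda>i k r. mat_vec n (H i k) \<theta> r + w i k \<omega> r) (\<lambda>i k. d i k \<omega>) k i c"

definition er :: "'a \<Rightarrow> nat \<Rightarrow> 'v \<times> nat \<Rightarrow> real" where
  "er \<omega> k p = est \<omega> k (fst p) (snd p) - \<theta> (snd p)"

definition xs :: "'a \<Rightarrow> nat \<Rightarrow> 'v \<Rightarrow> real" where
  "xs \<omega> k i = est \<omega> (k - 1) i (sc_coord n k)"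

text \<open>The symbol received by i from j minus its conditional mean given the past. Coefficients
  carry the indices j i because the message travels from j to i.\<close>

definition eps :: "'a \<Rightarrow> 'v \<Rightarrow> 'v \<Rightarrow> nat \<Rightarrow> real" where
  "eps \<omega> i j k = one_bit (sc_thr \<nu> b j i k) (b j i) (xs \<omega> k j) (d j k \<omega>)
     - lap_trans (sc_thr \<nu> b j i k) (b j i) (xs \<omega> k j)"

abbreviation dn :: "'a \<Rightarrow> 'v \<Rightarrow> 'v \<Rightarrow> nat \<Rightarrow> real" where
  "dn \<omega> i j k \<equiv> A * real k powr (\<nu> i j - 1) * a i j * eps \<omega> i j k"

abbreviation dsum :: "'a \<Rightarrow> 'v \<Rightarrow> 'v \<Rightarrow> nat \<Rightarrow> nat \<Rightarrow> real" where
  "dsum \<omega> i j c k \<equiv> \<Sum>t\<in>{1..k}. (if sc_coord n t = c then real t powr \<nu> i j else 0) * eps \<omega> i j t"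

text \<open>The factor \<open>k powr \<nu>\<close> is k times the step size. On edges of a bounded
  path it cancels the decay of the slope, so the weights stay between positive constants.\<close>

definition tau :: "'a \<Rightarrow> nat \<Rightarrow> 'v \<Rightarrow> 'v \<Rightarrow> real" where
  "tau \<omega> k i j = A * real k powr \<nu> i j * a i j
     * lap_slope (sc_thr \<nu> b i j k) (b i j) (xs \<omega> k i) (xs \<omega> k j)"

definition Q :: "'a \<Rightarrow> nat \<Rightarrow> ('v \<times> nat \<Rightarrow> real) \<Rightarrow> 'v \<times> nat \<Rightarrow> real" where
  "Q \<omega> k = netop n m B (\<lambda>i. H i k) (sc_coord n k) (tau \<omega> k)"

text \<open>Dither noise as it enters the error at time k. It and \<open>nw\<close> contain the step
  size, whereas \<open>Q\<close> is still to be divided by k.\<close>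

definition nd :: "'a \<Rightarrow> nat \<Rightarrow> 'v \<times> nat \<Rightarrow> real" where
  "nd \<omega> k p = (if snd p = sc_coord n k
     then \<Sum>j\<in>UNIV. A * real k powr (\<nu> (fst p) j - 1) * a (fst p) j * eps \<omega> (fst p) j k else 0)"

definition nw :: "'a \<Rightarrow> nat \<Rightarrow> 'v \<times> nat \<Rightarrow> real" where
  "nw \<omega> k p = B / real k * (\<Sum>r<m (fst p). H (fst p) k r (snd p) * w (fst p) k \<omega> r)"

lemma thr_sym: "a i j > 0 \<Longrightarrow> sc_thr \<nu> b i j k = sc_thr \<nu> b j i k"
  using \<nu>_sym[of i j] b_sym[of i j] by (simp add: sc_thr_def)

lemma thr_nonneg: "a i j > 0 \<Longrightarrow> k \<ge> 1 \<Longrightarrow> 0 \<le> sc_thr \<nu> b i j k"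
  using \<nu>_nonneg b_pos by (simp add: sc_thr_def less_imp_le)

lemma exp_thr: "a i j > 0 \<Longrightarrow> k \<ge> 1 \<Longrightarrow> exp (- sc_thr \<nu> b i j k / b i j) = real k powr (- \<nu> i j)"
  using b_pos[of i j] by (simp add: sc_thr_def powr_def)

lemma coord_less: "sc_coord n k < n"
  using n_pos by (simp add: sc_coord_def)

text \<open>The linear form is exact. The received symbol is \<open>eps\<close> plus
  \<open>G\<close> at the sender's value, and by symmetry of the coefficients the same
  \<open>G\<close> is subtracted at the receiver's value. \<open>lap_slope\<close> makes the
  difference linear in the difference of the two estimates, in which \<theta> cancels.\<close>

lemma er_Suc:
  "er \<omega> (Suc t) p = er \<omega> t p - Q \<omega> (Suc t) (er \<omega> t) p / real (Suc t) + nd \<omega> (Suc t) p + nw \<omega> (Suc t) p"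
proof -
  obtain i c where p: "p = (i, c)" by (cases p)
  define k where "k = Suc t"
  define l where "l = sc_coord n k"
  have k0: "real k > 0" by (simp add: k_def)
  have xs: "xs \<omega> k j = est \<omega> t j l" for j by (simp add: xs_def k_def l_def)
  have e1: "est \<omega> k i c = est \<omega> t i c
      + (if c = l then \<Sum>j\<in>{j. a i j > 0}. A * real k powr (\<nu> i j - 1) * a i j *
           (sc_msg \<nu> b (est \<omega> t j l) (d j k \<omega>) j i k - sc_G \<nu> b i j k (est \<omega> t i l)) else 0)
      + B / real k * matT_vec (m i) (H i k) (\<lambda>r. mat_vec n (H i k) \<theta> r + w i k \<omega> r - mat_vec n (H i k) (est \<omega> t i) r) c"
    unfolding est_def k_def l_def by (simp add: Let_def)
  have c1: "(\<Sum>j\<in>{j. a i j > 0}. A * real k powr (\<nu> i j - 1) * a i j *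
           (sc_msg \<nu> b (est \<omega> t j l) (d j k \<omega>) j i k - sc_G \<nu> b i j k (est \<omega> t i l)))
      = (\<Sum>j\<in>UNIV. dn \<omega> i j k)
        - (\<Sum>j\<in>UNIV. tau \<omega> k i j * (er \<omega> t (i, l) - er \<omega> t (j, l))) / real k"
  proof -
    have "(\<Sum>j\<in>{j. a i j > 0}. A * real k powr (\<nu> i j - 1) * a i j *
           (sc_msg \<nu> b (est \<omega> t j l) (d j k \<omega>) j i k - sc_G \<nu> b i j k (est \<omega> t i l)))
      = (\<Sum>j\<in>{j. a i j > 0}. dn \<omega> i j k
          - tau \<omega> k i j * (er \<omega> t (i, l) - er \<omega> t (j, l)) / real k)"
    proof (rule sum.cong)
      fix j assume "j \<in> {j. a i j > 0}"
      then have aij: "a i j > 0" by simp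
      define C where "C = sc_thr \<nu> b i j k"
      have tauj: "tau \<omega> k i j * (er \<omega> t (i, l) - er \<omega> t (j, l)) / real k
         = A * real k powr (\<nu> i j - 1) * a i j * (lap_slope C (b i j) (xs \<omega> k i) (xs \<omega> k j) * (xs \<omega> k i - xs \<omega> k j))"
        unfolding tau_def C_def using k0 by (simp add: powr_diff er_def xs)
      have "sc_msg \<nu> b (est \<omega> t j l) (d j k \<omega>) j i k - sc_G \<nu> b i j k (est \<omega> t i l)
        = eps \<omega> i j k - lap_slope C (b i j) (xs \<omega> k i) (xs \<omega> k j) * (xs \<omega> k i - xs \<omega> k j)"
        unfolding lap_slope_mult sc_msg_eq sc_G_eq eps_def C_def xs
        using thr_sym[OF aij] b_sym[OF aij] by simp
      then show "A * real k powr (\<nu> i j - 1) * a i j *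
           (sc_msg \<nu> b (est \<omega> t j l) (d j k \<omega>) j i k - sc_G \<nu> b i j k (est \<omega> t i l))
        = dn \<omega> i j k - tau \<omega> k i j * (er \<omega> t (i, l) - er \<omega> t (j, l)) / real k"
        unfolding tauj by (simp add: right_diff_distrib)
    qed simp
    also have "\<dots> = (\<Sum>j\<in>UNIV. dn \<omega> i j k
          - tau \<omega> k i j * (er \<omega> t (i, l) - er \<omega> t (j, l)) / real k)"
    proof (rule sum.mono_neutral_left)
      show "\<forall>j\<in>UNIV - {j. a i j > 0}. dn \<omega> i j k
          - tau \<omega> k i j * (er \<omega> t (i, l) - er \<omega> t (j, l)) / real k = 0"
      proof
        fix j assume "j \<in> UNIV - {j. a i j > 0}"
        then have "a i j = 0" using a_nonneg[of i j] by auto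
        then show "dn \<omega> i j k
          - tau \<omega> k i j * (er \<omega> t (i, l) - er \<omega> t (j, l)) / real k = 0" by (simp add: tau_def)
      qed
    qed auto
    finally show ?thesis by (simp add: sum_subtractf sum_divide_distrib)
  qed
  have c2: "matT_vec (m i) (H i k) (\<lambda>r. mat_vec n (H i k) \<theta> r + w i k \<omega> r - mat_vec n (H i k) (est \<omega> t i) r) c
     = (\<Sum>r<m i. H i k r c * w i k \<omega> r) - (\<Sum>r<m i. H i k r c * (\<Sum>c'<n. H i k r c' * er \<omega> t (i, c')))"
    unfolding matT_vec_def mat_vec_def er_def sum_subtractf[symmetric]
    by (rule sum.cong) (auto simp: algebra_simps sum_subtractf)
  define T where "T = (\<Sum>j\<in>UNIV. tau \<omega> k i j * (er \<omega> t (i, l) - er \<omega> t (j, l)))"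
  define N where "N = (\<Sum>j\<in>UNIV. dn \<omega> i j k)"
  define V where "V = (\<Sum>r<m i. H i k r c * (\<Sum>c'<n. H i k r c' * er \<omega> t (i, c')))"
  define W where "W = (\<Sum>r<m i. H i k r c * w i k \<omega> r)"
  have Q1: "Q \<omega> k (er \<omega> t) (i, c) = (if c = l then T else 0) + B * V"
    by (simp add: Q_def netop_def T_def V_def l_def)
  have N1: "nd \<omega> k (i, c) = (if c = l then N else 0)" by (simp add: nd_def N_def l_def)
  have W1: "nw \<omega> k (i, c) = B / real k * W" by (simp add: nw_def W_def)
  have "er \<omega> k (i, c) = est \<omega> k i c - \<theta> c" "er \<omega> t (i, c) = est \<omega> t i c - \<theta> c" by (simp_all add: er_def)
  moreover have "est \<omega> k i c = est \<omega> t i c + (if c = l then N - T / real k else 0) + B / real k * (W - V)"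
    using e1 c1 c2 by (simp add: T_def N_def V_def W_def)
  ultimately have "er \<omega> k (i, c) = er \<omega> t (i, c) - Q \<omega> k (er \<omega> t) (i, c) / real k + nd \<omega> k (i, c) + nw \<omega> k (i, c)"
    unfolding Q1 N1 W1 by (simp add: add_divide_distrib right_diff_distrib diff_divide_distrib)
  then show ?thesis by (simp add: p k_def)
qed

text \<open>\<open>U k = avg f k\<close> solves \<open>U k = (1 - 1 / k) U (k - 1) + f k\<close>; subtracting it from the error removes
  the noise \<open>f\<close> from the recursion at the price of a perturbation of order \<open>U / k\<close>.\<close>

definition avg :: "(nat \<Rightarrow> 'v \<times> nat \<Rightarrow> real) \<Rightarrow> nat \<Rightarrow> 'v \<times> nat \<Rightarrow> real" where
  "avg f k p = (\<Sum>t\<in>{1..k}. real t * f t p) / real k"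

lemma avg_Suc: "avg f (Suc k) p = avg f k p - avg f k p / real (Suc k) + f (Suc k) p"
proof (cases "k = 0")
  case True
  then show ?thesis by (simp add: avg_def)
next
  case False
  define S where "S = (\<Sum>t\<in>{1..k}. real t * f t p)"
  have "S / real k - S / real k / real (Suc k) = S / real (Suc k)" using False by (simp add: divide_simps) (simp add: algebra_simps)
  moreover have "avg f (Suc k) p = S / real (Suc k) + f (Suc k) p"
    unfolding avg_def S_def by (simp add: add_divide_distrib)
  ultimately show ?thesis by (simp add: avg_def S_def)
qed

text \<open>\<open>Gf k\<close> contains the observation noise of all times, also future ones: for the conditional law of the
  next dither this is harmless, and predictable weights may depend on it.\<close>

definition Gf :: "nat \<Rightarrow> 'a measure" where
  "Gf k = gen_sigma M ({(\<lambda>\<omega>. w i t \<omega> r) | i t r. 1 \<le> t \<and> r < m i} \<union> {d i t | i t. 1 \<le> t \<and> t \<le> k})"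

lemma d_borel: "k \<ge> 1 \<Longrightarrow> d i k \<in> borel_measurable M"
  using d_lap[of k i] by (simp add: distributed_def)

lemma Gf_sub: "subalgebra M (Gf k)"
  unfolding Gf_def by (rule subalgebra_gen_sigma) (auto intro: w_meas d_borel)

lemma Gf_mono: "sets (Gf k) \<subseteq> sets (Gf (Suc k))"
  unfolding Gf_def by (rule gen_sigma_mono, rule Un_mono) (blast intro: le_SucI)+

lemma Gf_lift: "s \<le> t \<Longrightarrow> f \<in> borel_measurable (Gf s) \<Longrightarrow> f \<in> borel_measurable (Gf t)" for f :: "'a \<Rightarrow> real"
  by (rule measurable_filtration_mono[where \<G> = Gf, OF Gf_sub Gf_mono])

lemma w_Gf: "t \<ge> 1 \<Longrightarrow> r < m i \<Longrightarrow> (\<lambda>\<omega>. w i t \<omega> r) \<in> borel_measurable (Gf k)"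
  unfolding Gf_def by (rule gen_sigma_measurable) blast

lemma d_Gf: "t \<ge> 1 \<Longrightarrow> t \<le> k \<Longrightarrow> d i t \<in> borel_measurable (Gf k)"
  unfolding Gf_def by (rule gen_sigma_measurable) blast

lemma tau_sym: "tau \<omega> k i j = tau \<omega> k j i"
proof (cases "a i j > 0")
  case True
  then show ?thesis unfolding tau_def
    using \<nu>_sym[OF True] b_sym[OF True] thr_sym[OF True] a_sym[of i j] by (simp add: lap_slope_sym)
next
  case False
  then have "a i j = 0" "a j i = 0" using a_nonneg[of i j] a_sym[of i j] by auto
  then show ?thesis by (simp add: tau_def)
qed

lemma nw_meas: "k \<ge> 1 \<Longrightarrow> (\<lambda>\<omega>. nw \<omega> k p) \<in> borel_measurable (Gf t)"
  unfolding nw_def by (intro borel_measurable_times borel_measurable_sum borel_measurable_const w_Gf) auto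

lemma eps_meas_of_xs:
  assumes x: "\<And>j. (\<lambda>\<omega>. xs \<omega> (Suc t) j) \<in> borel_measurable (Gf t)"
  shows "(\<lambda>\<omega>. eps \<omega> i j (Suc t)) \<in> borel_measurable (Gf (Suc t))"
proof -
  have [measurable]: "(\<lambda>\<omega>. xs \<omega> (Suc t) j) \<in> borel_measurable (Gf (Suc t))"
    by (rule Gf_lift[OF _ x]) simp
  have [measurable]: "d j (Suc t) \<in> borel_measurable (Gf (Suc t))" by (rule d_Gf) auto
  show ?thesis unfolding eps_def by measurable
qed

text \<open>\<open>lap_slope\<close> is defined by cases, but multiplied by the difference of errors
  it becomes a difference of two values of \<open>lap_trans\<close>, from which measurability is
  immediate.\<close>

lemma Q_er_meas:
  assumes e: "\<And>p. (\<lambda>\<omega>. er \<omega> t p) \<in> borel_measurable (Gf t)"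
  shows "(\<lambda>\<omega>. Q \<omega> (Suc t) (er \<omega> t) p) \<in> borel_measurable (Gf t)"
proof -
  obtain i c where p: "p = (i, c)" by (cases p)
  define l where "l = sc_coord n (Suc t)"
  note [measurable] = e
  have xs_eq: "xs \<omega> (Suc t) j = er \<omega> t (j, l) + \<theta> l" for \<omega> j by (simp add: xs_def er_def l_def)
  have tau_er: "tau \<omega> (Suc t) i j * (er \<omega> t (i, l) - er \<omega> t (j, l))
     = A * real (Suc t) powr \<nu> i j * a i j * (lap_trans (sc_thr \<nu> b i j (Suc t)) (b i j) (er \<omega> t (i, l) + \<theta> l)
       - lap_trans (sc_thr \<nu> b i j (Suc t)) (b i j) (er \<omega> t (j, l) + \<theta> l))" for \<omega> j
    unfolding tau_def mult.assoc lap_slope_mult[symmetric] xs_eq by simp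
  show ?thesis
    unfolding p Q_def netop_def prod.case l_def[symmetric] tau_er by measurable
qed

lemma er_meas: "(\<lambda>\<omega>. er \<omega> t p) \<in> borel_measurable (Gf t)"
proof (induction t arbitrary: p)
  case 0
  show ?case by (simp add: er_def est_def)
next
  case (Suc t)
  have xs_meas: "(\<lambda>\<omega>. xs \<omega> (Suc t) j) \<in> borel_measurable (Gf t)" for j
  proof -
    have "(\<lambda>\<omega>. xs \<omega> (Suc t) j) = (\<lambda>\<omega>. er \<omega> t (j, sc_coord n (Suc t)) + \<theta> (sc_coord n (Suc t)))"
      by (simp add: xs_def er_def)
    then show ?thesis using Suc.IH[of "(j, sc_coord n (Suc t))"] by simp
  qed
  note eps_meas_of_xs[OF xs_meas, measurable]
  have [measurable]: "(\<lambda>\<omega>. nd \<omega> (Suc t) p) \<in> borel_measurable (Gf (Suc t))"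
    unfolding nd_def by measurable
  note nw_meas[of "Suc t" p "Suc t", simplified, measurable]
  have [measurable]: "(\<lambda>\<omega>. er \<omega> t p) \<in> borel_measurable (Gf (Suc t))"
    by (rule Gf_lift[OF _ Suc.IH]) simp
  have [measurable]: "(\<lambda>\<omega>. Q \<omega> (Suc t) (er \<omega> t) p) \<in> borel_measurable (Gf (Suc t))"
    by (rule Gf_lift[OF _ Q_er_meas[OF Suc.IH]]) simp
  show ?case unfolding er_Suc by measurable
qed

lemma xs_meas: "(\<lambda>\<omega>. xs \<omega> (Suc t) j) \<in> borel_measurable (Gf t)"
proof -
  have "(\<lambda>\<omega>. xs \<omega> (Suc t) j) = (\<lambda>\<omega>. er \<omega> t (j, sc_coord n (Suc t)) + \<theta> (sc_coord n (Suc t)))"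
    by (simp add: xs_def er_def)
  then show ?thesis using er_meas[of t "(j, sc_coord n (Suc t))"] by simp
qed

text \<open>The joint independence of all dithers and the observation noise is regrouped into two
  blocks of indices: those generating \<open>Gf t\<close>, and the single next dither.\<close>

lemma d_indep_Gf:
  assumes S: "S \<in> sets (Gf t)" and C: "C \<in> sets borel"
  shows "prob (S \<inter> (d j (Suc t) -` C \<inter> space M)) = prob S * prob (d j (Suc t) -` C \<inter> space M)"
proof -
  define E where "E = (\<lambda>j. case j of Inl (i, k) \<Rightarrow> sets (gen_sigma M {d i k})
     | Inr () \<Rightarrow> sets (gen_sigma M {(\<lambda>\<omega>. w i t \<omega> r) | i t r. 1 \<le> t \<and> r < m i}))"
  define J where "J = (\<lambda>x::bool. if x then insert (Inr ()) (Inl ` {(i, k). 1 \<le> k \<and> k \<le> t}) else {Inl (j, Suc t)})"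
  have "indep_sets E (\<Union>x\<in>UNIV. J x)"
    by (rule indep_sets_mono_index[OF _ d_indep[folded E_def]]) (auto simp: J_def split: if_splits)
  moreover have "Int_stable (E x)" for x
    unfolding E_def by (auto split: sum.splits prod.splits unit.splits intro: sets.Int_stable)
  moreover have "disjoint_family_on J UNIV"
    unfolding disjoint_family_on_def J_def by auto
  ultimately have ind: "indep_sets (\<lambda>x. sigma_sets (space M) (\<Union>i\<in>J x. E i)) UNIV"
    by (rule indep_sets_collect_sigma)
  have 1: "S \<in> sigma_sets (space M) (\<Union>i\<in>J True. E i)"
  proof -
    have S_in: "S \<in> sigma_sets (space M) {f -` A \<inter> space M | f A. f \<in> {(\<lambda>\<omega>. w i t \<omega> r) | i t r. 1 \<le> t \<and> r < m i}
        \<union> {d i s | i s. 1 \<le> s \<and> s \<le> t} \<and> A \<in> sets borel}"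
      using S unfolding Gf_def sets_gen_sigma .
    have sub: "{f -` A \<inter> space M | f A. f \<in> {(\<lambda>\<omega>. w i t \<omega> r) | i t r. 1 \<le> t \<and> r < m i}
        \<union> {d i s | i s. 1 \<le> s \<and> s \<le> t} \<and> A \<in> sets borel} \<subseteq> (\<Union>i\<in>J True. E i)"
    proof
      fix X assume "X \<in> {f -` A \<inter> space M | f A. f \<in> {(\<lambda>\<omega>. w i t \<omega> r) | i t r. 1 \<le> t \<and> r < m i}
        \<union> {d i s | i s. 1 \<le> s \<and> s \<le> t} \<and> A \<in> sets borel}"
      then obtain f A where X: "X = f -` A \<inter> space M" "A \<in> sets borel"
        and f: "f \<in> {(\<lambda>\<omega>. w i t \<omega> r) | i t r. 1 \<le> t \<and> r < m i} \<or> f \<in> {d i s | i s. 1 \<le> s \<and> s \<le> t}" by blast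
      from f show "X \<in> (\<Union>i\<in>J True. E i)"
      proof
        assume "f \<in> {(\<lambda>\<omega>. w i t \<omega> r) | i t r. 1 \<le> t \<and> r < m i}"
        then have "X \<in> E (Inr ())" unfolding E_def X sum.case unit.case
          using measurable_sets[OF gen_sigma_measurable X(2), of f "{(\<lambda>\<omega>. w i t \<omega> r) | i t r. 1 \<le> t \<and> r < m i}" M] by simp
        then show ?thesis by (auto simp: J_def)
      next
        assume "f \<in> {d i s | i s. 1 \<le> s \<and> s \<le> t}"
        then obtain i s where s: "f = d i s" "1 \<le> s" "s \<le> t" by blast
        have "X \<in> E (Inl (i, s))" unfolding E_def X sum.case prod.case s(1) using measurable_sets[OF gen_sigma_measurable X(2), of "d i s" "{d i s}" M] by simp
        then show ?thesis using s by (auto simp: J_def)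
      qed
    qed
    show ?thesis by (rule subsetD[OF sigma_sets_mono'[OF sub] S_in])
  qed
  have 2: "d j (Suc t) -` C \<inter> space M \<in> sigma_sets (space M) (\<Union>i\<in>J False. E i)"
  proof (rule sigma_sets.Basic)
    have "d j (Suc t) -` C \<inter> space M \<in> E (Inl (j, Suc t))"
      unfolding E_def sum.case prod.case using measurable_sets[OF gen_sigma_measurable C, of "d j (Suc t)" "{d j (Suc t)}" M] by simp
    then show "d j (Suc t) -` C \<inter> space M \<in> (\<Union>i\<in>J False. E i)" by (auto simp: J_def)
  qed
  have "prob (\<Inter>x\<in>UNIV. (if x then S else d j (Suc t) -` C \<inter> space M)) = (\<Prod>x\<in>UNIV. prob (if x then S else d j (Suc t) -` C \<inter> space M))"
    by (rule indep_setsD[OF ind]) (use 1 2 in auto)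
  then show ?thesis by (simp add: UNIV_bool Int_commute mult.commute)
qed

lemma eps_dominated:
  assumes aij: "a i j > 0" and h: "h \<in> borel_measurable (Gf t)"
    and h_le: "\<And>\<omega>. \<omega> \<in> space M \<Longrightarrow> \<bar>h \<omega>\<bar> \<le> 1 / 2"
  shows "exp_dominated (Gf t) (\<lambda>\<omega>. h \<omega> * eps \<omega> i j (Suc t))
     (\<lambda>\<omega>. (h \<omega>)\<^sup>2 * lap_send (sc_thr \<nu> b j i (Suc t)) (b j i) (xs \<omega> (Suc t) j))"
proof -
  have aji: "a j i > 0" using aij a_sym by simp
  show ?thesis unfolding eps_def
    by (rule exp_dominated_one_bit[OF Gf_sub d_indep_Gf d_lap b_pos[OF aji] thr_nonneg[OF aji] xs_meas h h_le]) auto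
qed

end

section \<open>Almost sure bounds for the noise\<close>

lemma eventually_bounded_imp_bounded:
  fixes f :: "nat \<Rightarrow> real"
  assumes "\<And>k. k \<ge> k0 \<Longrightarrow> f k \<le> C"
  shows "\<exists>R. \<forall>k. f k \<le> R"
proof (rule exI[of _ "Max (insert C (f ` {..<k0}))"], rule allI)
  fix k
  show "f k \<le> Max (insert C (f ` {..<k0}))"
  proof (cases "k < k0")
    case True
    then show ?thesis by (intro Max_ge) auto
  next
    case False
    then have "f k \<le> C" using assms by simp
    also have "C \<le> Max (insert C (f ` {..<k0}))" by (intro Max_ge) auto
    finally show ?thesis .
  qed
qed

text \<open>Telescoping. \<open>D\<close> stands for an accumulated martingale part, for which
  Ville's inequality supplies an upper bound only.\<close>

lemma bounded_above_of_increments: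
  fixes L s D :: "nat \<Rightarrow> real"
  assumes step: "\<And>t. t \<ge> t1 \<Longrightarrow> L (Suc t) \<le> L t + s t + (D (Suc t) - D t)"
    and s: "summable s" "\<And>t. 0 \<le> s t" and D: "\<And>t. D t \<le> C"
  shows "\<exists>R. \<forall>t. L t \<le> R"
proof -
  have 1: "L t - D t \<le> L t1 - D t1 + sum s {t1..<t}" if "t \<ge> t1" for t
    using that by (induction rule: dec_induct) (use step in \<open>force simp: algebra_simps\<close>)+
  have 2: "sum s {t1..<t} \<le> suminf s" for t
    by (rule sum_le_suminf) (use s in auto)
  have "L t \<le> L t1 - D t1 + suminf s + C" if "t \<ge> t1" for t
    using 1[OF that] 2[of t] D[of t] by linarith
  then show ?thesis by (rule eventually_bounded_imp_bounded)
qed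

context sc_network
begin

lemma wfilt_sub: "subalgebra M (wfilt M m w t)"
  unfolding wfilt_def by (rule subalgebra_gen_sigma) (auto intro: w_meas)

lemma wdfilt_sub: "subalgebra M (wdfilt M m w d t)"
  unfolding wdfilt_def by (rule subalgebra_gen_sigma) (auto intro: w_meas d_borel)

lemma wfilt_mono: "sets (wfilt M m w t) \<subseteq> sets (wfilt M m w (Suc t))"
  unfolding wfilt_def by (rule gen_sigma_mono) (blast intro: le_SucI)

lemma w_wfilt: "r < m i \<Longrightarrow> (\<lambda>\<omega>. w i (Suc t) \<omega> r) \<in> borel_measurable (wfilt M m w (Suc t))"
  unfolding wfilt_def by (rule gen_sigma_measurable) force

text \<open>The moment assumption conditions on the observation noise alone, the martingale property
  on the larger filtration with dithers. Weights measurable for the smaller one are measurable for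
  the larger one, so both assumptions can be combined over \<open>wfilt\<close>.\<close>

lemma w_mean_zero:
  assumes Y: "Y \<in> borel_measurable (wfilt M m w t)" and B: "\<And>\<omega>. \<omega> \<in> space M \<Longrightarrow> 0 \<le> Y \<omega> \<and> Y \<omega> \<le> C"
    and r: "r < m i"
  shows "integrable M (\<lambda>\<omega>. Y \<omega> * w i (Suc t) \<omega> r)" "(\<integral>\<omega>. Y \<omega> * w i (Suc t) \<omega> r \<partial>M) = 0"
proof -
  interpret S: finite_measure_subalgebra M "wdfilt M m w d t" by standard (rule wdfilt_sub)
  have "subalgebra (wdfilt M m w d t) (wfilt M m w t)"
    unfolding subalgebra_def wdfilt_def wfilt_def space_gen_sigma by (intro conjI refl gen_sigma_mono) blast
  then have Y': "Y \<in> borel_measurable (wdfilt M m w d t)" using Y measurable_from_subalg by blast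
  then have [measurable]: "Y \<in> borel_measurable M" using wdfilt_sub measurable_from_subalg by blast
  note [measurable] = w_meas
  show int: "integrable M (\<lambda>\<omega>. Y \<omega> * w i (Suc t) \<omega> r)"
  proof (rule Bochner_Integration.integrable_bound)
    show "integrable M (\<lambda>\<omega>. C * w i (Suc t) \<omega> r)" using w_int[of "Suc t" r i] r by simp
    show "AE \<omega> in M. norm (Y \<omega> * w i (Suc t) \<omega> r) \<le> norm (C * w i (Suc t) \<omega> r)"
      by (rule AE_I2) (use B in \<open>fastforce simp: abs_mult intro!: mult_right_mono\<close>)
  qed measurable
  have "(\<integral>\<omega>. Y \<omega> * w i (Suc t) \<omega> r \<partial>M) = (\<integral>\<omega>. Y \<omega> * real_cond_exp M (wdfilt M m w d t) (\<lambda>\<omega>. w i (Suc t) \<omega> r) \<omega> \<partial>M)"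
    by (rule S.real_cond_exp_intg(2)[symmetric, OF int Y']) measurable
  also have "\<dots> = (\<integral>\<omega>. 0 \<partial>M)"
    by (rule integral_cong_AE) (use w_mds[of "Suc t" r i] r in \<open>auto elim: eventually_mono\<close>)
  finally show "(\<integral>\<omega>. Y \<omega> * w i (Suc t) \<omega> r \<partial>M) = 0" by simp
qed

text \<open>Division by \<open>Hb\<close> makes each increment at most the norm of the noise, by
  Cauchy-Schwarz, so the moment assumption applies with that norm as \<eta>. The two signs of
  \<open>sg\<close> together give a bound on absolute values.\<close>

lemma AE_w_sum_le:
  assumes c: "c < n" and sg: "\<bar>sg\<bar> = (1::real)"
  shows "AE \<omega> in M. \<exists>C. \<forall>\<^sub>F k in sequentially.
    (\<Sum>t\<in>{1..k}. sg / Hb * (\<Sum>r<m i. H i t r c * w i t \<omega> r)) \<le> C * sqrt (real k * ln (real k))"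
proof (rule AE_mds_sum_le[where \<G> = "wfilt M m w" and \<eta> = "\<lambda>t \<omega>. vnorm (m i) (w i t \<omega>)", OF wfilt_sub wfilt_mono _ _ _ _ _ \<rho>])
  show "(\<lambda>\<omega>. sg / Hb * (\<Sum>r<m i. H i (Suc t) r c * w i (Suc t) \<omega> r)) \<in> borel_measurable (wfilt M m w (Suc t))" for t
    by (intro borel_measurable_times borel_measurable_sum borel_measurable_const w_wfilt) auto
  show "(\<lambda>\<omega>. vnorm (m i) (w i (Suc t) \<omega>)) \<in> borel_measurable (wfilt M m w (Suc t))" for t
  proof -
    have [measurable]: "(\<lambda>\<omega>. \<Sum>c<m i. (w i (Suc t) \<omega> c)\<^sup>2) \<in> borel_measurable (wfilt M m w (Suc t))"
      by (intro borel_measurable_sum borel_measurable_power w_wfilt) auto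
    show ?thesis unfolding vnorm_def by measurable
  qed
  show "\<bar>sg / Hb * (\<Sum>r<m i. H i (Suc t) r c * w i (Suc t) \<omega> r)\<bar> \<le> vnorm (m i) (w i (Suc t) \<omega>)" for t \<omega>
  proof -
    define v where "v = (\<Sum>r<m i. H i (Suc t) r c * w i (Suc t) \<omega> r)"
    have "v\<^sup>2 \<le> (\<Sum>r<m i. (H i (Suc t) r c)\<^sup>2) * (\<Sum>r<m i. (w i (Suc t) \<omega> r)\<^sup>2)"
      unfolding v_def by (rule Cauchy_Schwarz_ineq_sum)
    also have "\<dots> \<le> Hb\<^sup>2 * (\<Sum>r<m i. (w i (Suc t) \<omega> r)\<^sup>2)"
    proof (rule mult_right_mono)
      have "(\<Sum>r<m i. (H i (Suc t) r c)\<^sup>2) \<le> (\<Sum>r<m i. \<Sum>c<n. (H i (Suc t) r c)\<^sup>2)"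
        by (intro sum_mono member_le_sum[where f = "\<lambda>c. (H i (Suc t) _ c)\<^sup>2"]) (use c in auto)
      also have "\<dots> = (mnorm (m i) n (H i (Suc t)))\<^sup>2" by (simp add: mnorm_def sum_nonneg)
      also have "\<dots> \<le> Hb\<^sup>2" by (intro power_mono H_le) (auto simp: mnorm_def sum_nonneg)
      finally show "(\<Sum>r<m i. (H i (Suc t) r c)\<^sup>2) \<le> Hb\<^sup>2" .
    qed (simp add: sum_nonneg)
    also have "\<dots> = (Hb * vnorm (m i) (w i (Suc t) \<omega>))\<^sup>2" by (simp add: vnorm_def power_mult_distrib sum_nonneg)
    finally have "\<bar>v\<bar> \<le> Hb * vnorm (m i) (w i (Suc t) \<omega>)"
      by (intro power2_le_imp_le[of "\<bar>v\<bar>"]) (use Hb_pos in \<open>auto simp: vnorm_def sum_nonneg\<close>)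
    then show ?thesis unfolding v_def[symmetric] using Hb_pos sg by (simp add: abs_mult field_simps)
  qed
  show "integrable M (\<lambda>\<omega>. sg / Hb * (\<Sum>r<m i. H i (Suc t) r c * w i (Suc t) \<omega> r))" for t
    by (intro integrable_mult_right Bochner_Integration.integrable_sum w_int) auto
  show "(\<integral>\<omega>. Y \<omega> * (sg / Hb * (\<Sum>r<m i. H i (Suc t) r c * w i (Suc t) \<omega> r)) \<partial>M) = 0"
    if Y: "Y \<in> borel_measurable (wfilt M m w t)" and Bd: "\<And>\<omega>. \<omega> \<in> space M \<Longrightarrow> 0 \<le> Y \<omega> \<and> Y \<omega> \<le> Bd" for t Y Bd
  proof -
    note wm = w_mean_zero[OF Y Bd]
    have "(\<integral>\<omega>. Y \<omega> * (sg / Hb * (\<Sum>r<m i. H i (Suc t) r c * w i (Suc t) \<omega> r)) \<partial>M)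
      = (\<integral>\<omega>. (\<Sum>r<m i. (sg / Hb * H i (Suc t) r c) * (Y \<omega> * w i (Suc t) \<omega> r)) \<partial>M)"
      by (simp add: sum_distrib_left mult_ac)
    also have "\<dots> = (\<Sum>r<m i. \<integral>\<omega>. (sg / Hb * H i (Suc t) r c) * (Y \<omega> * w i (Suc t) \<omega> r) \<partial>M)"
      by (rule Bochner_Integration.integral_sum) (auto intro!: integrable_mult_right wm(1))
    also have "\<dots> = 0" by (intro sum.neutral ballI) (simp add: wm(2))
    finally show ?thesis .
  qed
  show "AE \<omega> in M. \<exists>L::real. \<forall>t. nn_cond_exp M (wfilt M m w t) (\<lambda>\<omega>. ennreal (vnorm (m i) (w i (Suc t) \<omega>) powr \<rho>)) \<omega> \<le> ennreal L"
    using w_moment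
  proof eventually_elim
    case (elim \<omega>)
    define s where "s = (SUP ik \<in> UNIV \<times> {1..}. nn_cond_exp M (wfilt M m w (snd ik - 1))
       (\<lambda>\<omega>. ennreal (vnorm (m (fst ik)) (w (fst ik) (snd ik) \<omega>) powr \<rho>)) \<omega>)"
    have "nn_cond_exp M (wfilt M m w t) (\<lambda>\<omega>. ennreal (vnorm (m i) (w i (Suc t) \<omega>) powr \<rho>)) \<omega> \<le> s" for t
      unfolding s_def by (rule SUP_upper2[of "(i, Suc t)"]) auto
    moreover have "s = ennreal (enn2real s)" using elim unfolding s_def[symmetric] by simp
    ultimately show ?case by metis
  qed
qed

text \<open>The weight t in \<open>avg\<close> cancels the step size B / t, so the averaged
  observation noise is a plain mean of martingale differences.\<close>

lemma AE_avg_nw: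
  "AE \<omega> in M. \<exists>C\<ge>0. \<forall>\<^sub>F k in sequentially. \<forall>p\<in>I. \<bar>avg (nw \<omega>) k p\<bar> \<le> C * sqrt (ln (real k) / real k)"
proof -
  have one: "AE \<omega> in M. \<exists>C. \<forall>\<^sub>F k in sequentially. \<bar>avg (nw \<omega>) k p\<bar> \<le> C * sqrt (ln (real k) / real k)" if p: "p \<in> I" for p
  proof -
    obtain i c where ic: "p = (i, c)" "c < n" using p by auto
    show ?thesis
      using AE_w_sum_le[OF ic(2) abs_one, of i] AE_w_sum_le[OF ic(2) abs_neg_one, of i]
    proof eventually_elim
      case (elim \<omega>)
      define S where "S k = (\<Sum>t\<in>{1..k}. 1 / Hb * (\<Sum>r<m i. H i t r c * w i t \<omega> r))" for k
      obtain C1 where C1: "\<forall>\<^sub>F k in sequentially. S k \<le> C1 * sqrt (real k * ln (real k))" using elim(1) unfolding S_def by blast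
      have "(\<Sum>t\<in>{1..k}. - 1 / Hb * (\<Sum>r<m i. H i t r c * w i t \<omega> r)) = - S k" for k
        unfolding S_def sum_negf[symmetric] by (intro sum.cong) auto
      then obtain C2 where C2: "\<forall>\<^sub>F k in sequentially. - S k \<le> C2 * sqrt (real k * ln (real k))" using elim(2) by auto
      have "\<forall>\<^sub>F k in sequentially. \<bar>avg (nw \<omega>) k p\<bar> \<le> (B * Hb * max C1 C2) * sqrt (ln (real k) / real k)"
        using C1 C2 eventually_gt_at_top[of 1]
      proof eventually_elim
        case (elim k)
        define q where "q = sqrt (real k * ln (real k))"
        have q0: "q \<ge> 0" using elim by (simp add: q_def)
        have "avg (nw \<omega>) k p = B * Hb * S k / real k"
        proof -
          have "(\<Sum>t\<in>{1..k}. real t * nw \<omega> t p) = (\<Sum>t\<in>{1..k}. B * Hb * (1 / Hb * (\<Sum>r<m i. H i t r c * w i t \<omega> r)))"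
            by (rule sum.cong) (use Hb_pos in \<open>auto simp: nw_def ic\<close>)
          then show ?thesis unfolding avg_def S_def by (simp add: sum_distrib_left)
        qed
        then have "\<bar>avg (nw \<omega>) k p\<bar> = B * Hb * \<bar>S k\<bar> / real k" using B_pos Hb_pos by (simp add: abs_mult)
        also have "\<bar>S k\<bar> \<le> max C1 C2 * q"
          using elim mult_right_mono[OF max.cobounded1[of C1 C2] q0] mult_right_mono[OF max.cobounded2[of C2 C1] q0]
          unfolding q_def[symmetric] by linarith
        also have "B * Hb * (max C1 C2 * q) / real k = (B * Hb * max C1 C2) * (q / real k)" by simp
        also have "q / real k = sqrt (ln (real k) / real k)"
        proof -
          have "q / real k = sqrt (real k * ln (real k)) / sqrt ((real k)\<^sup>2)" by (simp add: q_def)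
          also have "\<dots> = sqrt (ln (real k) / real k)" unfolding real_sqrt_divide[symmetric] using elim by (simp add: power2_eq_square)
          finally show ?thesis .
        qed
        finally show ?case using B_pos Hb_pos by (simp add: divide_right_mono mult_left_mono)
      qed
      then show ?case by blast
    qed
  qed
  have "AE \<omega> in M. \<forall>p\<in>I. \<exists>C. \<forall>\<^sub>F k in sequentially. \<bar>avg (nw \<omega>) k p\<bar> \<le> C * sqrt (ln (real k) / real k)"
    by (rule AE_finite_allI[OF _ one]) auto
  then show ?thesis
  proof eventually_elim
    case (elim \<omega>)
    then obtain C where C: "\<And>p. p \<in> I \<Longrightarrow> \<forall>\<^sub>F k in sequentially. \<bar>avg (nw \<omega>) k p\<bar> \<le> C p * sqrt (ln (real k) / real k)" by metis
    have "\<forall>\<^sub>F k in sequentially. \<forall>p\<in>I. \<bar>avg (nw \<omega>) k p\<bar> \<le> C p * sqrt (ln (real k) / real k)"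
      by (rule eventually_ball_finite) (use C in auto)
    then have "\<forall>\<^sub>F k in sequentially. \<forall>p\<in>I. \<bar>avg (nw \<omega>) k p\<bar> \<le> (\<Sum>p\<in>I. \<bar>C p\<bar>) * sqrt (ln (real k) / real k)"
      using eventually_gt_at_top[of 1]
    proof eventually_elim
      case (elim k)
      have "C p \<le> (\<Sum>p\<in>I. \<bar>C p\<bar>)" if "p \<in> I" for p
      proof -
        have "\<bar>C p\<bar> \<le> (\<Sum>p\<in>I. \<bar>C p\<bar>)"
          by (rule member_le_sum[where f = "\<lambda>p. \<bar>C p\<bar>"]) (use that in \<open>simp_all add: finite_cartesian_product\<close>)
        then show ?thesis by linarith
      qed
      moreover have "0 \<le> sqrt (ln (real k) / real k)" using elim(2) by simp
      ultimately have "C p * sqrt (ln (real k) / real k) \<le> (\<Sum>p\<in>I. \<bar>C p\<bar>) * sqrt (ln (real k) / real k)" if "p \<in> I" for p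
        using that by (intro mult_right_mono) auto
      then show ?case using elim(1) order.trans by blast
    qed
    then show ?case by (intro exI[of _ "\<Sum>p\<in>I. \<bar>C p\<bar>"]) (auto intro: sum_nonneg)
  qed
qed

section \<open>Dither sums: predictable variance and predictable weights\<close>

abbreviation send :: "'a \<Rightarrow> 'v \<Rightarrow> 'v \<Rightarrow> nat \<Rightarrow> real" where
  "send \<omega> i j k \<equiv> lap_send (sc_thr \<nu> b j i k) (b j i) (xs \<omega> k j)"

lemma abs_eps_le_2: "\<bar>eps \<omega> i j k\<bar> \<le> 2"
  using abs_one_bit_le_1[of "sc_thr \<nu> b j i k" "b j i" "xs \<omega> k j" "d j k \<omega>"]
    abs_lap_trans_le_1[of "sc_thr \<nu> b j i k" "b j i" "xs \<omega> k j"]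
  unfolding eps_def by linarith

lemma send_le_2: "send \<omega> i j k \<le> 2"
  unfolding lap_send_def
  using lap_cdf_le_1[of "(xs \<omega> k j - sc_thr \<nu> b j i k) / b j i"] lap_cdf_le_1[of "(- xs \<omega> k j - sc_thr \<nu> b j i k) / b j i"]
  by linarith

lemma eps_meas: "(\<lambda>\<omega>. eps \<omega> i j (Suc t)) \<in> borel_measurable (Gf (Suc t))"
  by (rule eps_meas_of_xs[OF xs_meas])

lemma send_meas: "(\<lambda>\<omega>. send \<omega> i j (Suc t)) \<in> borel_measurable (Gf t)"
  using xs_meas[of t j] by measurable

abbreviation dsum_le :: "'a \<Rightarrow> 'v \<Rightarrow> 'v \<Rightarrow> nat \<Rightarrow> real \<Rightarrow> nat \<Rightarrow> bool" where
  "dsum_le \<omega> i j c sg k \<equiv> sg * dsum \<omega> i j c k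
     \<le> sqrt (ln (real k) / real k powr (1 + \<nu> i j)) * (\<Sum>t\<in>{1..k}. (real t powr \<nu> i j)\<^sup>2 * send \<omega> i j t)
       + 2 * ln (real k) / sqrt (ln (real k) / real k powr (1 + \<nu> i j))"

text \<open>The predictable variance is left unevaluated, since it is known to be small only along
  bounded paths. The multiplier is tuned to the order \<open>k powr (1 + \<nu> i j)\<close> that the
  variance has there, which balances the two terms.\<close>

lemma AE_eps_sum_le:
  assumes aij: "a i j > 0" and sg: "\<bar>sg\<bar> = (1::real)"
  defines "lam \<equiv> \<lambda>k. sqrt (ln (real k) / real k powr (1 + \<nu> i j))"
  shows "AE \<omega> in M. \<forall>\<^sub>F k in sequentially.
     sg * dsum \<omega> i j c k
     \<le> lam k * (\<Sum>t\<in>{1..k}. (real t powr \<nu> i j)\<^sup>2 * send \<omega> i j t) + 2 * ln (real k) / lam k"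
proof -
  define v where "v = \<nu> i j"
  have v: "0 \<le> v" "v < 1 / 2" using \<nu>_nonneg[OF aij] \<nu>_le[OF aij] \<nu>b by (auto simp: v_def)
  define g where "g t = (if sc_coord n t = c then real t powr v else 0)" for t
  have g: "0 \<le> g t" "g t \<le> real t powr v" for t by (auto simp: g_def)
  define D where "D k \<omega> = (\<Sum>t\<in>{1..k}. (sg * lam k * g t) * eps \<omega> i j t - (sg * lam k * g t)\<^sup>2 * send \<omega> i j t)" for k \<omega>
  \<comment> \<open>The exponential bound requires multipliers of size at most 1 / 2. The product
    behaves like \<open>k powr ((v - 1) / 2)\<close> up to a logarithm.\<close>
  have "(\<lambda>k. lam k * real k powr v) \<longlonglongrightarrow> 0"
  proof (rule Lim_transform_eventually)
    have "(v - 1) / 2 < 0" using v by simp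
    then show "(\<lambda>k. sqrt (ln (real k)) * real k powr ((v - 1) / 2)) \<longlonglongrightarrow> 0" by real_asymp
    show "\<forall>\<^sub>F k in sequentially. sqrt (ln (real k)) * real k powr ((v - 1) / 2) = lam k * real k powr v"
      using eventually_gt_at_top[of 0]
    proof eventually_elim
      case (elim k)
      have "sqrt (real k powr (1 + v)) = real k powr ((1 + v) / 2)"
        using elim by (simp add: powr_half_sqrt[symmetric] powr_powr)
      then have "lam k * real k powr v = sqrt (ln (real k)) * (real k powr v / real k powr ((1 + v) / 2))"
        unfolding lam_def v_def[symmetric] by (simp add: real_sqrt_divide)
      also have "real k powr v / real k powr ((1 + v) / 2) = real k powr ((v - 1) / 2)"
        unfolding powr_diff[symmetric] by (simp add: field_simps)
      finally show ?case by simp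
    qed
  qed
  then have "\<forall>\<^sub>F k in sequentially. lam k * real k powr v < 1 / 2" by (rule order_tendstoD) simp
  then have ev: "\<forall>\<^sub>F k in sequentially. (\<integral>\<^sup>+\<omega>. ennreal (exp (D k \<omega>)) \<partial>M) \<le> 1"
    using eventually_gt_at_top[of 1]
  proof eventually_elim
    case (elim k)
    have lam0: "lam k > 0" using elim by (simp add: lam_def)
    have hle: "\<bar>sg * lam k * g (Suc t)\<bar> \<le> lam k * real (Suc t) powr v" for t
      using sg lam0 g[of "Suc t"] by (simp add: abs_mult)
    show ?case unfolding D_def
    proof (rule exp_supermartingale[where \<G> = Gf and c = "\<lambda>t. lam k * real t powr v * 2", OF Gf_sub Gf_mono])
      show "(\<lambda>\<omega>. sg * lam k * g (Suc t) * eps \<omega> i j (Suc t)) \<in> borel_measurable (Gf (Suc t))" for t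
        using eps_meas[of i j t] by measurable
      show "(\<lambda>\<omega>. (sg * lam k * g (Suc t))\<^sup>2 * send \<omega> i j (Suc t)) \<in> borel_measurable (Gf t)" for t
        using send_meas[where i = i and j = j and t = t] by (rule borel_measurable_times[OF borel_measurable_const])
      show "0 \<le> (sg * lam k * g (Suc t))\<^sup>2 * send \<omega> i j (Suc t)" for t \<omega> by (simp add: lap_send_nonneg)
      show "sg * lam k * g (Suc t) * eps \<omega> i j (Suc t) \<le> lam k * real (Suc t) powr v * 2" for t \<omega>
      proof -
        have "sg * lam k * g (Suc t) * eps \<omega> i j (Suc t) \<le> \<bar>sg * lam k * g (Suc t)\<bar> * \<bar>eps \<omega> i j (Suc t)\<bar>"
          by (metis abs_ge_self abs_mult)
        also have "\<dots> \<le> lam k * real (Suc t) powr v * 2"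
          using lam0 by (intro mult_mono hle abs_eps_le_2) auto
        finally show ?thesis .
      qed
      show "exp_dominated (Gf t) (\<lambda>\<omega>. sg * lam k * g (Suc t) * eps \<omega> i j (Suc t)) (\<lambda>\<omega>. (sg * lam k * g (Suc t))\<^sup>2 * send \<omega> i j (Suc t))"
        if "t < k" for t
      proof (rule eps_dominated[OF aij])
        have "lam k * real (Suc t) powr v \<le> lam k * real k powr v"
          using that lam0 v by (intro mult_left_mono powr_mono2) auto
        then show "\<bar>sg * lam k * g (Suc t)\<bar> \<le> 1 / 2" using hle[of t] elim by linarith
      qed simp
    qed
  qed
  have D_meas: "D k \<in> borel_measurable M" for k
    unfolding D_def
  proof (rule borel_measurable_sum)
    fix t assume "t \<in> {1..k}"
    then obtain s where s: "t = Suc s" by (cases t) auto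
    have [measurable]: "(\<lambda>\<omega>. eps \<omega> i j t) \<in> borel_measurable M" "(\<lambda>\<omega>. send \<omega> i j t) \<in> borel_measurable M"
      unfolding s using eps_meas[of i j s] send_meas[where i = i and j = j and t = s] Gf_sub measurable_from_subalg by blast+
    show "(\<lambda>\<omega>. (sg * lam k * g t) * eps \<omega> i j t - (sg * lam k * g t)\<^sup>2 * send \<omega> i j t) \<in> borel_measurable M" by measurable
  qed
  have "AE \<omega> in M. \<forall>\<^sub>F k in sequentially. D k \<omega> \<le> 2 * ln (real k)"
    by (rule AE_eventually_le_ln[OF D_meas ev])
  then show ?thesis
  proof eventually_elim
    case (elim \<omega>)
    then show ?case using eventually_gt_at_top[of 1]
    proof eventually_elim
      case (elim k)
      have lam0: "lam k > 0" using elim by (simp add: lam_def)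
      have sg2: "sg\<^sup>2 = 1" using sg by (metis power2_abs one_power2)
      have "lam k * (sg * (\<Sum>t\<in>{1..k}. g t * eps \<omega> i j t)) = D k \<omega> + (\<Sum>t\<in>{1..k}. (sg * lam k * g t)\<^sup>2 * send \<omega> i j t)"
        unfolding D_def by (simp add: sum_subtractf sum_distrib_left mult_ac)
      also have "\<dots> \<le> 2 * ln (real k) + (\<Sum>t\<in>{1..k}. (lam k)\<^sup>2 * ((real t powr v)\<^sup>2 * send \<omega> i j t))"
      proof (rule add_mono[OF elim(1) sum_mono])
        fix t
        have "(sg * lam k * g t)\<^sup>2 * send \<omega> i j t = (lam k)\<^sup>2 * ((g t)\<^sup>2 * send \<omega> i j t)" by (simp add: power_mult_distrib sg2)
        also have "\<dots> \<le> (lam k)\<^sup>2 * ((real t powr v)\<^sup>2 * send \<omega> i j t)"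
          using g[of t] by (intro mult_left_mono mult_right_mono power_mono) (auto simp: lap_send_nonneg)
        finally show "(sg * lam k * g t)\<^sup>2 * send \<omega> i j t \<le> (lam k)\<^sup>2 * ((real t powr v)\<^sup>2 * send \<omega> i j t)" .
      qed
      also have "\<dots> = lam k * (lam k * (\<Sum>t\<in>{1..k}. (real t powr v)\<^sup>2 * send \<omega> i j t) + 2 * ln (real k) / lam k)"
        using lam0 by (simp add: sum_distrib_left[symmetric] power2_eq_square algebra_simps)
      finally have "sg * (\<Sum>t\<in>{1..k}. g t * eps \<omega> i j t) \<le> lam k * (\<Sum>t\<in>{1..k}. (real t powr v)\<^sup>2 * send \<omega> i j t) + 2 * ln (real k) / lam k"
        using lam0 by simp
      then show ?case unfolding g_def v_def .
    qed
  qed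
qed

lemma summable_powr_nat: "e < - 1 \<Longrightarrow> summable (\<lambda>t. C * real t powr e)"
  by (intro summable_mult) (simp add: summable_real_powr_iff)

text \<open>The squared step sizes are summable because 2 \<nu> - 2 < -1, so the compensator is
  bounded even with the trivial bound 2 for \<open>send\<close>. Thus nothing about the size of the
  path enters, and the result can be used to prove boundedness.\<close>

lemma AE_predictable_sum_bounded:
  assumes aij: "a i j > 0" and h: "\<And>t. h (Suc t) \<in> borel_measurable (Gf t)"
    and h_le: "\<And>t \<omega>. \<bar>h t \<omega>\<bar> \<le> (1::real)"
  shows "AE \<omega> in M. \<exists>C. \<forall>k. (\<Sum>t\<in>{1..k}. h t \<omega> * (dn \<omega> i j t)) \<le> C"
proof -
  define v where "v = \<nu> i j"
  have v: "0 \<le> v" "v < 1 / 2" using \<nu>_nonneg[OF aij] \<nu>_le[OF aij] \<nu>b by (auto simp: v_def)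
  \<comment> \<open>Halved to keep the multiplier of \<open>eps\<close> within 1 / 2; the factor 2
    returns in the final bound.\<close>
  define g where "g t \<omega> = h t \<omega> * real t powr (v - 1) / 2" for t \<omega>
  have pw: "real (Suc t) powr (v - 1) \<le> 1" for t using v powr_mono[of "v - 1" 0 "real (Suc t)"] by simp
  have g_le': "\<bar>g t \<omega>\<bar> \<le> real t powr (v - 1) / 2" for t \<omega>
    unfolding g_def using h_le[of t \<omega>] by (simp add: abs_mult mult_left_le_one_le)
  have g_le: "\<bar>g (Suc t) \<omega>\<bar> \<le> 1 / 2" for t \<omega> using g_le'[of "Suc t" \<omega>] pw[of t] by linarith
  have "AE \<omega> in M. \<exists>C. \<forall>k. (\<Sum>t\<in>{1..k}. g t \<omega> * eps \<omega> i j t - (g t \<omega>)\<^sup>2 * send \<omega> i j t) \<le> C"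
  proof (rule AE_bounded_above_of_exp_dominated[where \<G> = Gf and c = "\<lambda>t. 1", OF Gf_sub Gf_mono])
    have gm: "g (Suc t) \<in> borel_measurable (Gf t)" for t unfolding g_def using h[of t] by measurable
    show "(\<lambda>\<omega>. g (Suc t) \<omega> * eps \<omega> i j (Suc t)) \<in> borel_measurable (Gf (Suc t))" for t
    proof -
      have "g (Suc t) \<in> borel_measurable (Gf (Suc t))" by (rule Gf_lift[OF _ gm]) simp
      then show ?thesis using eps_meas[of i j t] by (rule borel_measurable_times)
    qed
    show "(\<lambda>\<omega>. (g (Suc t) \<omega>)\<^sup>2 * send \<omega> i j (Suc t)) \<in> borel_measurable (Gf t)" for t
      by (intro borel_measurable_times borel_measurable_power gm send_meas)
    show "0 \<le> (g (Suc t) \<omega>)\<^sup>2 * send \<omega> i j (Suc t)" for t \<omega> by (simp add: lap_send_nonneg)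
    show "g (Suc t) \<omega> * eps \<omega> i j (Suc t) \<le> 1" for t \<omega>
    proof -
      have "g (Suc t) \<omega> * eps \<omega> i j (Suc t) \<le> \<bar>g (Suc t) \<omega>\<bar> * \<bar>eps \<omega> i j (Suc t)\<bar>" by (metis abs_ge_self abs_mult)
      also have "\<dots> \<le> 1 / 2 * 2" by (intro mult_mono g_le abs_eps_le_2) auto
      finally show ?thesis by simp
    qed
    show "exp_dominated (Gf t) (\<lambda>\<omega>. g (Suc t) \<omega> * eps \<omega> i j (Suc t)) (\<lambda>\<omega>. (g (Suc t) \<omega>)\<^sup>2 * send \<omega> i j (Suc t))" for t
      by (rule eps_dominated[OF aij gm g_le])
  qed simp
  then show ?thesis
  proof eventually_elim
    case (elim \<omega>)
    then obtain C where C: "\<And>k. (\<Sum>t\<in>{1..k}. g t \<omega> * eps \<omega> i j t - (g t \<omega>)\<^sup>2 * send \<omega> i j t) \<le> C" by blast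
    define s where "s = (\<lambda>t. (1 / 2) * real t powr (2 * v - 2))"
    have sm: "summable s" unfolding s_def using v by (intro summable_powr_nat) auto
    have "(\<Sum>t\<in>{1..k}. g t \<omega> * eps \<omega> i j t) \<le> C + suminf s" for k
    proof -
      have "(\<Sum>t\<in>{1..k}. (g t \<omega>)\<^sup>2 * send \<omega> i j t) \<le> (\<Sum>t\<in>{1..k}. s t)"
      proof (rule sum_mono)
        fix t
        have "(g t \<omega>)\<^sup>2 \<le> (real t powr (v - 1) / 2)\<^sup>2" using power_mono[OF g_le'[of t \<omega>], of 2] by simp
        then have "(g t \<omega>)\<^sup>2 * send \<omega> i j t \<le> (real t powr (v - 1) / 2)\<^sup>2 * 2"
          by (intro mult_mono send_le_2) (auto simp: lap_send_nonneg)
        also have "\<dots> = s t"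
          by (simp add: s_def power_divide power2_eq_square powr_add[symmetric])
        finally show "(g t \<omega>)\<^sup>2 * send \<omega> i j t \<le> s t" .
      qed
      also have "\<dots> \<le> suminf s" by (rule sum_le_suminf[OF sm]) (auto simp: s_def)
      finally show ?thesis using C[of k] by (simp add: sum_subtractf)
    qed
    moreover have "(\<Sum>t\<in>{1..k}. h t \<omega> * (dn \<omega> i j t))
       = 2 * A * a i j * (\<Sum>t\<in>{1..k}. g t \<omega> * eps \<omega> i j t)" for k
      unfolding sum_distrib_left g_def v_def by (intro sum.cong) auto
    ultimately have "(\<Sum>t\<in>{1..k}. h t \<omega> * (dn \<omega> i j t)) \<le> 2 * A * a i j * (C + suminf s)" for k
      using A_pos aij by (simp add: mult_left_mono)
    then show ?case by blast
  qed
qed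

end

section \<open>Boundedness of the estimates\<close>

text \<open>The logarithm normalises the martingale term: its coefficient g / (1 + |g|^2) is bounded
  whatever the size of the error. What remains is |e|^2, the Young term of
  \<open>perturbed_descent\<close>, and the drift \<delta> U. For the latter two, the energy is
  compared with products, so that the logarithm splits into summands.\<close>

lemma log_energy_step:
  fixes \<zeta> U v e :: "'i \<Rightarrow> real"
  assumes desc: "(\<Sum>p\<in>I. (v p)\<^sup>2) \<le> \<kappa> * (\<Sum>p\<in>I. (\<zeta> p + U p) * v p)" and \<kappa>: "0 < \<kappa>" "\<kappa> \<le> 1" and \<delta>: "\<delta> \<ge> 0"
    and g: "\<And>p. g p = \<zeta> p - v p + \<delta> * U p"
  shows "ln (1 + (\<Sum>p\<in>I. (g p + e p)\<^sup>2)) \<le> ln (1 + (\<Sum>p\<in>I. (\<zeta> p)\<^sup>2))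
    + (\<kappa> * (\<Sum>p\<in>I. (U p)\<^sup>2) + 2 * (\<delta> * L2_set U I) + (\<Sum>p\<in>I. (e p)\<^sup>2))
    + 2 * (\<Sum>p\<in>I. g p * e p) / (1 + (\<Sum>p\<in>I. (g p)\<^sup>2))"
proof -
  define G where "G = (\<Sum>p\<in>I. (g p)\<^sup>2)"
  define V where "V = (\<Sum>p\<in>I. (\<zeta> p)\<^sup>2)"
  define E where "E = (\<Sum>p\<in>I. (e p)\<^sup>2)"
  define W where "W = (\<Sum>p\<in>I. (U p)\<^sup>2)"
  define X where "X = (\<Sum>p\<in>I. (\<zeta> p - v p)\<^sup>2)"
  define u where "u = \<delta> * L2_set U I"
  have nn: "G \<ge> 0" "V \<ge> 0" "E \<ge> 0" "W \<ge> 0" "X \<ge> 0" "u \<ge> 0"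
    unfolding G_def V_def E_def W_def X_def u_def using \<delta> by (auto intro!: sum_nonneg mult_nonneg_nonneg)
  have expand: "(\<Sum>p\<in>I. (g p + e p)\<^sup>2) = G + 2 * (\<Sum>p\<in>I. g p * e p) + E"
    unfolding G_def E_def by (simp add: power2_sum sum.distrib sum_distrib_left mult_ac)
  have ge0: "(\<Sum>p\<in>I. (g p + e p)\<^sup>2) \<ge> 0" by (intro sum_nonneg) auto
  have 1: "ln (1 + (\<Sum>p\<in>I. (g p + e p)\<^sup>2)) \<le> ln (1 + G) + (2 * (\<Sum>p\<in>I. g p * e p) + E) / (1 + G)"
  proof -
    have "ln ((1 + (\<Sum>p\<in>I. (g p + e p)\<^sup>2)) / (1 + G)) \<le> (1 + (\<Sum>p\<in>I. (g p + e p)\<^sup>2)) / (1 + G) - 1"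
      using nn ge0 by (intro ln_le_minus_one divide_pos_pos) linarith+
    also have "(1 + (\<Sum>p\<in>I. (g p + e p)\<^sup>2)) / (1 + G) - 1 = (2 * (\<Sum>p\<in>I. g p * e p) + E) / (1 + G)"
      unfolding expand using nn by (simp add: field_simps)
    finally show ?thesis using nn ge0 by (simp add: ln_div)
  qed
  have 2: "(2 * (\<Sum>p\<in>I. g p * e p) + E) / (1 + G) \<le> 2 * (\<Sum>p\<in>I. g p * e p) / (1 + G) + E"
    using nn divide_left_mono[of 1 "1 + G" E] by (simp add: add_divide_distrib)
  have XV: "X \<le> V + \<kappa> * W" unfolding X_def V_def W_def by (rule perturbed_descent[OF desc \<kappa>])
  have "L2_set g I = L2_set (\<lambda>p. (\<zeta> p - v p) + \<delta> * U p) I" by (rule L2_set_cong) (auto simp: g)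
  also have "\<dots> \<le> L2_set (\<lambda>p. \<zeta> p - v p) I + u"
    using L2_set_triangle_ineq[of "\<lambda>p. \<zeta> p - v p" "\<lambda>p. \<delta> * U p" I] \<delta> by (simp add: L2_set_mult_const u_def)
  finally have "L2_set g I \<le> sqrt X + u" by (simp add: L2_set_def X_def)
  then have "(L2_set g I)\<^sup>2 \<le> (sqrt X + u)\<^sup>2" by (intro power_mono) auto
  then have "G \<le> X + 2 * sqrt X * u + u\<^sup>2" using nn by (simp add: G_def L2_set_power2 power2_sum)
  moreover have "2 * sqrt X \<le> 1 + X"
  proof -
    have "0 \<le> (1 - sqrt X)\<^sup>2" by simp
    then show ?thesis using nn by (simp add: power2_diff)
  qed
  then have "2 * sqrt X * u \<le> (1 + X) * u" using nn by (intro mult_right_mono) auto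
  moreover have "(1 + X) * u = u + X * u" by (simp add: algebra_simps)
  moreover have "0 \<le> X * u" "0 \<le> X * u\<^sup>2" using nn by auto
  moreover have "(1 + X) * (1 + u)\<^sup>2 = 1 + X + 2 * u + u\<^sup>2 + 2 * (X * u) + X * u\<^sup>2"
    by (simp add: power2_eq_square algebra_simps)
  ultimately have "1 + G \<le> (1 + X) * (1 + u)\<^sup>2" using nn by linarith
  then have "ln (1 + G) \<le> ln ((1 + X) * (1 + u)\<^sup>2)" using nn by simp
  also have "\<dots> = ln (1 + X) + 2 * ln (1 + u)"
    using nn by (subst ln_mult) (auto simp: ln_realpow add_pos_nonneg)
  also have "ln (1 + u) \<le> u" using nn by (intro ln_add_one_self_le_self)
  also have "ln (1 + X) \<le> ln (1 + V) + \<kappa> * W"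
  proof -
    have kW: "0 \<le> \<kappa> * W" "0 \<le> V * (\<kappa> * W)" using \<kappa> nn by auto
    have "1 + X \<le> (1 + V) * (1 + \<kappa> * W)" using XV kW by (simp add: algebra_simps)
    then have "ln (1 + X) \<le> ln ((1 + V) * (1 + \<kappa> * W))" using nn by simp
    also have "\<dots> = ln (1 + V) + ln (1 + \<kappa> * W)" using nn kW by (subst ln_mult) auto
    also have "ln (1 + \<kappa> * W) \<le> \<kappa> * W" using kW by (intro ln_add_one_self_le_self)
    finally show ?thesis by simp
  qed
  finally have "ln (1 + G) \<le> ln (1 + V) + \<kappa> * W + 2 * u" by simp
  then show ?thesis using 1 2 unfolding G_def V_def W_def E_def u_def by linarith
qed

context sc_network
begin

text \<open>Predictable part, at time k, of the error from which the averaged observation noise has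
  been subtracted; adding the dither \<open>nd\<close> gives the new value of that
  difference.\<close>

definition pp :: "'a \<Rightarrow> nat \<Rightarrow> 'v \<times> nat \<Rightarrow> real" where
  "pp \<omega> k p = (er \<omega> (k - 1) p - avg (nw \<omega>) (k - 1) p) - Q \<omega> k (er \<omega> (k - 1)) p / real k
     + 1 / real k * avg (nw \<omega>) (k - 1) p"

text \<open>Coefficient of the dither at node i in the increment of the logarithmic energy. It is
  bounded by 1 because 2 |x| \<le> 1 + x^2.\<close>

definition hh :: "'v \<Rightarrow> nat \<Rightarrow> 'a \<Rightarrow> real" where
  "hh i k \<omega> = 2 * pp \<omega> k (i, sc_coord n k) / (1 + (\<Sum>p\<in>I. (pp \<omega> k p)\<^sup>2))"

lemma finite_I: "finite I" by simp

lemma coord_in_I: "(i, sc_coord n k) \<in> I" by (simp add: coord_less)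

lemma pp_meas: "(\<lambda>\<omega>. pp \<omega> (Suc t) p) \<in> borel_measurable (Gf t)"
proof -
  have [measurable]: "(\<lambda>\<omega>. avg (nw \<omega>) t p) \<in> borel_measurable (Gf t)"
    unfolding avg_def by (intro borel_measurable_divide borel_measurable_sum borel_measurable_times nw_meas) auto
  note [measurable] = er_meas[of t p] Q_er_meas[OF er_meas, of t p]
  show ?thesis unfolding pp_def diff_Suc_1 by measurable
qed

lemma hh_meas: "hh i (Suc t) \<in> borel_measurable (Gf t)"
proof -
  have [measurable]: "(\<lambda>\<omega>. pp \<omega> (Suc t) p) \<in> borel_measurable (Gf t)" for p by (rule pp_meas)
  show ?thesis unfolding hh_def by measurable
qed

lemma abs_hh_le: "\<bar>hh i k \<omega>\<bar> \<le> 1"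
proof -
  define x where "x = pp \<omega> k (i, sc_coord n k)"
  define S where "S = (\<Sum>p\<in>I. (pp \<omega> k p)\<^sup>2)"
  have "x\<^sup>2 \<le> S" unfolding x_def S_def
    by (rule member_le_sum[where f = "\<lambda>p. (pp \<omega> k p)\<^sup>2", OF coord_in_I]) auto
  moreover have "2 * \<bar>x\<bar> \<le> 1 + x\<^sup>2" using zero_le_power2[of "1 - \<bar>x\<bar>"] by (simp add: power2_diff)
  ultimately have "\<bar>2 * x\<bar> \<le> 1 + S" by simp
  moreover have "1 + S > 0" using \<open>x\<^sup>2 \<le> S\<close> zero_le_power2[of x] by linarith
  ultimately show ?thesis unfolding hh_def x_def[symmetric] S_def[symmetric]
    by (simp only: abs_divide) (simp add: divide_le_eq)
qed

definition Ab :: real where "Ab = (\<Sum>i\<in>UNIV. \<Sum>j\<in>UNIV. if a i j > 0 then A * a i j / b i j else 0)"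

lemma Ab_nonneg: "Ab \<ge> 0"
  unfolding Ab_def using A_pos b_pos by (intro sum_nonneg) (auto simp: less_imp_le)

lemma tau_nonneg: "k \<ge> 1 \<Longrightarrow> tau \<omega> k i j \<ge> 0"
proof (cases "a i j > 0")
  case True
  assume "k \<ge> 1"
  then show ?thesis unfolding tau_def
    using A_pos True lap_slope_bounds(1)[OF b_pos[OF True] thr_nonneg[OF True]] by simp
next
  case False
  then have "a i j = 0" using a_nonneg[of i j] by auto
  then show ?thesis by (simp add: tau_def)
qed

text \<open>Without a bound on the path only the slope bound 1 / b is available, so the weights may
  grow like \<open>k powr \<nu>b\<close>. After division by k they still tend to 0.\<close>

lemma tau_row_le:
  assumes k: "k \<ge> 1"
  shows "(\<Sum>j\<in>UNIV. tau \<omega> k i j) \<le> Ab * real k powr \<nu>b"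
proof -
  define f where "f i j = (if a i j > 0 then A * a i j / b i j else 0)" for i j
  have f0: "f i j \<ge> 0" for i j unfolding f_def using A_pos b_pos by (auto simp: less_imp_le)
  have "(\<Sum>j\<in>UNIV. tau \<omega> k i j) \<le> (\<Sum>j\<in>UNIV. f i j * real k powr \<nu>b)"
  proof (rule sum_mono)
    fix j
    show "tau \<omega> k i j \<le> f i j * real k powr \<nu>b"
    proof (cases "a i j > 0")
      case True
      have "tau \<omega> k i j \<le> A * real k powr \<nu>b * a i j * (1 / b i j)"
        unfolding tau_def using A_pos True k \<nu>_le[OF True]
          lap_slope_bounds(1,2)[OF b_pos[OF True] thr_nonneg[OF True k], of "xs \<omega> k i" "xs \<omega> k j"]
        by (intro mult_mono powr_mono) auto
      then show ?thesis using True by (simp add: f_def mult_ac)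
    next
      case False
      then have "a i j = 0" using a_nonneg[of i j] by auto
      then show ?thesis by (simp add: tau_def f_def)
    qed
  qed
  also have "\<dots> = (\<Sum>j\<in>UNIV. f i j) * real k powr \<nu>b" by (simp add: sum_distrib_right)
  also have "(\<Sum>j\<in>UNIV. f i j) \<le> Ab" unfolding Ab_def f_def[symmetric]
    by (rule member_le_sum[where f = "\<lambda>i. \<Sum>j\<in>UNIV. f i j"]) (auto intro!: sum_nonneg f0)
  finally show ?thesis by (simp add: mult_right_mono)
qed

lemma Q_norm_le_inner:
  assumes k: "k \<ge> 1" and r: "\<And>i. (\<Sum>j\<in>UNIV. tau \<omega> k i j) \<le> r"
  shows "(\<Sum>p\<in>I. (Q \<omega> k y p)\<^sup>2) \<le> (4 * r + 2 * B * Hb\<^sup>2) * (\<Sum>p\<in>I. y p * Q \<omega> k y p)"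
  unfolding Q_def
  by (rule netop_norm_le_inner[OF coord_less tau_sym tau_nonneg[OF k] _ r H_le[OF k]]) (use B_pos in auto)

text \<open>Constant \<kappa> of the descent inequality for the operator divided by k. It eventually
  falls below 1 because \<nu>b < 1.\<close>

definition kap :: "nat \<Rightarrow> real" where
  "kap k = (4 * (Ab * real k powr \<nu>b) + 2 * B * Hb\<^sup>2) / real k"

lemma nd_sum_sq_le:
  "k \<ge> 1 \<Longrightarrow> (\<Sum>p\<in>I. (nd \<omega> k p)\<^sup>2) \<le> (\<Sum>i\<in>UNIV. (\<Sum>j\<in>UNIV. 2 * A * a i j)\<^sup>2) * real k powr (2 * \<nu>b - 2)"
proof -
  assume k: "k \<ge> 1"
  define N where "N i = (\<Sum>j\<in>UNIV. dn \<omega> i j k)" for i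
  have "\<bar>N i\<bar> \<le> (\<Sum>j\<in>UNIV. 2 * A * a i j) * real k powr (\<nu>b - 1)" for i
  proof -
    have "\<bar>N i\<bar> \<le> (\<Sum>j\<in>UNIV. \<bar>dn \<omega> i j k\<bar>)" unfolding N_def by (rule sum_abs)
    also have "\<dots> \<le> (\<Sum>j\<in>UNIV. 2 * A * a i j * real k powr (\<nu>b - 1))"
    proof (rule sum_mono)
      fix j
      show "\<bar>dn \<omega> i j k\<bar> \<le> 2 * A * a i j * real k powr (\<nu>b - 1)"
      proof (cases "a i j > 0")
        case True
        have "\<bar>dn \<omega> i j k\<bar> = A * a i j * (real k powr (\<nu> i j - 1) * \<bar>eps \<omega> i j k\<bar>)"
          using A_pos True by (simp add: abs_mult)
        also have "\<dots> \<le> A * a i j * (real k powr (\<nu>b - 1) * 2)"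
          using A_pos True k \<nu>_le[OF True] by (intro mult_left_mono mult_mono powr_mono abs_eps_le_2) auto
        finally show ?thesis by simp
      next
        case False
        then have "a i j = 0" using a_nonneg[of i j] by auto
        then show ?thesis by simp
      qed
    qed
    finally show ?thesis by (simp add: sum_distrib_right)
  qed
  then have N2: "(N i)\<^sup>2 \<le> (\<Sum>j\<in>UNIV. 2 * A * a i j)\<^sup>2 * real k powr (2 * \<nu>b - 2)" for i
    using power_mono[of "\<bar>N i\<bar>" "(\<Sum>j\<in>UNIV. 2 * A * a i j) * real k powr (\<nu>b - 1)" 2]
    by (simp add: power_mult_distrib power2_eq_square[of "real k powr (\<nu>b - 1)"] powr_add[symmetric])
  have "(\<Sum>p\<in>I. (nd \<omega> k p)\<^sup>2) = (\<Sum>i\<in>UNIV. \<Sum>c<n. if c = sc_coord n k then (N i)\<^sup>2 else 0)"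
    unfolding sum_pairs by (intro sum.cong refl) (simp add: nd_def N_def)
  also have "\<dots> = (\<Sum>i\<in>UNIV. (N i)\<^sup>2)" using coord_less[of k] by simp
  also have "\<dots> \<le> (\<Sum>i\<in>UNIV. (\<Sum>j\<in>UNIV. 2 * A * a i j)\<^sup>2 * real k powr (2 * \<nu>b - 2))" by (intro sum_mono N2)
  finally show ?thesis by (simp add: sum_distrib_right)
qed

lemma pp_nd_inner:
  "2 * (\<Sum>p\<in>I. pp \<omega> k p * nd \<omega> k p) / (1 + (\<Sum>p\<in>I. (pp \<omega> k p)\<^sup>2))
    = (\<Sum>i\<in>UNIV. \<Sum>j\<in>UNIV. hh i k \<omega> * (dn \<omega> i j k))"
proof -
  define S where "S = 1 + (\<Sum>p\<in>I. (pp \<omega> k p)\<^sup>2)"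
  define N where "N i = (\<Sum>j\<in>UNIV. dn \<omega> i j k)" for i
  have "(\<Sum>p\<in>I. pp \<omega> k p * nd \<omega> k p) = (\<Sum>i\<in>UNIV. \<Sum>c<n. if c = sc_coord n k then pp \<omega> k (i, c) * N i else 0)"
    unfolding sum_pairs by (intro sum.cong refl) (simp add: nd_def N_def)
  also have "\<dots> = (\<Sum>i\<in>UNIV. pp \<omega> k (i, sc_coord n k) * N i)" using coord_less[of k] by simp
  finally have "2 * (\<Sum>p\<in>I. pp \<omega> k p * nd \<omega> k p) / S = (\<Sum>i\<in>UNIV. 2 * pp \<omega> k (i, sc_coord n k) / S * N i)"
    by (simp add: sum_distrib_left sum_divide_distrib mult.assoc)
  then show ?thesis unfolding hh_def S_def N_def sum_distrib_left .
qed

lemma L2_set_le_card: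
  assumes "\<And>p. p \<in> I \<Longrightarrow> \<bar>f p\<bar> \<le> C"
  shows "L2_set f I \<le> real (card I) * C"
proof -
  have "L2_set f I \<le> (\<Sum>p\<in>I. \<bar>f p\<bar>)" by (rule L2_set_le_sum_abs)
  also have "\<dots> \<le> (\<Sum>p\<in>I. C)" by (intro sum_mono assms)
  finally show ?thesis by simp
qed

text \<open>Only the observation noise is averaged out, since the sharp control of the dither
  presupposes a bounded path. The deterministic increments of the logarithmic energy have orders
  \<open>t powr (\<nu>b - 3 / 2)\<close>, \<open>t powr (- (5 / 4))\<close> and
  \<open>t powr (2 * \<nu>b - 2)\<close>, all summable for \<nu>b < 1 / 2. The dither enters through
  the sums with weights \<open>hh\<close>, which are bounded above.\<close>

lemma er_bounded_path:
  assumes U: "\<forall>\<^sub>F k in sequentially. \<forall>p\<in>I. \<bar>avg (nw \<omega>) k p\<bar> \<le> C * sqrt (ln (real k) / real k)" and C: "C \<ge> 0"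
    and D: "\<And>i j. a i j > 0 \<Longrightarrow> \<exists>C. \<forall>k. (\<Sum>t\<in>{1..k}. hh i t \<omega> * (dn \<omega> i j t)) \<le> C"
  shows "\<exists>R. \<forall>k. L2_set (er \<omega> k) I \<le> R"
proof -
  define \<zeta> where "\<zeta> t p = er \<omega> t p - avg (nw \<omega>) t p" for t p
  define L where "L t = ln (1 + (\<Sum>p\<in>I. (\<zeta> t p)\<^sup>2))" for t
  define Dm where "Dm k = (\<Sum>t\<in>{1..k}. \<Sum>i\<in>UNIV. \<Sum>j\<in>UNIV. hh i t \<omega> * (dn \<omega> i j t))" for k
  define W where "W t = (\<Sum>p\<in>I. (avg (nw \<omega>) t p)\<^sup>2)" for t
  define cN where "cN = (\<Sum>i\<in>UNIV. (\<Sum>j\<in>UNIV. 2 * A * a i j)\<^sup>2)"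
  have cN0: "cN \<ge> 0" unfolding cN_def by (intro sum_nonneg) auto
  define cK where "cK = 4 * Ab + 2 * B * Hb\<^sup>2"
  have cK0: "cK > 0" unfolding cK_def using Ab_nonneg B_pos Hb_pos by (simp add: add_nonneg_pos)
  define N where "N = real (card I)"
  have kap_pos: "kap (Suc t) > 0" for t
    unfolding kap_def using Ab_nonneg B_pos Hb_pos by (intro divide_pos_pos add_nonneg_pos) auto
  have kap_le: "kap (Suc t) \<le> cK * real t powr (\<nu>b - 1)" if "t \<ge> 1" for t
  proof -
    have "1 \<le> real (Suc t) powr \<nu>b" using \<nu>b by (intro ge_one_powr_ge_zero) auto
    then have "4 * (Ab * real (Suc t) powr \<nu>b) + 2 * B * Hb\<^sup>2 \<le> cK * real (Suc t) powr \<nu>b"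
      unfolding cK_def using B_pos mult_left_mono[of 1 "real (Suc t) powr \<nu>b" "2 * B * Hb\<^sup>2"] by (simp add: algebra_simps)
    then have "kap (Suc t) \<le> cK * real (Suc t) powr \<nu>b / real (Suc t)" unfolding kap_def by (intro divide_right_mono) auto
    also have "\<dots> = cK * real (Suc t) powr (\<nu>b - 1)" by (simp add: powr_diff)
    also have "\<dots> \<le> cK * real t powr (\<nu>b - 1)" using cK0 that \<nu>b by (intro mult_left_mono powr_mono2') auto
    finally show ?thesis .
  qed
  have D_bd: "\<exists>C. \<forall>k. Dm k \<le> C"
  proof -
    have ex: "\<exists>C. \<forall>k. (\<Sum>t\<in>{1..k}. hh i t \<omega> * (dn \<omega> i j t)) \<le> C" for i j
    proof (cases "a i j > 0")
      case False
      then have "a i j = 0" using a_nonneg[of i j] by auto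
      then show ?thesis by (intro exI[of _ 0]) simp
    qed (rule D)
    define Cij where "Cij i j = (SOME C. \<forall>k. (\<Sum>t\<in>{1..k}. hh i t \<omega> * (dn \<omega> i j t)) \<le> C)" for i j
    have Cij: "(\<Sum>t\<in>{1..k}. hh i t \<omega> * (dn \<omega> i j t)) \<le> Cij i j" for i j k
      using someI_ex[OF ex[of i j]] unfolding Cij_def by blast
    have "Dm k \<le> (\<Sum>i\<in>UNIV. \<Sum>j\<in>UNIV. Cij i j)" for k
    proof -
      have "Dm k = (\<Sum>i\<in>UNIV. \<Sum>t\<in>{1..k}. \<Sum>j\<in>UNIV. hh i t \<omega> * (dn \<omega> i j t))"
        unfolding Dm_def by (rule sum.swap)
      also have "\<dots> \<le> (\<Sum>i\<in>UNIV. \<Sum>j\<in>UNIV. Cij i j)"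
      proof (rule sum_mono)
        fix i
        have "(\<Sum>t\<in>{1..k}. \<Sum>j\<in>UNIV. hh i t \<omega> * (dn \<omega> i j t))
          = (\<Sum>j\<in>UNIV. \<Sum>t\<in>{1..k}. hh i t \<omega> * (dn \<omega> i j t))" by (rule sum.swap)
        also have "\<dots> \<le> (\<Sum>j\<in>UNIV. Cij i j)" by (intro sum_mono Cij)
        finally show "(\<Sum>t\<in>{1..k}. \<Sum>j\<in>UNIV. hh i t \<omega> * (dn \<omega> i j t)) \<le> (\<Sum>j\<in>UNIV. Cij i j)" .
      qed
      finally show ?thesis .
    qed
    then show ?thesis by blast
  qed
  then obtain CD where CD: "\<And>k. Dm k \<le> CD" by blast
  have zeta_Suc: "\<zeta> (Suc t) p = pp \<omega> (Suc t) p + nd \<omega> (Suc t) p" for t p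
    unfolding \<zeta>_def pp_def diff_Suc_1 er_Suc avg_Suc by simp
  have step: "L (Suc t) \<le> L t + (kap (Suc t) * W t + 2 * (1 / real (Suc t) * L2_set (avg (nw \<omega>) t) I) + (\<Sum>p\<in>I. (nd \<omega> (Suc t) p)\<^sup>2))
      + (Dm (Suc t) - Dm t)" if small: "kap (Suc t) \<le> 1" for t
  proof -
    define k where "k = Suc t"
    define v where "v p = Q \<omega> k (er \<omega> t) p / real k" for p
    have desc: "(\<Sum>p\<in>I. (v p)\<^sup>2) \<le> kap k * (\<Sum>p\<in>I. (\<zeta> t p + avg (nw \<omega>) t p) * v p)"
    proof -
      have "(\<Sum>p\<in>I. (Q \<omega> k (er \<omega> t) p)\<^sup>2) \<le> (4 * (Ab * real k powr \<nu>b) + 2 * B * Hb\<^sup>2) * (\<Sum>p\<in>I. er \<omega> t p * Q \<omega> k (er \<omega> t) p)"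
        by (rule Q_norm_le_inner[OF _ tau_row_le]) (simp_all add: k_def)
      then have "(\<Sum>p\<in>I. (Q \<omega> k (er \<omega> t) p)\<^sup>2) / (real k)\<^sup>2
         \<le> (4 * (Ab * real k powr \<nu>b) + 2 * B * Hb\<^sup>2) * (\<Sum>p\<in>I. er \<omega> t p * Q \<omega> k (er \<omega> t) p) / (real k)\<^sup>2"
        by (rule divide_right_mono) simp
      moreover have "(\<Sum>p\<in>I. (v p)\<^sup>2) = (\<Sum>p\<in>I. (Q \<omega> k (er \<omega> t) p)\<^sup>2) / (real k)\<^sup>2"
        unfolding v_def power_divide sum_divide_distrib ..
      moreover have "(\<Sum>p\<in>I. (\<zeta> t p + avg (nw \<omega>) t p) * v p) = (\<Sum>p\<in>I. er \<omega> t p * Q \<omega> k (er \<omega> t) p) / real k"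
        unfolding v_def \<zeta>_def sum_divide_distrib by simp
      ultimately show ?thesis unfolding kap_def by (simp add: power2_eq_square)
    qed
    have "L (Suc t) = ln (1 + (\<Sum>p\<in>I. (pp \<omega> k p + nd \<omega> k p)\<^sup>2))" unfolding L_def zeta_Suc k_def ..
    also have "\<dots> \<le> ln (1 + (\<Sum>p\<in>I. (\<zeta> t p)\<^sup>2))
      + (kap k * W t + 2 * (1 / real k * L2_set (avg (nw \<omega>) t) I) + (\<Sum>p\<in>I. (nd \<omega> k p)\<^sup>2))
      + 2 * (\<Sum>p\<in>I. pp \<omega> k p * nd \<omega> k p) / (1 + (\<Sum>p\<in>I. (pp \<omega> k p)\<^sup>2))"
      unfolding W_def
    proof (rule log_energy_step[OF desc])
      show "0 < kap k" "kap k \<le> 1" using kap_pos[of t] small by (auto simp: k_def)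
      show "pp \<omega> k p = \<zeta> t p - v p + 1 / real k * avg (nw \<omega>) t p" for p
        unfolding pp_def \<zeta>_def v_def k_def by simp
    qed simp
    also have "2 * (\<Sum>p\<in>I. pp \<omega> k p * nd \<omega> k p) / (1 + (\<Sum>p\<in>I. (pp \<omega> k p)\<^sup>2)) = Dm (Suc t) - Dm t"
      unfolding pp_nd_inner Dm_def k_def by simp
    finally show ?thesis unfolding L_def k_def .
  qed
  have "\<forall>\<^sub>F k::nat in sequentially. sqrt (ln (real k) / real k) \<le> real k powr (- (1 / 4))" by real_asymp
  moreover have "(\<lambda>t. cK * real t powr (\<nu>b - 1)) \<longlonglongrightarrow> 0" using \<nu>b by real_asymp
  then have "\<forall>\<^sub>F t in sequentially. cK * real t powr (\<nu>b - 1) < 1" by (rule order_tendstoD) simp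
  ultimately have "\<forall>\<^sub>F t in sequentially. t \<ge> 1 \<and> kap (Suc t) \<le> 1 \<and> (\<forall>p\<in>I. \<bar>avg (nw \<omega>) t p\<bar> \<le> C * real t powr (- (1 / 4)))"
    using U eventually_ge_at_top[of 1]
  proof eventually_elim
    case (elim t)
    have "kap (Suc t) \<le> 1" using elim(2) kap_le[OF elim(4)] by linarith
    moreover have "\<bar>avg (nw \<omega>) t p\<bar> \<le> C * real t powr (- (1 / 4))" if "p \<in> I" for p
      using elim(3) that mult_left_mono[OF elim(1) C] by (meson order.trans)
    ultimately show ?case using elim(4) by blast
  qed
  then obtain t1 where t1: "\<And>t. t \<ge> t1 \<Longrightarrow> t \<ge> 1 \<and> kap (Suc t) \<le> 1 \<and> (\<forall>p\<in>I. \<bar>avg (nw \<omega>) t p\<bar> \<le> C * real t powr (- (1 / 4)))"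
    unfolding eventually_sequentially by blast
  define s where "s t = cK * (N * C)\<^sup>2 * real t powr (\<nu>b - 3 / 2) + 2 * (N * C) * real t powr (- (5 / 4)) + cN * real t powr (2 * \<nu>b - 2)" for t
  have s: "summable s" unfolding s_def using \<nu>b by (intro summable_add summable_powr_nat) auto
  have N0: "N \<ge> 0" by (simp add: N_def)
  have s0: "0 \<le> s t" for t unfolding s_def using cK0 cN0 C N0 by (intro add_nonneg_nonneg mult_nonneg_nonneg) auto
  have L2U: "L2_set (avg (nw \<omega>) t) I \<le> N * C * real t powr (- (1 / 4))" if "t \<ge> t1" for t
    using L2_set_le_card[of "avg (nw \<omega>) t" "C * real t powr (- (1 / 4))"] t1[OF that] by (simp add: N_def mult.assoc)
  have step': "L (Suc t) \<le> L t + s t + (Dm (Suc t) - Dm t)" if t: "t \<ge> t1" for t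
  proof -
    have t': "t \<ge> 1" "kap (Suc t) \<le> 1" using t1[OF t] by auto
    have "W t = (L2_set (avg (nw \<omega>) t) I)\<^sup>2" by (simp add: W_def L2_set_power2)
    also have "\<dots> \<le> (N * C * real t powr (- (1 / 4)))\<^sup>2" using L2U[OF t] by (intro power_mono) auto
    also have "\<dots> = (N * C)\<^sup>2 * real t powr (- (1 / 2))"
      by (simp add: power_mult_distrib power2_eq_square[of "real t powr _"] powr_add[symmetric])
    finally have Wle: "W t \<le> (N * C)\<^sup>2 * real t powr (- (1 / 2))" .
    have "kap (Suc t) * W t \<le> (cK * real t powr (\<nu>b - 1)) * ((N * C)\<^sup>2 * real t powr (- (1 / 2)))"
      using cK0 by (intro mult_mono kap_le t' Wle) (auto simp: W_def sum_nonneg)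
    also have "\<dots> = cK * (N * C)\<^sup>2 * (real t powr (\<nu>b - 1) * real t powr (- (1 / 2)))" by simp
    also have "real t powr (\<nu>b - 1) * real t powr (- (1 / 2)) = real t powr (\<nu>b - 3 / 2)"
      unfolding powr_add[symmetric] by simp
    finally have 1: "kap (Suc t) * W t \<le> cK * (N * C)\<^sup>2 * real t powr (\<nu>b - 3 / 2)" .
    have "1 / real (Suc t) * L2_set (avg (nw \<omega>) t) I \<le> real t powr (- 1) * (N * C * real t powr (- (1 / 4)))"
      using t' L2U[OF t] by (intro mult_mono) (auto simp: powr_minus_divide frac_le)
    also have "\<dots> = N * C * (real t powr (- 1) * real t powr (- (1 / 4)))" by simp
    also have "real t powr (- 1) * real t powr (- (1 / 4)) = real t powr (- (5 / 4))" unfolding powr_add[symmetric] by simp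
    finally have 2: "1 / real (Suc t) * L2_set (avg (nw \<omega>) t) I \<le> N * C * real t powr (- (5 / 4))" .
    have "(\<Sum>p\<in>I. (nd \<omega> (Suc t) p)\<^sup>2) \<le> cN * real (Suc t) powr (2 * \<nu>b - 2)"
      unfolding cN_def by (rule nd_sum_sq_le) simp
    also have "\<dots> \<le> cN * real t powr (2 * \<nu>b - 2)" using cN0 t' \<nu>b by (intro mult_left_mono powr_mono2') auto
    finally have 3: "(\<Sum>p\<in>I. (nd \<omega> (Suc t) p)\<^sup>2) \<le> cN * real t powr (2 * \<nu>b - 2)" .
    show ?thesis using step[OF t'(2)] 1 2 3 unfolding s_def by linarith
  qed
  obtain R where R: "\<And>t. L t \<le> R" using bounded_above_of_increments[OF step' s s0 CD] by blast
  have "L2_set (er \<omega> t) I \<le> sqrt (exp R) + N * C" if t: "t \<ge> t1" for t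
  proof -
    have "L2_set (er \<omega> t) I \<le> L2_set (\<zeta> t) I + L2_set (avg (nw \<omega>) t) I"
      using L2_set_triangle_ineq[of "\<zeta> t" "avg (nw \<omega>) t" I] by (simp add: \<zeta>_def)
    also have "L2_set (\<zeta> t) I \<le> sqrt (exp R)"
    proof -
      have nn: "0 \<le> (\<Sum>p\<in>I. (\<zeta> t p)\<^sup>2)" by (intro sum_nonneg) auto
      then have "1 + (\<Sum>p\<in>I. (\<zeta> t p)\<^sup>2) = exp (L t)" unfolding L_def by simp
      also have "\<dots> \<le> exp R" using R by simp
      finally show ?thesis by (simp add: L2_set_def)
    qed
    also have "L2_set (avg (nw \<omega>) t) I \<le> N * C * 1"
    proof (rule order.trans[OF L2U[OF t]], rule mult_left_mono)
      show "real t powr (- (1 / 4)) \<le> 1" using t1[OF t] powr_mono[of "- (1 / 4)" 0 "real t"] by simp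
    qed (use N0 C in auto)
    finally show ?thesis by simp
  qed
  then show ?thesis by (rule eventually_bounded_imp_bounded)
qed

lemma AE_er_bounded: "AE \<omega> in M. \<exists>R. \<forall>k. L2_set (er \<omega> k) I \<le> R"
proof -
  have "AE \<omega> in M. \<forall>ij\<in>{(i, j). a i j > 0}. \<exists>C. \<forall>k.
     (\<Sum>t\<in>{1..k}. hh (fst ij) t \<omega> * (dn \<omega> (fst ij) (snd ij) t)) \<le> C"
  proof (rule AE_finite_allI)
    fix ij :: "'v \<times> 'v" assume "ij \<in> {(i, j). a i j > 0}"
    then have "a (fst ij) (snd ij) > 0" by auto
    then show "AE \<omega> in M. \<exists>C. \<forall>k.
       (\<Sum>t\<in>{1..k}. hh (fst ij) t \<omega> * (dn \<omega> (fst ij) (snd ij) t)) \<le> C"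
      by (rule AE_predictable_sum_bounded) (rule hh_meas abs_hh_le)+
  qed simp
  then show ?thesis using AE_avg_nw
  proof eventually_elim
    case (elim \<omega>)
    obtain C where "C \<ge> 0" "\<forall>\<^sub>F k in sequentially. \<forall>p\<in>I. \<bar>avg (nw \<omega>) k p\<bar> \<le> C * sqrt (ln (real k) / real k)"
      using elim(2) by blast
    then show ?case using elim(1) by (intro er_bounded_path[of \<omega> C]) force+
  qed
qed

end

section \<open>Convergence rate\<close>

text \<open>By ln (1 + x) \<le> x and 1 + y \<le> exp y. It identifies e P as the relative decay
  \<sigma> of the rate \<open>k powr (- e)\<close> over a block of length P.\<close>

lemma powr_minus_shift:
  fixes k P :: nat and e :: real
  assumes "k \<ge> 1" "e \<ge> 0"
  shows "(1 - e * real P / real k) * real k powr (- e) \<le> real (k + P) powr (- e)"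
proof -
  define x where "x = real P / real k"
  have x: "x \<ge> 0" by (simp add: x_def)
  have "real (k + P) = real k * (1 + x)" using assms by (simp add: x_def field_simps)
  then have "real (k + P) powr (- e) = real k powr (- e) * (1 + x) powr (- e)"
    using x by (simp add: powr_mult)
  moreover have "1 - e * x \<le> (1 + x) powr (- e)"
  proof -
    have "1 - e * x \<le> 1 - e * ln (1 + x)"
      using mult_left_mono[OF ln_add_one_self_le_self[OF x] assms(2)] by simp
    also have "\<dots> \<le> exp (- (e * ln (1 + x)))" using exp_ge_add_one_self[of "- (e * ln (1 + x))"] by simp
    also have "\<dots> = (1 + x) powr (- e)" using x by (simp add: powr_def)
    finally show ?thesis .
  qed
  then have "(1 - e * x) * real k powr (- e) \<le> (1 + x) powr (- e) * real k powr (- e)" by (intro mult_right_mono) auto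
  ultimately show ?thesis by (simp add: x_def mult_ac)
qed

lemma abs_le_L2_set: "finite I \<Longrightarrow> p \<in> I \<Longrightarrow> \<bar>f p\<bar> \<le> L2_set f I"
  using member_le_L2_set[of I p "\<lambda>p. \<bar>f p\<bar>"] by (simp add: L2_set_def)

locale sc_network_bounds = sc_network +
  fixes blo bhi K \<delta> :: real and p :: nat and o' :: 'b
  assumes blo: "blo > 0" and bhi: "bhi > 0"
    and b_bounds: "\<And>i j. a i j > 0 \<Longrightarrow> blo \<le> b i j \<and> b i j \<le> bhi"
    and K_pos: "K > 0" and \<delta>_pos: "\<delta> > 0" and p_pos: "p \<ge> 1"
    and poincare: "\<And>u::'b \<Rightarrow> real. (\<Sum>i\<in>UNIV. (u i - u o')\<^sup>2) \<le> K * (\<Sum>i\<in>UNIV. \<Sum>j\<in>UNIV. a i j * (u i - u j)\<^sup>2)"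
    and pe: "\<And>k x. k \<ge> 1 \<Longrightarrow> real p * \<delta> * (vnorm n x)\<^sup>2
      \<le> (\<Sum>t\<in>{k..<k+p}. \<Sum>i\<in>UNIV. (vnorm (m i) (mat_vec n (H i t) x))\<^sup>2)"
begin

definition rr :: "nat \<Rightarrow> real" where
  "rr k = sqrt (ln (real k)) / real k powr (1 / 2 - \<nu>b / 2)"

definition Th :: real where "Th = (\<Sum>c<n. \<bar>\<theta> c\<bar>)"

lemma xs_le:
  assumes "L2_set (er \<omega> (k - 1)) I \<le> R"
  shows "\<bar>xs \<omega> k j\<bar> \<le> R + Th"
proof -
  have "xs \<omega> k j = er \<omega> (k - 1) (j, sc_coord n k) + \<theta> (sc_coord n k)" by (simp add: xs_def er_def)
  moreover have "\<bar>er \<omega> (k - 1) (j, sc_coord n k)\<bar> \<le> R"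
    using abs_le_L2_set[OF finite_I coord_in_I, of "er \<omega> (k - 1)" j k] assms by linarith
  moreover have "\<bar>\<theta> (sc_coord n k)\<bar> \<le> Th" unfolding Th_def
    by (rule member_le_sum[where f = "\<lambda>c. \<bar>\<theta> c\<bar>"]) (auto simp: coord_less)
  ultimately show ?thesis by linarith
qed

lemma avg_nd_eq:
  "avg (nd \<omega>) k (i, c) = (\<Sum>j\<in>UNIV. A * a i j * dsum \<omega> i j c k) / real k"
proof -
  have "(\<Sum>t\<in>{1..k}. real t * nd \<omega> t (i, c))
     = (\<Sum>t\<in>{1..k}. \<Sum>j\<in>UNIV. A * a i j * ((if sc_coord n t = c then real t powr \<nu> i j else 0) * eps \<omega> i j t))"
  proof (rule sum.cong[OF refl])
    fix t assume t: "t \<in> {1..k}"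
    show "real t * nd \<omega> t (i, c) = (\<Sum>j\<in>UNIV. A * a i j * ((if sc_coord n t = c then real t powr \<nu> i j else 0) * eps \<omega> i j t))"
    proof (cases "c = sc_coord n t")
      case True
      have "real t * nd \<omega> t (i, c) = (\<Sum>j\<in>UNIV. real t * (dn \<omega> i j t))"
        using True by (simp add: nd_def sum_distrib_left)
      also have "\<dots> = (\<Sum>j\<in>UNIV. A * a i j * ((if sc_coord n t = c then real t powr \<nu> i j else 0) * eps \<omega> i j t))"
        using True t by (intro sum.cong refl) (simp add: powr_diff)
      finally show ?thesis .
    qed (auto simp: nd_def)
  qed
  also have "\<dots> = (\<Sum>j\<in>UNIV. \<Sum>t\<in>{1..k}. A * a i j * ((if sc_coord n t = c then real t powr \<nu> i j else 0) * eps \<omega> i j t))"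
    by (rule sum.swap)
  finally show ?thesis unfolding avg_def by (simp add: sum_distrib_left)
qed

text \<open>Along a path bounded by R the sending probability is at most
  \<open>E * t powr (- \<nu> i j)\<close>, so the predictable variance is at most
  \<open>E * k powr (1 + \<nu> i j)\<close>, and both terms of \<open>dsum_le\<close> have the order
  of the square root of ln k times that power. The constant depends on the path, which an almost
  sure order permits.\<close>

lemma eps_sum_le_path:
  assumes aij: "a i j > 0" and R: "\<And>k. L2_set (er \<omega> k) I \<le> R"
    and ev: "\<And>sg. sg \<in> {1, -1} \<Longrightarrow> \<forall>\<^sub>F k in sequentially. dsum_le \<omega> i j c sg k"
  shows "\<exists>C\<ge>0. \<forall>\<^sub>F k in sequentially. \<bar>dsum \<omega> i j c k\<bar>
     \<le> C * real k * rr k"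
proof -
  define v where "v = \<nu> i j"
  have aji: "a j i > 0" using aij a_sym by simp
  have v: "0 \<le> v" "v \<le> \<nu>b" using \<nu>_nonneg[OF aij] \<nu>_le[OF aij] by (auto simp: v_def)
  define E where "E = exp ((R + Th) / b j i)"
  define S where "S k = (\<Sum>t\<in>{1..k}. (if sc_coord n t = c then real t powr v else 0) * eps \<omega> i j t)" for k
  define V where "V k = (\<Sum>t\<in>{1..k}. (real t powr v)\<^sup>2 * send \<omega> i j t)" for k
  have V_le: "V k \<le> E * (real k * real k powr v)" for k
  proof -
    have "V k \<le> (\<Sum>t\<in>{1..k}. E * real k powr v)" unfolding V_def
    proof (rule sum_mono)
      fix t assume t: "t \<in> {1..k}"
      have "send \<omega> i j t \<le> E * exp (- sc_thr \<nu> b j i t / b j i)"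
        unfolding E_def by (rule lap_send_le[OF b_pos[OF aji]]) (rule xs_le[OF R])
      also have "exp (- sc_thr \<nu> b j i t / b j i) = real t powr (- v)"
        using exp_thr[OF aji, of t] t \<nu>_sym[OF aij] by (simp add: v_def)
      finally have "(real t powr v)\<^sup>2 * send \<omega> i j t \<le> (real t powr v)\<^sup>2 * (E * real t powr (- v))"
        by (intro mult_left_mono) auto
      also have "\<dots> = E * real t powr v" using t by (simp add: power2_eq_square powr_minus)
      also have "\<dots> \<le> E * real k powr v" using t v by (intro mult_left_mono powr_mono2) (auto simp: E_def)
      finally show "(real t powr v)\<^sup>2 * send \<omega> i j t \<le> E * real k powr v" .
    qed
    then show ?thesis by (simp add: mult_ac)
  qed
  have "\<forall>\<^sub>F k in sequentially. \<bar>S k\<bar> \<le> (E + 2) * real k * rr k"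
    using ev[of 1, simplified] ev[of "-1", simplified] eventually_gt_at_top[of 1]
    unfolding v_def[symmetric] S_def[symmetric]
  proof eventually_elim
    case (elim k)
    define l where "l = ln (real k)"
    define kv where "kv = real k powr (1 + v)"
    have pos: "l > 0" "kv > 0" using elim(3) by (auto simp: l_def kv_def)
    have kv_eq: "kv = real k * real k powr v" using elim(3) by (simp add: kv_def powr_add)
    define q where "q = sqrt (l * kv)"
    have q0: "q > 0" using pos by (simp add: q_def)
    have 1: "sqrt (l / kv) * kv = q"
    proof -
      have "sqrt (l / kv) * kv = sqrt (l / kv) * sqrt (kv\<^sup>2)" using pos by simp
      also have "\<dots> = q" unfolding q_def real_sqrt_mult[symmetric] using pos by (simp add: power2_eq_square)
      finally show ?thesis .
    qed
    have 2: "l / sqrt (l / kv) = q"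
    proof -
      have "q * sqrt (l / kv) = sqrt (l\<^sup>2)" unfolding q_def real_sqrt_mult[symmetric] using pos by (simp add: power2_eq_square)
      also have "\<dots> = l" using pos by simp
      finally show ?thesis using pos by (simp add: field_simps)
    qed
    have Vk: "V k = (\<Sum>t = Suc 0..k. (real t powr v)\<^sup>2 * send \<omega> i j t)" unfolding V_def by simp
    have bd: "sqrt (l / kv) * V k + 2 * l / sqrt (l / kv) \<le> (E + 2) * q"
    proof -
      have "sqrt (l / kv) * V k \<le> sqrt (l / kv) * (E * kv)"
        using V_le[of k] pos unfolding kv_eq[symmetric] by (intro mult_left_mono) auto
      also have "\<dots> = E * q" unfolding 1[symmetric] by simp
      finally have "sqrt (l / kv) * V k \<le> E * q" .
      moreover have "2 * l / sqrt (l / kv) = 2 * q" using 2 by simp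
      ultimately show ?thesis by (simp only: distrib_right)
    qed
    have Sk: "S k = (\<Sum>t = Suc 0..k. (if sc_coord n t = c then real t powr v else 0) * eps \<omega> i j t)" unfolding S_def by simp
    have "S k \<le> (E + 2) * q" "- S k \<le> (E + 2) * q"
      using elim(1,2) bd unfolding Sk[symmetric] Vk[symmetric] l_def[symmetric] kv_def[symmetric] by linarith+
    then have "\<bar>S k\<bar> \<le> (E + 2) * q" by linarith
    also have "q \<le> real k * rr k"
    proof -
      have "sqrt kv = real k powr ((1 + v) / 2)" using elim(3) by (simp add: kv_def powr_half_sqrt[symmetric] powr_powr)
      also have "\<dots> \<le> real k powr (1 - (1 / 2 - \<nu>b / 2))" using elim(3) v by (intro powr_mono) (auto simp: field_simps)
      also have "\<dots> = real k / real k powr (1 / 2 - \<nu>b / 2)" using elim(3) by (subst powr_diff) simp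
      finally have "sqrt l * sqrt kv \<le> sqrt l * (real k / real k powr (1 / 2 - \<nu>b / 2))" using pos by (intro mult_left_mono) auto
      then show ?thesis by (simp add: q_def real_sqrt_mult rr_def l_def mult_ac)
    qed
    then have "(E + 2) * q \<le> (E + 2) * (real k * rr k)" by (intro mult_left_mono) (auto simp: E_def add_nonneg_nonneg)
    finally show ?case by (simp add: mult.assoc)
  qed
  moreover have "E + 2 \<ge> 0" by (simp add: E_def add_nonneg_nonneg)
  ultimately show ?thesis unfolding S_def v_def by blast
qed

text \<open>Dither sums occur for finitely many edges, coordinates and signs, so one null set covers
  all of them. The observation noise contributes the order sqrt (ln k / k), which is at most
  \<open>rr\<close>.\<close>

lemma AE_avg_noise:
  "AE \<omega> in M. \<exists>C\<ge>0. \<forall>\<^sub>F k in sequentially. \<forall>p\<in>I. \<bar>avg (\<lambda>t p. nd \<omega> t p + nw \<omega> t p) k p\<bar> \<le> C * rr k"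
proof -
  have ev: "AE \<omega> in M. \<forall>x\<in>{(i, j, c, sg). a i j > 0 \<and> c < n \<and> sg \<in> {1, -1::real}}. case x of (i, j, c, sg) \<Rightarrow>
     (\<forall>\<^sub>F k in sequentially. dsum_le \<omega> i j c sg k)"
  proof (rule AE_finite_allI)
    have "{(i, j, c, sg). a i j > 0 \<and> c < n \<and> sg \<in> {1, -1::real}} \<subseteq> UNIV \<times> UNIV \<times> {..<n} \<times> {1, -1}" by auto
    then show "finite {(i, j, c, sg). a i j > 0 \<and> c < n \<and> sg \<in> {1, -1::real}}" by (rule finite_subset) auto
  next
    fix x assume "x \<in> {(i, j, c, sg). a i j > 0 \<and> c < n \<and> sg \<in> {1, -1::real}}"
    then obtain i j c sg where x: "x = (i, j, c, sg)" "a i j > 0" "\<bar>sg\<bar> = 1" by auto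
    show "AE \<omega> in M. case x of (i, j, c, sg) \<Rightarrow> (\<forall>\<^sub>F k in sequentially. dsum_le \<omega> i j c sg k)"
      unfolding x(1) prod.case by (rule AE_eps_sum_le[OF x(2,3)])
  qed
  show ?thesis
    using ev AE_er_bounded AE_avg_nw
  proof eventually_elim
    case (elim \<omega>)
    define S where "S i j c k = dsum \<omega> i j c k" for i j c k
    obtain R where R: "\<And>k. L2_set (er \<omega> k) I \<le> R" using elim(2) by blast
    have ex: "\<exists>C\<ge>0. \<forall>\<^sub>F k in sequentially. A * a i j * \<bar>S i j c k\<bar> \<le> C * real k * rr k" if c: "c < n" for i j c
    proof (cases "a i j > 0")
      case True
      have "\<exists>C\<ge>0. \<forall>\<^sub>F k in sequentially. \<bar>S i j c k\<bar> \<le> C * real k * rr k"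
        unfolding S_def by (rule eps_sum_le_path[OF True R]) (use elim(1) True c in blast)
      then obtain C where C: "C \<ge> 0" "\<forall>\<^sub>F k in sequentially. \<bar>S i j c k\<bar> \<le> C * real k * rr k" by blast
      show ?thesis
      proof (intro exI[of _ "A * a i j * C"] conjI)
        show "0 \<le> A * a i j * C" using A_pos True C by simp
        show "\<forall>\<^sub>F k in sequentially. A * a i j * \<bar>S i j c k\<bar> \<le> A * a i j * C * real k * rr k"
          using C(2) by eventually_elim (use A_pos True in \<open>simp add: mult.assoc\<close>)
      qed
    next
      case False
      then have "a i j = 0" using a_nonneg[of i j] by auto
      then show ?thesis by (intro exI[of _ 0]) simp
    qed
    define Cd where "Cd i j c = (SOME C. C \<ge> 0 \<and> (\<forall>\<^sub>F k in sequentially. A * a i j * \<bar>S i j c k\<bar> \<le> C * real k * rr k))" for i j c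
    have Cd: "Cd i j c \<ge> 0" "\<forall>\<^sub>F k in sequentially. A * a i j * \<bar>S i j c k\<bar> \<le> Cd i j c * real k * rr k" if "c < n" for i j c
      using someI_ex[OF ex[OF that, of i j]] unfolding Cd_def by blast+
    obtain Cw where Cw: "Cw \<ge> 0" "\<forall>\<^sub>F k in sequentially. \<forall>p\<in>I. \<bar>avg (nw \<omega>) k p\<bar> \<le> Cw * sqrt (ln (real k) / real k)"
      using elim(3) by blast
    have "\<forall>\<^sub>F k in sequentially. \<forall>i\<in>UNIV. \<forall>j\<in>UNIV. \<forall>c\<in>{..<n}. A * a i j * \<bar>S i j c k\<bar> \<le> Cd i j c * real k * rr k"
      by (intro eventually_ball_finite ballI finite) (use Cd in auto)
    then have "\<forall>\<^sub>F k in sequentially. \<forall>p\<in>I. \<bar>avg (\<lambda>t p. nd \<omega> t p + nw \<omega> t p) k p\<bar>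
        \<le> ((\<Sum>i\<in>UNIV. \<Sum>c<n. \<Sum>j\<in>UNIV. Cd i j c) + Cw) * rr k"
      using Cw(2) eventually_gt_at_top[of 1]
    proof eventually_elim
      case (elim k)
      have rr0: "rr k \<ge> 0" using elim(3) by (simp add: rr_def)
      show ?case
      proof
        fix p assume p: "p \<in> I"
        obtain i c where ic: "p = (i, c)" "c < n" using p by auto
        have "\<bar>avg (nd \<omega>) k p\<bar> \<le> (\<Sum>j\<in>UNIV. Cd i j c) * rr k"
        proof -
          have "\<bar>avg (nd \<omega>) k p\<bar> = \<bar>\<Sum>j\<in>UNIV. A * a i j * S i j c k\<bar> / real k"
            unfolding ic avg_nd_eq S_def by simp
          also have "\<dots> \<le> (\<Sum>j\<in>UNIV. Cd i j c * real k * rr k) / real k"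
          proof (rule divide_right_mono)
            have "\<bar>\<Sum>j\<in>UNIV. A * a i j * S i j c k\<bar> \<le> (\<Sum>j\<in>UNIV. \<bar>A * a i j * S i j c k\<bar>)" by (rule sum_abs)
            also have "\<dots> \<le> (\<Sum>j\<in>UNIV. Cd i j c * real k * rr k)"
            proof (rule sum_mono)
              fix j
              have "\<bar>A * a i j * S i j c k\<bar> = A * a i j * \<bar>S i j c k\<bar>" using A_pos a_nonneg[of i j] by (simp add: abs_mult)
              then show "\<bar>A * a i j * S i j c k\<bar> \<le> Cd i j c * real k * rr k" using elim(1) ic(2) by auto
            qed
            finally show "\<bar>\<Sum>j\<in>UNIV. A * a i j * S i j c k\<bar> \<le> (\<Sum>j\<in>UNIV. Cd i j c * real k * rr k)" .
          qed simp
          also have "\<dots> = (\<Sum>j\<in>UNIV. Cd i j c) * rr k"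
            using elim(3) by (simp add: sum_distrib_right[symmetric])
          finally show ?thesis .
        qed
        also have "(\<Sum>j\<in>UNIV. Cd i j c) * rr k \<le> (\<Sum>i\<in>UNIV. \<Sum>c<n. \<Sum>j\<in>UNIV. Cd i j c) * rr k"
        proof (rule mult_right_mono[OF _ rr0])
          have "(\<Sum>j\<in>UNIV. Cd i j c) \<le> (\<Sum>c<n. \<Sum>j\<in>UNIV. Cd i j c)"
            by (rule member_le_sum[where f = "\<lambda>c. \<Sum>j\<in>UNIV. Cd i j c"]) (use ic Cd in \<open>auto intro!: sum_nonneg\<close>)
          also have "\<dots> \<le> (\<Sum>i\<in>UNIV. \<Sum>c<n. \<Sum>j\<in>UNIV. Cd i j c)"
            by (rule member_le_sum[where f = "\<lambda>i. \<Sum>c<n. \<Sum>j\<in>UNIV. Cd i j c"]) (use Cd in \<open>auto intro!: sum_nonneg\<close>)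
          finally show "(\<Sum>j\<in>UNIV. Cd i j c) \<le> (\<Sum>i\<in>UNIV. \<Sum>c<n. \<Sum>j\<in>UNIV. Cd i j c)" .
        qed
        finally have 1: "\<bar>avg (nd \<omega>) k p\<bar> \<le> (\<Sum>i\<in>UNIV. \<Sum>c<n. \<Sum>j\<in>UNIV. Cd i j c) * rr k" .
        have "sqrt (ln (real k) / real k) \<le> rr k"
        proof -
          have "sqrt (real k) = real k powr (1 / 2)" by (simp add: powr_half_sqrt)
          also have "real k powr (1 / 2 - \<nu>b / 2) \<le> \<dots>" using elim(3) \<nu>b by (intro powr_mono) auto
          finally show ?thesis unfolding rr_def real_sqrt_divide using elim(3) by (intro divide_left_mono) auto
        qed
        then have "Cw * sqrt (ln (real k) / real k) \<le> Cw * rr k" using Cw(1) by (rule mult_left_mono)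
        then have 2: "\<bar>avg (nw \<omega>) k p\<bar> \<le> Cw * rr k" using elim(2) p by (meson order.trans)
        have "avg (\<lambda>t p. nd \<omega> t p + nw \<omega> t p) k p = avg (nd \<omega>) k p + avg (nw \<omega>) k p"
          by (simp add: avg_def distrib_left sum.distrib add_divide_distrib)
        then show "\<bar>avg (\<lambda>t p. nd \<omega> t p + nw \<omega> t p) k p\<bar> \<le> ((\<Sum>i\<in>UNIV. \<Sum>c<n. \<Sum>j\<in>UNIV. Cd i j c) + Cw) * rr k"
          using 1 2 by (simp add: distrib_right)
      qed
    qed
    moreover have "(\<Sum>i\<in>UNIV. \<Sum>c<n. \<Sum>j\<in>UNIV. Cd i j c) + Cw \<ge> 0"
      using Cd Cw by (intro add_nonneg_nonneg sum_nonneg) auto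
    ultimately show ?case by blast
  qed
qed

text \<open>Consensus gain guaranteed while the transmitted values stay within R of 0. It decays
  exponentially in R: for a bound found along a path it is random, for R = \<open>Th + 1\<close> it
  is a constant of the problem.\<close>

definition gain :: "real \<Rightarrow> real" where "gain R = A * (exp (- R / blo) / bhi)"

lemma tau_bounds:
  assumes k: "k \<ge> 1" and R: "R \<ge> 0" "\<And>j. \<bar>xs \<omega> k j\<bar> \<le> R"
  shows "gain R * a i j \<le> tau \<omega> k i j" "tau \<omega> k i j \<le> A * a i j * (exp (R / blo) / blo)"
proof -
  have "gain R * a i j \<le> tau \<omega> k i j \<and> tau \<omega> k i j \<le> A * a i j * (exp (R / blo) / blo)"
  proof (cases "a i j > 0")
    case True
    define sl where "sl = lap_slope (sc_thr \<nu> b i j k) (b i j) (xs \<omega> k i) (xs \<omega> k j)"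
    have kk: "real k powr \<nu> i j * real k powr (- \<nu> i j) = 1" using k by (simp add: powr_minus)
    have bb: "0 < blo" "blo \<le> b i j" "b i j \<le> bhi" using b_bounds[OF True] blo by auto
    have sl: "exp (- R / b i j) / b i j * real k powr (- \<nu> i j) \<le> sl" "sl \<le> exp (R / b i j) / b i j * real k powr (- \<nu> i j)"
      unfolding sl_def exp_thr[OF True k, symmetric]
      by (intro lap_slope_bounds(3,4)[OF b_pos[OF True] thr_nonneg[OF True k]] R)+
    have tau: "tau \<omega> k i j = A * a i j * (real k powr \<nu> i j * sl)" by (simp add: tau_def sl_def)
    have "real k powr \<nu> i j * sl \<ge> real k powr \<nu> i j * (exp (- R / b i j) / b i j * real k powr (- \<nu> i j))"
      using sl by (intro mult_left_mono) auto
    also have "real k powr \<nu> i j * (exp (- R / b i j) / b i j * real k powr (- \<nu> i j)) = exp (- R / b i j) / b i j"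
      using kk by (simp add: mult.assoc[symmetric] mult.commute[of "real k powr \<nu> i j"])
    also have "exp (- R / b i j) / b i j \<ge> exp (- R / blo) / bhi"
    proof (rule frac_le)
      have "R / b i j \<le> R / blo" using bb R by (intro divide_left_mono) auto
      then show "exp (- R / blo) \<le> exp (- R / b i j)" by simp
    qed (use bb in auto)
    finally have lo: "exp (- R / blo) / bhi \<le> real k powr \<nu> i j * sl" .
    have "real k powr \<nu> i j * sl \<le> real k powr \<nu> i j * (exp (R / b i j) / b i j * real k powr (- \<nu> i j))"
      using sl by (intro mult_left_mono) auto
    also have "\<dots> = exp (R / b i j) / b i j"
      using kk by (simp add: mult.assoc[symmetric] mult.commute[of "real k powr \<nu> i j"])
    also have "\<dots> \<le> exp (R / blo) / blo"
    proof (rule frac_le)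
      have "R / b i j \<le> R / blo" using bb R by (intro divide_left_mono) auto
      then show "exp (R / b i j) \<le> exp (R / blo)" by simp
    qed (use bb in auto)
    finally have hi: "real k powr \<nu> i j * sl \<le> exp (R / blo) / blo" .
    have Aa: "A * a i j > 0" using A_pos True by simp
    show ?thesis unfolding tau gain_def using mult_left_mono[OF lo, of "A * a i j"] mult_left_mono[OF hi, of "A * a i j"] Aa
      by (simp add: mult_ac)
  next
    case False
    then have "a i j = 0" using a_nonneg[of i j] by auto
    then show ?thesis by (simp add: tau_def)
  qed
  then show "gain R * a i j \<le> tau \<omega> k i j" "tau \<omega> k i j \<le> A * a i j * (exp (R / blo) / blo)" by auto
qed

text \<open>The deterministic core shared by both passes. Subtracting the averaged noise U cancels
  the noise and leaves (U - Q U) / k, whose size is that of the reference rate divided by k. Block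
  contraction and comparison with \<open>s\<close> then apply, and U is added back at the
  end.\<close>

lemma path_rate:
  fixes s :: "nat \<Rightarrow> real"
  defines "P \<equiv> n + p"
  assumes t0: "t0 \<ge> 1" and R: "R \<ge> 0" "\<And>k j. k \<ge> t0 \<Longrightarrow> \<bar>xs \<omega> k j\<bar> \<le> R"
    and B': "0 \<le> B'" "B' \<le> B" and \<mu>: "\<sigma> < \<mu>'" "0 \<le> \<mu>'" "\<mu>' < \<mu>"
    and c1: "8 * K * \<mu> \<le> gain R" and c2: "4 * real CARD('b) * \<mu> \<le> real p * \<delta> * B'"
    and c3: "4 * K * (real p * Hb\<^sup>2) * B' \<le> gain R"
    and U: "\<And>k. k \<ge> t0 \<Longrightarrow> L2_set (avg (\<lambda>t p. nd \<omega> t p + nw \<omega> t p) k) I \<le> C * s k" and C: "C \<ge> 0"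
    and s_pos: "\<And>k. k \<ge> t0 \<Longrightarrow> s k > 0"
    and shift: "\<And>k j. k \<ge> t0 \<Longrightarrow> j \<le> P \<Longrightarrow> s (k + j) \<le> 2 * s k"
    and s_rec: "\<And>k. k \<ge> t0 \<Longrightarrow> (1 - \<sigma> / real k) * s k \<le> s (k + P)"
  shows "\<exists>D k2. 0 \<le> D \<and> (\<forall>k\<ge>k2. L2_set (er \<omega> k) I \<le> D * s k)"
proof -
  define U where "U k = avg (\<lambda>t p. nd \<omega> t p + nw \<omega> t p) k" for k
  define z where "z k p = er \<omega> k p - U k p" for k p
  define e where "e k p = U (k - 1) p - Q \<omega> k (U (k - 1)) p" for k p
  define r where "r = (\<Sum>i\<in>UNIV. \<Sum>j\<in>UNIV. A * a i j * (exp (R / blo) / blo))"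
  have term0: "A * a i j * (exp (R / blo) / blo) \<ge> 0" for i j using A_pos a_nonneg[of i j] blo by simp
  have r0: "r \<ge> 0" unfolding r_def by (intro sum_nonneg term0)
  define q where "q = 4 * r + 2 * B * Hb\<^sup>2"
  have q0: "q > 0" unfolding q_def using r0 B_pos Hb_pos by (simp add: add_nonneg_pos)
  \<comment> \<open>\<open>block_contraction\<close> asks for nonnegativity at all indices, while
    nothing is known about \<open>s\<close> below \<open>t0\<close>.\<close>
  define s' where "s' k = (if k \<ge> t0 then s k else 0)" for k
  have Qsq: "(\<Sum>p\<in>I. (Q \<omega> k y p)\<^sup>2) \<le> q * (\<Sum>p\<in>I. y p * Q \<omega> k y p)" if k: "k \<ge> t0" for k y
    unfolding q_def
  proof (rule Q_norm_le_inner)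
    show "k \<ge> 1" using k t0 by simp
    fix i
    have "(\<Sum>j\<in>UNIV. tau \<omega> k i j) \<le> (\<Sum>j\<in>UNIV. A * a i j * (exp (R / blo) / blo))"
      using k t0 by (intro sum_mono tau_bounds(2) R) auto
    also have "\<dots> \<le> r" unfolding r_def
      by (rule member_le_sum[where f = "\<lambda>i. \<Sum>j\<in>UNIV. A * a i j * (exp (R / blo) / blo)", OF UNIV_I _ finite])
         (intro sum_nonneg term0)
    finally show "(\<Sum>j\<in>UNIV. tau \<omega> k i j) \<le> r" .
  qed
  have Qn: "L2_set (Q \<omega> k y) I \<le> q * L2_set y I" if "k \<ge> t0" for k y
    by (rule norm_le_of_sq_le_inner[OF Qsq[OF that]]) (use q0 in auto)
  have Qdiff: "Q \<omega> t (\<lambda>i. x i - y i) i = Q \<omega> t x i - Q \<omega> t y i" for t x y i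
    unfolding Q_def by (rule netop_diff)
  have rec: "z (Suc t) i = z t i - Q \<omega> (Suc t) (z t) i / real (Suc t) + e (Suc t) i / real (Suc t)" for t i
  proof -
    have "Q \<omega> (Suc t) (z t) i = Q \<omega> (Suc t) (er \<omega> t) i - Q \<omega> (Suc t) (U t) i"
      unfolding z_def by (rule Qdiff)
    then show ?thesis unfolding e_def z_def[of "Suc t"] z_def[of t] er_Suc U_def avg_Suc diff_Suc_1
      by (simp add: diff_divide_distrib)
  qed
  have "\<exists>C k1. \<forall>k\<ge>k1. L2_set (z (k + P)) I \<le> (1 - \<mu>' / real k) * L2_set (z k) I + C * s' k / real k"
  proof (rule block_contraction[where Q = "Q \<omega>" and e = e and ?t0.0 = t0 and q = q and \<mu> = \<mu> and c = "2 * (1 + q) * C", OF finite_I])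
    show "z (Suc t) i = z t i - Q \<omega> (Suc t) (z t) i / real (Suc t) + e (Suc t) i / real (Suc t)" for t i by (rule rec)
    show "Q \<omega> t (\<lambda>i. x i - y i) i = Q \<omega> t x i - Q \<omega> t y i" for t x y i by (rule Qdiff)
    show "L2_set (Q \<omega> t x) I \<le> q * L2_set x I" if "t0 \<le> t" for t x by (rule Qn[OF that])
    show "0 \<le> (\<Sum>i\<in>I. x i * Q \<omega> t x i)" if "t0 \<le> t" for t x
    proof -
      have "0 \<le> (\<Sum>p\<in>I. (Q \<omega> t x p)\<^sup>2)" by (intro sum_nonneg) auto
      then have "0 \<le> q * (\<Sum>p\<in>I. x p * Q \<omega> t x p)" using Qsq[OF that, of x] by linarith
      then show ?thesis using q0 by (simp add: zero_le_mult_iff)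
    qed
    show "\<mu> * (L2_set x I)\<^sup>2 \<le> (\<Sum>t\<in>{Suc k..k + P}. \<Sum>i\<in>I. x i * Q \<omega> t x i)" if k: "t0 \<le> k" for k x
      unfolding Q_def P_def
    proof (rule netop_coercive[where h = "\<lambda>t i. H i t" and a = a and K = K and o' = o' and \<delta> = \<delta> and Hb = Hb and \<gamma> = "gain R" and B' = B',
          OF n_pos a_nonneg K_pos poincare])
      show "real p * \<delta> * (vnorm n x)\<^sup>2 \<le> (\<Sum>t = Suc k..k + p. \<Sum>i\<in>UNIV. (vnorm (m i) (mat_vec n (H i t) x))\<^sup>2)" for x
      proof -
        have "{Suc k..k + p} = {Suc k..<Suc k + p}" by auto
        then show ?thesis using pe[of "Suc k" x] by simp
      qed
      show "mnorm (m i) n (H i t) \<le> Hb" if "t \<in> {Suc k..k + p}" for t i using that by (intro H_le) auto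
      show "tau \<omega> t i j = tau \<omega> t j i" for t i j by (rule tau_sym)
      show "gain R * a i j \<le> tau \<omega> t i j" if "t \<in> {Suc k..k + (n + p)}" for t i j
        using that k t0 by (intro tau_bounds(1) R) auto
      show "0 \<le> gain R" unfolding gain_def using A_pos bhi by simp
    qed (use B' \<mu> c1 c2 c3 in auto)
    show "L2_set (e t) I \<le> 2 * (1 + q) * C * s' k" if k: "t0 \<le> k" and t: "t \<in> {Suc k..k + P}" for k t
    proof -
      have t1: "t - 1 \<ge> t0" "t \<ge> t0" using k t by auto
      define j where "j = t - 1 - k"
      have j: "t - 1 = k + j" "j \<le> P" using t by (auto simp: j_def)
      have "L2_set (e t) I = L2_set (\<lambda>p. U (t - 1) p + - Q \<omega> t (U (t - 1)) p) I"
        by (rule L2_set_cong) (auto simp: e_def)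
      also have "\<dots> \<le> L2_set (U (t - 1)) I + L2_set (\<lambda>p. - Q \<omega> t (U (t - 1)) p) I" by (rule L2_set_triangle_ineq)
      also have "\<dots> \<le> L2_set (U (t - 1)) I + q * L2_set (U (t - 1)) I"
        unfolding L2_set_minus_fun using Qn[OF t1(2)] by simp
      also have "\<dots> = (1 + q) * L2_set (U (t - 1)) I" by (simp add: algebra_simps)
      also have "\<dots> \<le> (1 + q) * (C * (2 * s k))"
      proof (rule mult_left_mono)
        have "L2_set (U (t - 1)) I \<le> C * s (t - 1)" unfolding U_def by (rule U[OF t1(1)])
        also have "\<dots> \<le> C * (2 * s k)" unfolding j(1) using C shift[OF k j(2)] by (intro mult_left_mono)
        finally show "L2_set (U (t - 1)) I \<le> C * (2 * s k)" .
      qed (use q0 in auto)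
      finally show ?thesis using k by (simp add: s'_def mult_ac)
    qed
    show "0 \<le> s' k" for k using s_pos[of k] by (auto simp: s'_def)
  qed (use q0 C \<mu> in auto)
  then obtain C' k1 where bc: "\<And>k. k \<ge> k1 \<Longrightarrow> L2_set (z (k + P)) I \<le> (1 - \<mu>' / real k) * L2_set (z k) I + C' * s' k / real k" by blast
  have "\<exists>D k2. 0 \<le> D \<and> (\<forall>k\<ge>k2. L2_set (z k) I \<le> D * s k)"
  proof (rule linear_recursion_rate[where ?k1.0 = "max k1 t0" and P = P and \<mu> = \<mu>' and \<sigma> = \<sigma> and C = C'])
    show "L2_set (z (k + P)) I \<le> (1 - \<mu>' / real k) * L2_set (z k) I + C' * s k / real k" if "max k1 t0 \<le> k" for k
      using bc[of k] that by (simp add: s'_def)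
  qed (use n_pos \<mu> s_pos s_rec in \<open>auto simp: P_def\<close>)
  then obtain D k2 where D: "0 \<le> D" "\<And>k. k \<ge> k2 \<Longrightarrow> L2_set (z k) I \<le> D * s k" by blast
  have "L2_set (er \<omega> k) I \<le> (D + C) * s k" if "k \<ge> max k2 t0" for k
  proof -
    have "L2_set (er \<omega> k) I \<le> L2_set (z k) I + L2_set (U k) I"
      using L2_set_triangle_ineq[of "z k" "U k" I] by (simp add: z_def)
    also have "\<dots> \<le> D * s k + C * s k" using that by (intro add_mono D) (auto simp: U_def intro: U)
    finally show ?thesis by (simp add: distrib_right)
  qed
  then show ?thesis using D(1) C by (intro exI[of _ "D + C"] exI[of _ "max k2 t0"]) auto
qed

end

context sc_network_bounds
begin

text \<open>The constants \<open>A\<close> and \<open>B\<close> enter through three inequalities at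
  the fixed radius \<open>Th + 1\<close>. The value n + p + 2 leaves room for the chain \<sigma> <
  \<mu>' < \<mu>: the relative decay of \<open>rr\<close> over a block is at most n + p, and two
  strict inequalities are required.\<close>

lemma AE_rate:
  assumes c1: "8 * K * real (n + p + 2) \<le> gain (Th + 1)"
    and c2: "4 * real CARD('b) * real (n + p + 2) \<le> real p * \<delta> * B"
    and c3: "4 * K * (real p * Hb\<^sup>2) * B \<le> gain (Th + 1)"
  shows "AE \<omega> in M. \<exists>D\<ge>0. \<forall>\<^sub>F k in sequentially. L2_set (er \<omega> k) I \<le> D * rr k"
  using AE_er_bounded AE_avg_noise
proof eventually_elim
  case (elim \<omega>)
  define P where "P = n + p"
  have P: "P \<ge> 1" using p_pos by (simp add: P_def)
  have Th0: "Th \<ge> 0" unfolding Th_def by (intro sum_nonneg) auto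
  define U where "U k = avg (\<lambda>t p. nd \<omega> t p + nw \<omega> t p) k" for k
  obtain R where R: "\<And>k. L2_set (er \<omega> k) I \<le> R" using elim(1) by blast
  have R0: "R \<ge> 0" by (rule order.trans[OF L2_set_nonneg R])
  obtain C0 where C0: "C0 \<ge> 0" "\<forall>\<^sub>F k in sequentially. \<forall>p\<in>I. \<bar>U k p\<bar> \<le> C0 * rr k"
    using elim(2) unfolding U_def by blast
  define C where "C = real (card I) * C0"
  have C: "C \<ge> 0" using C0 by (simp add: C_def)
  have UC: "\<forall>\<^sub>F k in sequentially. L2_set (U k) I \<le> C * rr k"
    using C0(2)
  proof eventually_elim
    case (elim k)
    have "L2_set (U k) I \<le> real (card I) * (C0 * rr k)" by (rule L2_set_le_card) (use elim in blast)
    then show ?case by (simp only: C_def mult.assoc)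
  qed
  \<comment> \<open>First pass: a crude polynomial rate, with a contraction constant depending on the path.\<close>
  have "\<exists>D \<kappa>. 0 < \<kappa> \<and> 0 \<le> D \<and> (\<forall>\<^sub>F k in sequentially. L2_set (er \<omega> k) I \<le> D * real k powr (- \<kappa>))"
  proof -
    define \<gamma> where "\<gamma> = gain (R + Th)"
    have \<gamma>0: "\<gamma> > 0" unfolding \<gamma>_def gain_def using A_pos bhi by simp
    define q where "q = 4 * K * (real p * Hb\<^sup>2)"
    have q0: "q > 0" unfolding q_def using K_pos p_pos Hb_pos by simp
    \<comment> \<open>The gain along this path may be too small to support the innovation weight
      \<open>B\<close>. The coercivity estimate accepts a smaller weight, which only lowers the
      contraction constant.\<close>
    define B' where "B' = min B (\<gamma> / q)"
    have B': "0 < B'" "B' \<le> B" unfolding B'_def using B_pos \<gamma>0 q0 by simp_all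
    have "q * B' \<le> q * (\<gamma> / q)" unfolding B'_def using q0 by (intro mult_left_mono min.cobounded2) auto
    then have qB': "q * B' \<le> \<gamma>" using q0 by simp
    define \<mu> where "\<mu> = min (\<gamma> / (8 * K)) (real p * \<delta> * B' / (4 * real CARD('b)))"
    have cardb: "real CARD('b) > 0" by simp
    have "\<gamma> / (8 * K) > 0" using \<gamma>0 K_pos by simp
    moreover have "real p * \<delta> * B' / (4 * real CARD('b)) > 0"
      using p_pos \<delta>_pos B' cardb by (intro divide_pos_pos mult_pos_pos) auto
    ultimately have \<mu>0: "\<mu> > 0" unfolding \<mu>_def by simp
    have "\<mu> \<le> \<gamma> / (8 * K)" unfolding \<mu>_def by (rule min.cobounded1)
    then have \<mu>1: "8 * K * \<mu> \<le> \<gamma>" using K_pos by (simp add: pos_le_divide_eq mult.commute)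
    have \<mu>2: "4 * real CARD('b) * \<mu> \<le> real p * \<delta> * B'"
    proof -
      have "\<mu> \<le> real p * \<delta> * B' / (4 * real CARD('b))" unfolding \<mu>_def by (rule min.cobounded2)
      then have "\<mu> * (4 * real CARD('b)) \<le> real p * \<delta> * B'" using cardb by (subst (asm) pos_le_divide_eq) auto
      then show ?thesis by (simp only: mult.commute)
    qed
    \<comment> \<open>At most 1 / 8, so that \<open>rr\<close>, which decays with an exponent above
      1 / 4, is dominated; and so small that \<kappa> P stays below \<mu>' = \<mu> / 2.\<close>
    define \<kappa> where "\<kappa> = min (1 / 8) (\<mu> / (4 * real P))"
    have \<kappa>: "0 < \<kappa>" "\<kappa> \<le> 1 / 8" unfolding \<kappa>_def using \<mu>0 P by simp_all
    have "\<kappa> * real P \<le> \<mu> / (4 * real P) * real P" unfolding \<kappa>_def by (intro mult_right_mono min.cobounded2) auto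
    then have \<kappa>P: "\<kappa> * real P \<le> \<mu> / 4" using P by simp
    have "(\<lambda>k::nat. rr k * real k powr (1 / 8)) \<longlonglongrightarrow> 0"
    proof (rule Lim_transform_eventually)
      define u where "u = 1 / 8 - (1 / 2 - \<nu>b / 2)"
      have "u < 0" using \<nu>b by (simp add: u_def)
      then show "(\<lambda>k. sqrt (ln (real k)) * real k powr u) \<longlonglongrightarrow> 0" by real_asymp
      show "\<forall>\<^sub>F k in sequentially. sqrt (ln (real k)) * real k powr u = rr k * real k powr (1 / 8)"
        unfolding u_def powr_diff[of _ "1 / 8"] rr_def by simp
    qed
    then have "\<forall>\<^sub>F k::nat in sequentially. rr k * real k powr (1 / 8) < 1" by (rule order_tendstoD) simp
    then have "\<forall>\<^sub>F k in sequentially. L2_set (U k) I \<le> C * real k powr (- \<kappa>)"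
      using UC eventually_ge_at_top[of 1]
    proof eventually_elim
      case (elim k)
      have "rr k \<le> real k powr (- (1 / 8))" using elim by (simp add: powr_minus_divide field_simps)
      also have "\<dots> \<le> real k powr (- \<kappa>)" using elim \<kappa> by (intro powr_mono) auto
      finally show ?case using elim(2) mult_left_mono[OF _ C, of "rr k" "real k powr (- \<kappa>)"] by linarith
    qed
    then obtain t1 where t1: "\<And>k. k \<ge> t1 \<Longrightarrow> L2_set (U k) I \<le> C * real k powr (- \<kappa>)"
      unfolding eventually_sequentially by blast
    have "\<exists>D k2. 0 \<le> D \<and> (\<forall>k\<ge>k2. L2_set (er \<omega> k) I \<le> D * real k powr (- \<kappa>))"
    proof (rule path_rate[where ?t0.0 = "max t1 1" and R = "R + Th" and B' = B' and \<mu> = \<mu> and \<mu>' = "\<mu> / 2" and \<sigma> = "\<kappa> * real P" and C = C])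
      show "\<bar>xs \<omega> k j\<bar> \<le> R + Th" for k j by (rule xs_le[OF R])
      show "8 * K * \<mu> \<le> gain (R + Th)" using \<mu>1 by (simp add: \<gamma>_def)
      show "4 * K * (real p * Hb\<^sup>2) * B' \<le> gain (R + Th)" using qB' by (simp add: q_def \<gamma>_def)
      show "L2_set (avg (\<lambda>t p. nd \<omega> t p + nw \<omega> t p) k) I \<le> C * real k powr (- \<kappa>)" if "max t1 1 \<le> k" for k
        using t1[of k] that by (simp add: U_def)
      show "real (k + j) powr (- \<kappa>) \<le> 2 * real k powr (- \<kappa>)" if "max t1 1 \<le> k" for k j
      proof -
        have "real (k + j) powr (- \<kappa>) \<le> real k powr (- \<kappa>)" using that \<kappa> by (intro powr_mono2') auto
        then show ?thesis using powr_ge_zero[of "real k" "- \<kappa>"] by linarith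
      qed
      show "(1 - \<kappa> * real P / real k) * real k powr (- \<kappa>) \<le> real (k + (n + p)) powr (- \<kappa>)" if "max t1 1 \<le> k" for k
        using powr_minus_shift[of k \<kappa> P] that \<kappa> by (simp add: P_def)
    qed (use R0 Th0 B' \<mu>0 \<kappa>P \<mu>2 C in auto)
    then show ?thesis using \<kappa>(1) unfolding eventually_sequentially by blast
  qed
  then obtain D \<kappa> where D: "0 < \<kappa>" "0 \<le> D" "\<forall>\<^sub>F k in sequentially. L2_set (er \<omega> k) I \<le> D * real k powr (- \<kappa>)" by blast
  have "(\<lambda>k::nat. D * real k powr (- \<kappa>)) \<longlonglongrightarrow> 0" using D(1) by real_asymp
  then have "\<forall>\<^sub>F k::nat in sequentially. D * real k powr (- \<kappa>) < 1" by (rule order_tendstoD) simp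
  then have "\<forall>\<^sub>F k in sequentially. L2_set (er \<omega> k) I \<le> 1" using D(3) by eventually_elim linarith
  moreover have "\<forall>\<^sub>F k::nat in sequentially. ln (real k + real P) \<le> 4 * ln (real k)" by real_asymp
  ultimately have "\<forall>\<^sub>F k in sequentially. L2_set (er \<omega> k) I \<le> 1 \<and> ln (real k + real P) \<le> 4 * ln (real k) \<and> L2_set (U k) I \<le> C * rr k \<and> k \<ge> 2"
    using UC eventually_ge_at_top[of 2] by eventually_elim blast
  then obtain t2 where t2: "\<And>k. k \<ge> t2 \<Longrightarrow> L2_set (er \<omega> k) I \<le> 1 \<and> ln (real k + real P) \<le> 4 * ln (real k) \<and> L2_set (U k) I \<le> C * rr k \<and> k \<ge> 2"
    unfolding eventually_sequentially by blast
  have k2: "k \<ge> 2" if "k \<ge> Suc t2" for k using t2[of k] that by simp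
  define e where "e = 1 / 2 - \<nu>b / 2"
  have e: "0 \<le> e" "e \<le> 1" using \<nu>b by (auto simp: e_def)
  have rr_eq: "rr k = sqrt (ln (real k)) * real k powr (- e)" for k
    by (simp add: rr_def e_def[symmetric] powr_minus_divide)
  \<comment> \<open>The start is \<open>Suc t2\<close> because \<open>xs\<close> at time k reads the
    error at time k - 1.\<close>
  have "\<exists>D k2. 0 \<le> D \<and> (\<forall>k\<ge>k2. L2_set (er \<omega> k) I \<le> D * rr k)"
  proof (rule path_rate[where ?t0.0 = "Suc t2" and R = "Th + 1" and B' = B and \<mu> = "real (n + p + 2)" and \<mu>' = "real (n + p + 1)" and \<sigma> = "real (n + p)" and C = C])
    show "\<bar>xs \<omega> k j\<bar> \<le> Th + 1" if "Suc t2 \<le> k" for k j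
      using xs_le[of \<omega> k 1 j] t2[of "k - 1"] that by simp
    show "L2_set (avg (\<lambda>t p. nd \<omega> t p + nw \<omega> t p) k) I \<le> C * rr k" if "Suc t2 \<le> k" for k
      using t2[of k] that by (simp add: U_def)
    show "0 < rr k" if "Suc t2 \<le> k" for k using k2[OF that] by (simp add: rr_def)
    show "rr (k + j) \<le> 2 * rr k" if k: "Suc t2 \<le> k" and j: "j \<le> n + p" for k j
    proof -
      \<comment> \<open>The logarithm grows inside a block; the factor 4 under the root is the 2 of
        the shift condition.\<close>
      have "sqrt (ln (real (k + j))) \<le> sqrt (4 * ln (real k))"
      proof -
        have "ln (real (k + j)) \<le> ln (real k + real P)" using j k2[OF k] by (simp add: P_def)
        also have "\<dots> \<le> 4 * ln (real k)" using t2[of k] k by simp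
        finally show ?thesis by simp
      qed
      also have "\<dots> = 2 * sqrt (ln (real k))" by (simp add: real_sqrt_mult)
      finally have "sqrt (ln (real (k + j))) * real (k + j) powr (- e) \<le> (2 * sqrt (ln (real k))) * real k powr (- e)"
        using k2[OF k] e by (intro mult_mono powr_mono2') auto
      then show ?thesis by (simp add: rr_eq)
    qed
    show "(1 - real (n + p) / real k) * rr k \<le> rr (k + (n + p))" if k: "Suc t2 \<le> k" for k
    proof -
      have kk: "k \<ge> 2" by (rule k2[OF k])
      \<comment> \<open>Since e \<le> 1 the power loses at most the fraction P / k over a block, and
        the growing logarithm only helps.\<close>
      have "(1 - real P / real k) * real k powr (- e) \<le> (1 - e * real P / real k) * real k powr (- e)"
      proof (rule mult_right_mono)
        have "e * real P / real k \<le> 1 * real P / real k" using e by (intro divide_right_mono mult_right_mono) auto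
        then show "1 - real P / real k \<le> 1 - e * real P / real k" by simp
      qed simp
      also have "\<dots> \<le> real (k + P) powr (- e)" by (rule powr_minus_shift) (use kk e in auto)
      finally have "sqrt (ln (real k)) * ((1 - real P / real k) * real k powr (- e)) \<le> sqrt (ln (real k)) * real (k + P) powr (- e)"
        using kk by (intro mult_left_mono) auto
      also have "\<dots> \<le> sqrt (ln (real (k + P))) * real (k + P) powr (- e)"
        using kk by (intro mult_right_mono) auto
      finally show ?thesis by (simp add: rr_eq P_def mult_ac)
    qed
  qed (use Th0 B_pos c1 c2 c3 C in auto)
  then show ?case unfolding eventually_sequentially by blast
qed

end

section \<open>Choice of the step-size constants and transfer to the algorithm\<close>

theorem theorem6p1:
  fixes M :: "'a measure"
    and n :: nat
    and m :: "'v::finite \<Rightarrow> nat"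
    and a :: "'v \<Rightarrow> 'v \<Rightarrow> real"
    and H :: "'v \<Rightarrow> nat \<Rightarrow> nat \<Rightarrow> nat \<Rightarrow> real"
    and \<theta> :: "nat \<Rightarrow> real"
    and w :: "'v \<Rightarrow> nat \<Rightarrow> 'a \<Rightarrow> nat \<Rightarrow> real"
    and d :: "'v \<Rightarrow> nat \<Rightarrow> 'a \<Rightarrow> real"
    and \<theta>0 :: "'v \<Rightarrow> nat \<Rightarrow> real"
    and \<nu> b :: "'v \<Rightarrow> 'v \<Rightarrow> real"
  defines "E \<equiv> {(i, j). a i j > 0}"
    and "F \<equiv> (\<lambda>k. gen_sigma M ({(\<lambda>\<omega>. w i t \<omega> r) | i t r. 1 \<le> t \<and> t \<le> k \<and> r < m i}
                                 \<union> {d i t | i t. 1 \<le> t \<and> t \<le> k}))"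
    and "Fw \<equiv> (\<lambda>k. gen_sigma M {(\<lambda>\<omega>. w i t \<omega> r) | i t r. 1 \<le> t \<and> t \<le> k \<and> r < m i})"
    and "y \<equiv> (\<lambda>\<omega> i k r. mat_vec n (H i k) \<theta> r + w i k \<omega> r)"
  assumes M: "prob_space M"
    and n_pos: "0 < n"
    (* graph *)
    and a_sym: "\<And>i j. a i j = a j i"
    and a_nonneg: "\<And>i j. a i j \<ge> 0"
    and a_loop: "\<And>i. a i i = 0"
    (* (A1) *)
    and A1_bound: "\<exists>Hb>0. \<forall>i k. k \<ge> 1 \<longrightarrow> mnorm (m i) n (H i k) \<le> Hb"
    and A1_pe: "\<exists>p::nat. p \<ge> 1 \<and> (\<exists>\<delta>>0. \<forall>k\<ge>1. \<forall>x.
                  (\<Sum>t\<in>{k..<k+p}. \<Sum>i\<in>UNIV. (vnorm (m i) (mat_vec n (H i t) x))\<^sup>2)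
                    \<ge> real p * \<delta> * (vnorm n x)\<^sup>2)"
    (* (A2) *)
    and w_meas: "\<And>i k r. (\<lambda>\<omega>. w i k \<omega> r) \<in> borel_measurable M"
    and w_int: "\<And>i k r. k \<ge> 1 \<Longrightarrow> r < m i \<Longrightarrow> integrable M (\<lambda>\<omega>. w i k \<omega> r)"
    and w_mds: "\<And>i k r. k \<ge> 1 \<Longrightarrow> r < m i \<Longrightarrow>
                  AE \<omega> in M. real_cond_exp M (F (k - 1)) (\<lambda>\<omega>. w i k \<omega> r) \<omega> = 0"
    and w_moment: "\<exists>\<rho>>2. AE \<omega> in M.
                  (SUP ik \<in> UNIV \<times> {1..}. nn_cond_exp M (Fw (snd ik - 1))
                      (\<lambda>\<omega>. ennreal (vnorm (m (fst ik)) (w (fst ik) (snd ik) \<omega>) powr \<rho>)) \<omega>) < \<infinity>"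
    (* (A3) *)
    and A3: "rank (laplacian a) = CARD('v) - 1"
    (* (A4) *)
    and d_lap: "\<And>i k. k \<ge> 1 \<Longrightarrow> distributed M lborel (d i k) (\<lambda>x. ennreal (exp (- \<bar>x\<bar>) / 2))"
    and d_indep: "prob_space.indep_sets M
                   (\<lambda>j. case j of Inl (i, k) \<Rightarrow> sets (gen_sigma M {d i k})
                               | Inr () \<Rightarrow> sets (gen_sigma M {(\<lambda>\<omega>. w i t \<omega> r) | i t r. 1 \<le> t \<and> r < m i}))
                   (Inl ` {(i, k). k \<ge> 1} \<union> {Inr ()})"
    (* algorithm coefficients *)
    and \<nu>_sym: "\<And>i j. (i, j) \<in> E \<Longrightarrow> \<nu> i j = \<nu> j i"
    and \<nu>_range: "\<And>i j. (i, j) \<in> E \<Longrightarrow> 0 \<le> \<nu> i j \<and> \<nu> i j < 1/2"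
    and b_sym: "\<And>i j. (i, j) \<in> E \<Longrightarrow> b i j = b j i"
    and b_pos: "\<And>i j. (i, j) \<in> E \<Longrightarrow> b i j > 0"
  shows "\<exists>(\<alpha> :: 'v \<Rightarrow> 'v \<Rightarrow> nat \<Rightarrow> real) (\<beta> :: 'v \<Rightarrow> nat \<Rightarrow> real).
           (\<forall>(i, j)\<in>E. \<forall>k\<ge>1. \<alpha> i j k > 0 \<and> \<alpha> i j k = \<alpha> j i k)
         \<and> (\<forall>i. \<forall>k\<ge>1. \<beta> i k > 0)
         \<and> (\<forall>(i, j)\<in>E. summable (\<lambda>k. (\<alpha> i j k)\<^sup>2)
                       \<and> bdd_above ((\<lambda>k. \<alpha> i j (k + 1) / \<alpha> i j k) ` {1..}))
         \<and> (\<forall>i. summable (\<lambda>k. (\<beta> i k)\<^sup>2)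
                 \<and> bdd_above ((\<lambda>k. \<beta> i (k + 1) / \<beta> i k) ` {1..}))
         \<and> \<not> summable (\<lambda>k. Min ({\<alpha> i j k / real k powr \<nu> i j | i j. (i, j) \<in> E}
                                 \<union> {\<beta> i k | i. True}))
         \<and> (\<forall>i. AE \<omega> in M. \<exists>C. \<forall>k\<ge>2.
               vnorm n (\<lambda>c. sc_est n m a \<nu> b \<alpha> \<beta> H \<theta>0 (y \<omega>) (\<lambda>i k. d i k \<omega>) k i c - \<theta> c)
                 \<le> C * sqrt (ln (real k))
                     / real k powr (1/2 - Max (insert 0 {\<nu> i j | i j. (i, j) \<in> E}) / 2))"
proof -
  interpret prob_space M by (rule M)
  obtain Hb where Hb: "Hb > 0" "\<And>i k. k \<ge> 1 \<Longrightarrow> mnorm (m i) n (H i k) \<le> Hb" using A1_bound by blast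
  obtain p :: nat and \<delta> where p: "p \<ge> 1" and \<delta>: "\<delta> > 0" and pe: "\<And>k x. k \<ge> 1 \<Longrightarrow>
      real p * \<delta> * (vnorm n x)\<^sup>2 \<le> (\<Sum>t\<in>{k..<k+p}. \<Sum>i\<in>UNIV. (vnorm (m i) (mat_vec n (H i t) x))\<^sup>2)"
    using A1_pe by blast
  obtain \<rho> where \<rho>: "\<rho> > 2" and mom: "AE \<omega> in M. (SUP ik \<in> UNIV \<times> {1..}. nn_cond_exp M (Fw (snd ik - 1))
      (\<lambda>\<omega>. ennreal (vnorm (m (fst ik)) (w (fst ik) (snd ik) \<omega>) powr \<rho>)) \<omega>) < \<infinity>"
    using w_moment by blast
  have E_iff: "(i, j) \<in> E \<longleftrightarrow> a i j > 0" for i j by (simp add: E_def)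
  \<comment> \<open>The element 0 covers a network without edges; otherwise it leaves the maximum
    unchanged, as all coefficients on edges are nonnegative.\<close>
  define \<nu>s where "\<nu>s = insert 0 {\<nu> i j | i j. (i, j) \<in> E}"
  define \<nu>b where "\<nu>b = Max \<nu>s"
  have "{\<nu> i j | i j. (i, j) \<in> E} = (\<lambda>(i, j). \<nu> i j) ` E" by auto
  then have fin: "finite \<nu>s" by (simp add: \<nu>s_def)
  have \<nu>b_ge: "\<nu> i j \<le> \<nu>b" if "a i j > 0" for i j
    unfolding \<nu>b_def by (rule Max_ge[OF fin]) (use that E_iff in \<open>auto simp: \<nu>s_def\<close>)
  have \<nu>b0: "0 \<le> \<nu>b" unfolding \<nu>b_def by (rule Max_ge[OF fin]) (simp add: \<nu>s_def)
  have \<nu>b_half: "\<nu>b < 1 / 2"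
    unfolding \<nu>b_def using fin \<nu>_range by (subst Max_less_iff) (auto simp: \<nu>s_def)
  \<comment> \<open>The element 1 keeps the set nonempty when there are no edges; only bounds on b
    are extracted from it.\<close>
  define bs where "bs = insert 1 ((\<lambda>(i, j). b i j) ` E)"
  define blo where "blo = Min bs"
  define bhi where "bhi = Max bs"
  have finb: "finite bs" by (simp add: bs_def)
  have blo: "blo > 0" unfolding blo_def using finb b_pos by (subst Min_gr_iff) (auto simp: bs_def)
  have "1 \<le> bhi" unfolding bhi_def by (rule Max_ge[OF finb]) (simp add: bs_def)
  then have bhi: "bhi > 0" by simp
  have b_bounds: "blo \<le> b i j \<and> b i j \<le> bhi" if "a i j > 0" for i j
  proof -
    have "b i j \<in> bs" using that by (force simp: bs_def E_iff)
    then show ?thesis unfolding blo_def bhi_def using finb by simp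
  qed
  \<comment> \<open>Any node can serve as reference; \<open>undefined\<close> merely names
    one.\<close>
  obtain K where K: "K > 0" "\<And>u::'v \<Rightarrow> real. (\<Sum>i\<in>UNIV. (u i - u undefined)\<^sup>2) \<le> K * (\<Sum>i\<in>UNIV. \<Sum>j\<in>UNIV. a i j * (u i - u j)\<^sup>2)"
    using connected_poincare[OF a_sym a_nonneg A3, of undefined] by blast
  \<comment> \<open>These constants make the blocks of length \<open>n + p\<close> contract at rate \<open>n + p + 2\<close> as soon as the
    estimates are within distance 1 of \<open>\<theta>\<close>.\<close>
  define B where "B = 4 * real CARD('v) * real (n + p + 2) / (real p * \<delta>)"
  have p\<delta>: "real p * \<delta> > 0" using p \<delta> by simp
  have cardv: "real CARD('v) > 0" by simp
  have B: "B > 0" unfolding B_def by (rule divide_pos_pos[OF _ p\<delta>]) (use cardv in simp)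
  have B_eq: "real p * \<delta> * B = 4 * real CARD('v) * real (n + p + 2)" unfolding B_def using p \<delta> by simp
  \<comment> \<open>The guaranteed gain at radius \<open>Th + 1\<close> per unit of
    \<open>A\<close>.\<close>
  define g where "g = exp (- ((\<Sum>c<n. \<bar>\<theta> c\<bar>) + 1) / blo) / bhi"
  have g: "g > 0" unfolding g_def using bhi by simp
  \<comment> \<open>Makes \<open>A * g\<close> the sum of the two lower bounds demanded of the gain;
    both summands are positive, so each bound holds.\<close>
  define A where "A = (8 * K * real (n + p + 2) + 4 * K * (real p * Hb\<^sup>2) * B) / g"
  have t1: "8 * K * real (n + p + 2) > 0" and t2: "4 * K * (real p * Hb\<^sup>2) * B > 0" using K B Hb p by simp_all
  have A: "A > 0" unfolding A_def by (rule divide_pos_pos[OF add_pos_pos[OF t1 t2] g])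
  have A_eq: "A * g = 8 * K * real (n + p + 2) + 4 * K * (real p * Hb\<^sup>2) * B" unfolding A_def using g by simp
  have Fw_eq: "Fw = wfilt M m w" unfolding Fw_def wfilt_def ..
  have F_eq: "F = wdfilt M m w d" unfolding F_def wdfilt_def ..
  interpret S: sc_network_bounds M n m a H \<theta> w d \<theta>0 \<nu> b A B Hb \<rho> \<nu>b blo bhi K \<delta> p undefined
  proof unfold_locales
    show "AE \<omega> in M. real_cond_exp M (wdfilt M m w d (k - 1)) (\<lambda>\<omega>. w i k \<omega> r) \<omega> = 0" if "k \<ge> 1" "r < m i" for i k r
      using w_mds[OF that] unfolding F_eq .
    show "AE \<omega> in M. (SUP ik \<in> UNIV \<times> {1..}. nn_cond_exp M (wfilt M m w (snd ik - 1))
       (\<lambda>\<omega>. ennreal (vnorm (m (fst ik)) (w (fst ik) (snd ik) \<omega>) powr \<rho>)) \<omega>) < \<infinity>"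
      using mom unfolding Fw_eq .
    show "\<And>i j. a i j > 0 \<Longrightarrow> \<nu> i j = \<nu> j i" using \<nu>_sym E_iff by blast
    show "\<And>i j. a i j > 0 \<Longrightarrow> 0 \<le> \<nu> i j" using \<nu>_range E_iff by blast
    show "\<And>i j. a i j > 0 \<Longrightarrow> b i j = b j i" using b_sym E_iff by blast
    show "\<And>i j. a i j > 0 \<Longrightarrow> b i j > 0" using b_pos E_iff by blast
  qed (fact n_pos a_sym a_nonneg A B Hb w_meas w_int \<rho> d_lap d_indep \<nu>b_ge \<nu>b0 \<nu>b_half blo bhi b_bounds K \<delta> p pe)+
  define \<alpha> where "\<alpha> = (\<lambda>i j k. A * real k powr (\<nu> i j - 1))"
  define \<beta> where "\<beta> = (\<lambda>(i::'v) k. B / real k)"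
  have "AE \<omega> in M. \<exists>D\<ge>0. \<forall>\<^sub>F k in sequentially. L2_set (S.er \<omega> k) (UNIV \<times> {..<n}) \<le> D * S.rr k"
  proof (rule S.AE_rate)
    have gain: "S.gain (S.Th + 1) = A * g" unfolding S.gain_def S.Th_def g_def ..
    show "8 * K * real (n + p + 2) \<le> S.gain (S.Th + 1)" "4 * K * (real p * Hb\<^sup>2) * B \<le> S.gain (S.Th + 1)"
      unfolding gain A_eq using t1 t2 by linarith+
    show "4 * real CARD('v) * real (n + p + 2) \<le> real p * \<delta> * B" unfolding B_eq ..
  qed
  then have rate: "AE \<omega> in M. \<exists>C. \<forall>k\<ge>2.
       vnorm n (\<lambda>c. sc_est n m a \<nu> b \<alpha> \<beta> H \<theta>0 (y \<omega>) (\<lambda>i k. d i k \<omega>) k i c - \<theta> c)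
         \<le> C * sqrt (ln (real k)) / real k powr (1/2 - \<nu>b / 2)" for i
  proof eventually_elim
    case (elim \<omega>)
    then obtain D where D: "D \<ge> 0" "\<forall>\<^sub>F k in sequentially. L2_set (S.er \<omega> k) (UNIV \<times> {..<n}) \<le> D * S.rr k" by blast
    define v where "v k = vnorm n (\<lambda>c. sc_est n m a \<nu> b \<alpha> \<beta> H \<theta>0 (y \<omega>) (\<lambda>i k. d i k \<omega>) k i c - \<theta> c)" for k
    have v_le: "v k \<le> L2_set (S.er \<omega> k) (UNIV \<times> {..<n})" for k
    proof -
      have v_eq: "v k = sqrt (\<Sum>c<n. (S.er \<omega> k (i, c))\<^sup>2)"
        unfolding v_def vnorm_def S.er_def S.est_def \<alpha>_def \<beta>_def y_def by simp
      have "(\<Sum>c<n. (S.er \<omega> k (i, c))\<^sup>2) \<le> (\<Sum>i\<in>UNIV. \<Sum>c<n. (S.er \<omega> k (i, c))\<^sup>2)"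
        by (rule member_le_sum[where f = "\<lambda>i. \<Sum>c<n. (S.er \<omega> k (i, c))\<^sup>2"]) (auto intro!: sum_nonneg)
      then show ?thesis unfolding v_eq L2_set_def sum_pairs by simp
    qed
    have rr_pos: "S.rr k > 0" if "k \<ge> 2" for k using that by (simp add: S.rr_def)
    obtain k0 where k0: "\<And>k. k \<ge> k0 \<Longrightarrow> L2_set (S.er \<omega> k) (UNIV \<times> {..<n}) \<le> D * S.rr k"
      using D(2) unfolding eventually_sequentially by blast
    \<comment> \<open>The rate vanishes at k = 1, so quotients are formed from k = 2 on, with 0 as a
      harmless default below. The finitely many times before \<open>k0\<close> only enlarge the
      constant.\<close>
    have "(if k \<ge> 2 then v k / S.rr k else 0) \<le> D" if "k \<ge> k0" for k
      using k0[OF that] v_le[of k] rr_pos[of k] D(1) by (auto simp: divide_le_eq)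
    then obtain C where C: "\<And>k. (if k \<ge> 2 then v k / S.rr k else 0) \<le> C"
      using eventually_bounded_imp_bounded[of k0 "\<lambda>k. if k \<ge> 2 then v k / S.rr k else 0" D] by blast
    have "v k \<le> C * sqrt (ln (real k)) / real k powr (1/2 - \<nu>b / 2)" if "k \<ge> 2" for k
    proof -
      have "v k / S.rr k \<le> C" using C[of k] that by simp
      then have "v k \<le> C * S.rr k" using rr_pos[OF that] by (simp add: divide_le_eq)
      then show ?thesis by (simp add: S.rr_def)
    qed
    then show ?case unfolding v_def by blast
  qed
  show ?thesis
  proof (intro exI[of _ \<alpha>] exI[of _ \<beta>] conjI)
    show "\<forall>(i, j)\<in>E. \<forall>k\<ge>1. \<alpha> i j k > 0 \<and> \<alpha> i j k = \<alpha> j i k"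
    proof clarify
      fix i j and k :: nat assume "(i, j) \<in> E" "1 \<le> k"
      then show "\<alpha> i j k > 0 \<and> \<alpha> i j k = \<alpha> j i k" using A \<nu>_sym[of i j] by (simp add: \<alpha>_def)
    qed
    show "\<forall>i. \<forall>k\<ge>1. \<beta> i k > 0" using B by (simp add: \<beta>_def)
    show "\<forall>(i, j)\<in>E. summable (\<lambda>k. (\<alpha> i j k)\<^sup>2) \<and> bdd_above ((\<lambda>k. \<alpha> i j (k + 1) / \<alpha> i j k) ` {1..})"
    proof (clarify, intro conjI)
      fix i j assume ij: "(i, j) \<in> E"
      have \<nu>ij: "\<nu> i j < 1 / 2" using \<nu>_range[OF ij] by simp
      have "(\<lambda>k. (\<alpha> i j k)\<^sup>2) = (\<lambda>k. A\<^sup>2 * real k powr (2 * \<nu> i j - 2))"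
        by (simp add: \<alpha>_def power_mult_distrib power2_eq_square[of "real _ powr _"] powr_add[symmetric])
      then show "summable (\<lambda>k. (\<alpha> i j k)\<^sup>2)" using \<nu>ij by (simp add: summable_real_powr_iff)
      show "bdd_above ((\<lambda>k. \<alpha> i j (k + 1) / \<alpha> i j k) ` {1..})"
      proof (rule bdd_aboveI2[where M = 1])
        fix k :: nat assume k: "k \<in> {1..}"
        then have "real (k + 1) powr (\<nu> i j - 1) \<le> real k powr (\<nu> i j - 1)" using \<nu>ij by (intro powr_mono2') auto
        then show "\<alpha> i j (k + 1) / \<alpha> i j k \<le> 1" using A k by (simp add: \<alpha>_def divide_le_eq)
      qed
    qed
    show "\<forall>i. summable (\<lambda>k. (\<beta> i k)\<^sup>2) \<and> bdd_above ((\<lambda>k. \<beta> i (k + 1) / \<beta> i k) ` {1..})"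
    proof (intro allI conjI)
      fix i
      have "summable (\<lambda>k. B\<^sup>2 * inverse (real k ^ 2))" by (intro summable_mult inverse_power_summable) auto
      then show "summable (\<lambda>k. (\<beta> i k)\<^sup>2)" by (simp add: \<beta>_def power_divide inverse_eq_divide)
      show "bdd_above ((\<lambda>k. \<beta> i (k + 1) / \<beta> i k) ` {1..})"
        by (rule bdd_aboveI2[where M = 1]) (use B in \<open>auto simp: \<beta>_def divide_le_eq\<close>)
    qed
    show "\<not> summable (\<lambda>k. Min ({\<alpha> i j k / real k powr \<nu> i j | i j. (i, j) \<in> E} \<union> {\<beta> i k | i. True}))"
    proof
      define S where "S k = {\<alpha> i j k / real k powr \<nu> i j | i j. (i, j) \<in> E} \<union> {\<beta> i k | i. True}" for k
      assume "summable (\<lambda>k. Min ({\<alpha> i j k / real k powr \<nu> i j | i j. (i, j) \<in> E} \<union> {\<beta> i k | i. True}))"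
      then have sm: "summable (\<lambda>k. Min (S k))" unfolding S_def .
      have S_im: "S k = (\<lambda>(i, j). \<alpha> i j k / real k powr \<nu> i j) ` E \<union> range (\<lambda>i. \<beta> i k)" for k unfolding S_def by auto
      have "min A B * inverse (real k) \<le> Min (S k)" if "k \<ge> 1" for k
      proof -
        have "min A B * inverse (real k) \<le> x" if "x \<in> S k" for x
        proof -
          \<comment> \<open>Division by \<open>k powr \<nu>\<close> turns every edge step size into
            A / k, so the minimum is bounded below by a harmonic term.\<close>
          have "x = A / real k \<or> x = B / real k"
            using that \<open>k \<ge> 1\<close> unfolding S_im by (auto simp: \<alpha>_def \<beta>_def powr_diff)
          then show ?thesis using \<open>k \<ge> 1\<close> by (auto simp: inverse_eq_divide intro!: divide_right_mono)
        qed
        moreover have "finite (S k)" "S k \<noteq> {}" unfolding S_im by auto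
        ultimately show ?thesis by simp
      qed
      moreover have "0 \<le> min A B" using A B by simp
      ultimately have "summable (\<lambda>k. min A B * inverse (real k))"
        by (intro summable_comparison_test'[OF sm, of 1]) auto
      then have "summable (\<lambda>k. inverse (real k))" using A B by (subst (asm) summable_cmult_iff) auto
      then show False using not_summable_harmonic[where 'a = real] by simp
    qed
    show "\<forall>i. AE \<omega> in M. \<exists>C. \<forall>k\<ge>2.
       vnorm n (\<lambda>c. sc_est n m a \<nu> b \<alpha> \<beta> H \<theta>0 (y \<omega>) (\<lambda>i k. d i k \<omega>) k i c - \<theta> c)
         \<le> C * sqrt (ln (real k)) / real k powr (1/2 - Max (insert 0 {\<nu> i j | i j. (i, j) \<in> E}) / 2)"
      using rate unfolding \<nu>b_def \<nu>s_def by blast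
  qed
qed

end
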